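(* Let $l\ge3$ and $-l\le m\le l$ with $(l,m)\neq(3,0)$. The sectional curvature of $\mathrm{SDiff}(\mathbb S^2)$ in the direction of $e^0_3$ and $e^m_l$ is $$C(e^0_3,e^m_l)=-\frac{525m^2}{32\pi}\Big(3\gamma^m_l-2\Big(\frac{12}{l(l+1)}+1\Big)\varrho^m_l-\Big(\frac{12}{l(l+1)}-1\Big)^2\vartheta^m_l\Big),$$ where, writing $A=\frac{((l+2)^2-m^2)((l+1)^2-m^2)}{(2l+1)(2l+3)^2(2l+5)}$, $B=\frac{((l-1)^2-m^2)(l^2-m^2)}{(2l-3)(2l-1)^2(2l+1)}$, $D=\Big(\frac{l^2-m^2}{(2l+1)(2l-1)}+\frac{(l+1)^2-m^2}{(2l+3)(2l+1)}-\frac15\Big)^2$, $r_1=\frac{l(l+1)}{(l+2)(l+3)}$, $r_2=\frac{l(l+1)}{(l-2)(l-1)}$: $$\vartheta^m_l=\tfrac18(Ar_1+Br_2+D),\quad\varrho^m_l=\tfrac18(A+B+D),\quad\gamma^m_l=\tfrac18\big(A/r_1+B/r_2+D\big).$$ For odd $l$ this is also the sectional curvature of $\mathrm{SDiff}(\mathbb{RP}^2)$ in the corresponding direction (with the isometric normalization).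
   Context: $\mathbb S^2$ with spherical coordinates $(\theta,\phi)$, metric $d\theta^2+\sin^2\theta d\phi^2$, area form $\mu=\sin\theta\,d\theta\wedge d\phi$; $\mathrm{SDiff}(\mathbb S^2)$ carries the right-invariant $L^2$ metric $\langle u,v\rangle=\int_{\mathbb S^2}g(u,v)\mu$ on divergence-free fields. Spherical harmonics $Y^m_l=\big[\frac{(l-m)!}{(l+m)!}\frac{2l+1}{4\pi}\big]^{1/2}e^{im\phi}P^m_l(\cos\theta)$ with $P^m_l(z)=(1-z^2)^{m/2}\frac1{2^ll!}\frac{d^{l+m}}{dz^{l+m}}(z^2-1)^l$ (no Condon–Shortley phase). $e^m_l=\mathrm{sgrad}\big(Y^m_l/\sqrt{l(l+1)}\big)$ with $\mathrm{sgrad}f=\frac1{\sin\theta}(\partial_\phi f\partial_\theta-\partial_\theta f\partial_\phi)$; these form an orthonormal basis of complexified divergence-free fields for the Hermitian product $\langle u,v\rangle=\int(u,\bar v)\mu$. In particular $e^0_3=\frac18\sqrt{21/\pi}(5\cos^2\theta-1)\partial_\phi$. Curvature: $\nabla_uv=\frac12([u,v]-B(u,v)-B(v,u))$, $\langle B(u,v),w\rangle=\langle u,[v,w]\rangle$, $R(u,v)w=-\nabla_u\nabla_vw+\nabla_v\nabla_uw+\nabla_{[u,v]}w$, extended complex-linearly; for complex directions $C(u,v)=\langle R(u,v)u,v\rangle/(\|u\|^2\|v\|^2-|\langle u,v\rangle|^2)$ with the Hermitian product. $\mathbb{RP}^2=\mathbb S^2/I$, $I(\theta,\phi)=(\pi-\theta,\pi+\phi)$;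 $\mathrm{SDiff}(\mathbb{RP}^2)$ is identified with the $I$-commuting subgroup of $\mathrm{SDiff}(\mathbb S^2)$ with the induced metric (isometric normalization). *)

theory Defs
  imports "HOL-Analysis.Analysis"
begin

type_synonym vec = "real^3"
type_synonym vf = "vec \<Rightarrow> vec"

text \<open>C-infinity on an open set U: F lies in a family of functions, each differentiable
  on U, that is closed under taking directional derivatives.\<close>
definition smooth_on :: "vec set \<Rightarrow> vf \<Rightarrow> bool" where
  "smooth_on U F \<longleftrightarrow> (\<exists>S. F \<in> S \<and> (\<forall>g\<in>S. g differentiable_on U \<and>
      (\<forall>v. (\<lambda>x. frechet_derivative g (at x) v) \<in> S)))"

definition S2 :: "vec set" where "S2 = sphere 0 1"

text \<open>A field on the sphere (only its values on S2 matter) is smooth if it is the restriction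
  of a map that is smooth on an open neighbourhood of S2.\<close>
definition smooth_ext :: "vf \<Rightarrow> vf \<Rightarrow> bool" where
  "smooth_ext X F \<longleftrightarrow> (\<exists>U. open U \<and> S2 \<subseteq> U \<and> smooth_on U F) \<and> (\<forall>p\<in>S2. F p = X p)"

definition ext :: "vf \<Rightarrow> vf" where "ext X = (SOME F. smooth_ext X F)"

definition Dv :: "vf \<Rightarrow> vec \<Rightarrow> vec \<Rightarrow> vec" where
  "Dv X p v = frechet_derivative (ext X) (at p) v"

text \<open>surface divergence of a tangent field on S2: tr((I - p p^T) DX(p))\<close>
definition sdiv :: "vf \<Rightarrow> vec \<Rightarrow> real" where
  "sdiv X p = (\<Sum>i\<in>UNIV. Dv X p (axis i 1) $ i) - p \<bullet> Dv X p p"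

definition sdiff_S2 :: "vf set" where
  "sdiff_S2 = {X. (\<exists>F. smooth_ext X F) \<and> (\<forall>p\<in>S2. X p \<bullet> p = 0) \<and> (\<forall>p\<in>S2. sdiv X p = 0)}"

text \<open>Lie algebra of SDiff(RP2): fields commuting with the antipodal map I(p) = -p,
  i.e. X(I p) = dI (X p) = - X p.\<close>
definition sdiff_RP2 :: "vf set" where
  "sdiff_RP2 = {X \<in> sdiff_S2. \<forall>p\<in>S2. X (- p) = - X p}"

text \<open>Lie bracket of vector fields (the curvature below is invariant under a global sign
  change of the bracket)\<close>
definition br :: "vf \<Rightarrow> vf \<Rightarrow> vf" where
  "br X Y = (\<lambda>p. Dv Y p (X p) - Dv X p (Y p))"

definition sph :: "real \<Rightarrow> real \<Rightarrow> vec" where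
  "sph \<theta> \<phi> = vector [sin \<theta> * cos \<phi>, sin \<theta> * sin \<phi>, cos \<theta>]"

definition ip :: "vf \<Rightarrow> vf \<Rightarrow> real" where
  "ip X Y = integral (cbox (0,0) (pi, 2*pi))
      (\<lambda>(\<theta>,\<phi>). (X (sph \<theta> \<phi>) \<bullet> Y (sph \<theta> \<phi>)) * sin \<theta>)"

definition Bop :: "vf set \<Rightarrow> vf \<Rightarrow> vf \<Rightarrow> vf" where
  "Bop g u v = (SOME b. b \<in> g \<and> (\<forall>w\<in>g. ip b w = ip u (br v w)))"

section \<open>Complexification (pairs (real part, imaginary part))\<close>

type_synonym cvf = "vf \<times> vf"

definition fadd :: "vf \<Rightarrow> vf \<Rightarrow> vf" where "fadd X Y = (\<lambda>p. X p + Y p)"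
definition fsub :: "vf \<Rightarrow> vf \<Rightarrow> vf" where "fsub X Y = (\<lambda>p. X p - Y p)"
definition fscale :: "real \<Rightarrow> vf \<Rightarrow> vf" where "fscale r X = (\<lambda>p. r *\<^sub>R X p)"

definition cadd :: "cvf \<Rightarrow> cvf \<Rightarrow> cvf" where
  "cadd u v = (fadd (fst u) (fst v), fadd (snd u) (snd v))"
definition csub :: "cvf \<Rightarrow> cvf \<Rightarrow> cvf" where
  "csub u v = (fsub (fst u) (fst v), fsub (snd u) (snd v))"
definition cneg :: "cvf \<Rightarrow> cvf" where
  "cneg u = (fscale (-1) (fst u), fscale (-1) (snd u))"
definition cscale :: "real \<Rightarrow> cvf \<Rightarrow> cvf" where
  "cscale r u = (fscale r (fst u), fscale r (snd u))"

definition cbil :: "(vf \<Rightarrow> vf \<Rightarrow> vf) \<Rightarrow> cvf \<Rightarrow> cvf \<Rightarrow> cvf" where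
  "cbil f u v = (fsub (f (fst u) (fst v)) (f (snd u) (snd v)),
                 fadd (f (fst u) (snd v)) (f (snd u) (fst v)))"

definition cbr :: "cvf \<Rightarrow> cvf \<Rightarrow> cvf" where "cbr = cbil br"
definition cB :: "vf set \<Rightarrow> cvf \<Rightarrow> cvf \<Rightarrow> cvf" where "cB g = cbil (Bop g)"

definition cnabla :: "vf set \<Rightarrow> cvf \<Rightarrow> cvf \<Rightarrow> cvf" where
  "cnabla g u v = cscale (1/2) (csub (csub (cbr u v) (cB g u v)) (cB g v u))"

definition cR :: "vf set \<Rightarrow> cvf \<Rightarrow> cvf \<Rightarrow> cvf \<Rightarrow> cvf" where
  "cR g u v w = cadd (cadd (cneg (cnabla g u (cnabla g v w))) (cnabla g v (cnabla g u w)))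
                     (cnabla g (cbr u v) w)"

definition herm :: "cvf \<Rightarrow> cvf \<Rightarrow> complex" where
  "herm u v = Complex (ip (fst u) (fst v) + ip (snd u) (snd v))
                      (ip (snd u) (fst v) - ip (fst u) (snd v))"

definition sec_curv :: "vf set \<Rightarrow> cvf \<Rightarrow> cvf \<Rightarrow> complex" where
  "sec_curv g u v = herm (cR g u v u) v /
     complex_of_real (Re (herm u u) * Re (herm v v) - (cmod (herm u v))^2)"

definition assocP :: "nat \<Rightarrow> int \<Rightarrow> real \<Rightarrow> real" where
  "assocP l m z = (1 - z^2) powr (of_int m / 2) * (1 / (2^l * fact l)) *
      (deriv ^^ nat (int l + m)) (\<lambda>t. (t^2 - 1)^l) z"

definition Ylm :: "nat \<Rightarrow> int \<Rightarrow> real \<Rightarrow> real \<Rightarrow> complex" where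
  "Ylm l m \<theta> \<phi> = complex_of_real (sqrt (fact (nat (int l - m)) / fact (nat (int l + m))
        * (2 * real l + 1) / (4 * pi))) * cis (of_int m * \<phi>) * complex_of_real (assocP l m (cos \<theta>))"

definition dth :: "real \<Rightarrow> real \<Rightarrow> vec" where
  "dth \<theta> \<phi> = vector [cos \<theta> * cos \<phi>, cos \<theta> * sin \<phi>, - sin \<theta>]"
definition dph :: "real \<Rightarrow> real \<Rightarrow> vec" where
  "dph \<theta> \<phi> = vector [- sin \<theta> * sin \<phi>, sin \<theta> * cos \<phi>, 0]"

definition sgrad_sph :: "(real \<Rightarrow> real \<Rightarrow> real) \<Rightarrow> real \<Rightarrow> real \<Rightarrow> vec" where
  "sgrad_sph h \<theta> \<phi> = (1 / sin \<theta>) *\<^sub>R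
     (deriv (\<lambda>t. h \<theta> t) \<phi> *\<^sub>R dth \<theta> \<phi> - deriv (\<lambda>t. h t \<phi>) \<theta> *\<^sub>R dph \<theta> \<phi>)"

definition poles :: "vec set" where "poles = {p \<in> S2. p $ 3 = 1 \<or> p $ 3 = -1}"

definition field_of_sph :: "(real \<Rightarrow> real \<Rightarrow> vec) \<Rightarrow> vf" where
  "field_of_sph W p =
     (if p \<in> poles then Lim (at p within (S2 - poles)) (\<lambda>q. W (arccos (q $ 3)) (Arg (Complex (q $ 1) (q $ 2))))
      else W (arccos (p $ 3)) (Arg (Complex (p $ 1) (p $ 2))))"

definition e :: "nat \<Rightarrow> int \<Rightarrow> cvf" where
  "e l m = (field_of_sph (sgrad_sph (\<lambda>\<theta> \<phi>. Re (Ylm l m \<theta> \<phi>) / sqrt (real l * (real l + 1)))),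
            field_of_sph (sgrad_sph (\<lambda>\<theta> \<phi>. Im (Ylm l m \<theta> \<phi>) / sqrt (real l * (real l + 1)))))"

definition cA :: "nat \<Rightarrow> int \<Rightarrow> real" where
  "cA l m = (((real l + 2)^2 - (of_int m)^2) * ((real l + 1)^2 - (of_int m)^2)) /
            ((2 * real l + 1) * (2 * real l + 3)^2 * (2 * real l + 5))"
definition cBc :: "nat \<Rightarrow> int \<Rightarrow> real" where
  "cBc l m = (((real l - 1)^2 - (of_int m)^2) * ((real l)^2 - (of_int m)^2)) /
            ((2 * real l - 3) * (2 * real l - 1)^2 * (2 * real l + 1))"
definition cD :: "nat \<Rightarrow> int \<Rightarrow> real" where
  "cD l m = (((real l)^2 - (of_int m)^2) / ((2 * real l + 1) * (2 * real l - 1))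
            + ((real l + 1)^2 - (of_int m)^2) / ((2 * real l + 3) * (2 * real l + 1)) - 1/5)^2"
definition r1 :: "nat \<Rightarrow> real" where
  "r1 l = (real l * (real l + 1)) / ((real l + 2) * (real l + 3))"
definition r2 :: "nat \<Rightarrow> real" where
  "r2 l = (real l * (real l + 1)) / ((real l - 2) * (real l - 1))"

definition vartheta :: "nat \<Rightarrow> int \<Rightarrow> real" where
  "vartheta l m = (cA l m * r1 l + cBc l m * r2 l + cD l m) / 8"
definition varrho :: "nat \<Rightarrow> int \<Rightarrow> real" where
  "varrho l m = (cA l m + cBc l m + cD l m) / 8"
definition gamma_lm :: "nat \<Rightarrow> int \<Rightarrow> real" where
  "gamma_lm l m = (cA l m / r1 l + cBc l m / r2 l + cD l m) / 8"

definition curv_formula :: "nat \<Rightarrow> int \<Rightarrow> real" where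
  "curv_formula l m = - (525 * (of_int m)^2 / (32 * pi)) *
     (3 * gamma_lm l m - 2 * (12 / (real l * (real l + 1)) + 1) * varrho l m
      - (12 / (real l * (real l + 1)) - 1)^2 * vartheta l m)"

end

theory Submission
  imports Defs "HOL-Computational_Algebra.Polynomial"
begin

text \<open>Every field involved is the symplectic gradient of a stream function
  Re (c (x + i y)^M) q(z) with a real polynomial q, and only its values on the sphere matter.
  The field of degree 3 and order 0 is U = f'(z) times the rotation field about the polar axis,
  where f' is a multiple of 5 z^2 - 1 and f is an eigenfunction of L = - Laplacian for the eigenvalue 12.

  The divergence theorem on the sphere turns the inner product of u with the bracket of v and w into
  minus the integral of du(v, w), where u also denotes its dual one-form; here du is L of the stream
  function of u times the area form. For v of order M with stream function g this gives
  [U, v] = sgrad (U g), B(U, v) = 12 sgrad (L^-1 (U g)) and B(v, U) = - sgrad (L^-1 (U (L g))), once the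
  remaining gradient part is removed; its potential is explicit by Cartan's formula for the rotation
  field, since on order M that rotation acts as multiplication by i M.

  Multiplication by 5 z^2 - 1 sends the Legendre function of degree k to degrees k + 2, k, k - 2, and
  L acts by k (k + 1). Hence the curvature operator applied to degree l has, besides terms of other
  degrees, which are orthogonal, a component along degree l itself, and only the products of opposite
  matrix coefficients enter it, so no normalisation of the harmonics is needed.\<close>

text \<open>Two Hilbert choices shape the proof: \<open>ext\<close> picks some extension of a field
  off the sphere, and \<open>Bop\<close> picks some field representing a functional. No linearity of
  either is established. So \<open>Dv\<close> is evaluated in tangential directions only, identities
  between fields hold modulo agreement on \<open>S2\<close>, and each value of \<open>Bop\<close>
  requires an explicit witness, with uniqueness supplied by positivity of \<open>ip\<close>. The
  witness is tested against every divergence-free field w, which is why its potential comes from a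
  pointwise identity and not from an expansion of w in harmonics. It must also lie in the algebra
  \<open>g\<close>: for the projective plane this is a parity condition on q, and the same field
  then serves both algebras. The inverse Laplacian fails on constants, which arise only for M = 0;
  there the bracket and both B terms carry a factor M and vanish. Negative m is reduced to M = |m|,
  because the sign of m and the normalisation only affect the constants c.\<close>

definition sphere_integral :: "(vec \<Rightarrow> real) \<Rightarrow> real" where
  "sphere_integral f = integral (cbox (0,0) (pi, 2*pi)) (\<lambda>(\<theta>,\<phi>). f (sph \<theta> \<phi>) * sin \<theta>)"

lemma ip_eq_sphere_integral: "ip X Y = sphere_integral (\<lambda>p. X p \<bullet> Y p)"
  by (simp add: ip_def sphere_integral_def)

section \<open>Coordinates in space and on the sphere\<close>

lemma inner_vec3: "(v::vec) \<bullet> w = v$1 * w$1 + v$2 * w$2 + v$3 * w$3"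
  by (simp add: inner_vec_def sum_3)

lemma vec3_eq_iff: "(v::vec) = w \<longleftrightarrow> v$1 = w$1 \<and> v$2 = w$2 \<and> v$3 = w$3"
  by (simp add: vec_eq_iff forall_3)

lemma mem_S2: "p \<in> S2 \<longleftrightarrow> p$1 * p$1 + p$2 * p$2 + p$3 * p$3 = 1"
proof -
  have "norm p = 1 \<longleftrightarrow> (norm p)^2 = 1"
    using norm_ge_zero[of p] by (simp add: abs_square_eq_1)
  then have "p \<in> S2 \<longleftrightarrow> (norm p)^2 = 1"
    by (simp add: S2_def)
  then show ?thesis
    by (simp add: power2_norm_eq_inner inner_vec3)
qed

lemma sph_in_S2: "sph \<theta> \<phi> \<in> S2"
proof -
  have "sin \<theta> * cos \<phi> * (sin \<theta> * cos \<phi>) + sin \<theta> * sin \<phi> * (sin \<theta> * sin \<phi>) + cos \<theta> * cos \<theta>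
      = (sin \<theta>)\<^sup>2 * ((sin \<phi>)\<^sup>2 + (cos \<phi>)\<^sup>2) + (cos \<theta>)\<^sup>2"
    by algebra
  then show ?thesis
    by (simp add: mem_S2 sph_def)
qed

lemma S2_eq_sph:
  assumes "p \<in> S2"
  shows "p = sph (arccos (p$3)) (Arg (Complex (p$1) (p$2)))"
proof -
  let ?z = "Complex (p$1) (p$2)"
  have n: "(p$1)\<^sup>2 + (p$2)\<^sup>2 + (p$3)\<^sup>2 = 1"
    using assms by (simp add: mem_S2 power2_eq_square)
  have "(p$3)\<^sup>2 \<le> 1"
    using n by (smt (verit) zero_le_power2)
  then have z: "-1 \<le> p$3" "p$3 \<le> 1"
    by (auto simp: abs_square_le_1)
  have "sin (arccos (p$3)) = sqrt (1 - (p$3)\<^sup>2)"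
    by (rule sin_arccos) (use z in auto)
  also have "\<dots> = cmod ?z"
    using n by (simp add: cmod_def algebra_simps)
  finally have s: "sin (arccos (p$3)) = cmod ?z" .
  have "?z = rcis (cmod ?z) (Arg ?z)"
    by (simp add: rcis_cmod_Arg)
  then have "p$1 = cmod ?z * cos (Arg ?z)" "p$2 = cmod ?z * sin (Arg ?z)"
    by (metis Re_rcis complex.sel(1), metis Im_rcis complex.sel(2))
  then show ?thesis
    using s z by (simp add: vec3_eq_iff sph_def)
qed

lemma S2_sphE:
  assumes "p \<in> S2"
  obtains \<theta> \<phi> where "\<theta> \<in> {0..pi}" "\<phi> \<in> {0..2*pi}" "p = sph \<theta> \<phi>"
proof -
  let ?t = "arccos (p$3)" and ?f = "Arg (Complex (p$1) (p$2))"
  \<comment> \<open>\<open>Arg\<close> takes values between -pi and pi, while the integration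
    rectangle uses angles from 0 to 2 pi.\<close>
  define f where "f = (if ?f < 0 then ?f + 2*pi else ?f)"
  have "(p$3)\<^sup>2 \<le> 1"
    using assms unfolding mem_S2 power2_eq_square by (smt (verit) zero_le_square)
  then have "-1 \<le> p$3" "p$3 \<le> 1"
    by (auto simp: abs_square_le_1)
  then have "?t \<in> {0..pi}"
    by (simp add: arccos_lbound arccos_ubound)
  moreover have "f \<in> {0..2*pi}"
    using Arg_bounded[of "Complex (p$1) (p$2)"] by (auto simp: f_def)
  moreover have "sph ?t f = sph ?t ?f"
    by (simp add: f_def sph_def)
  ultimately show ?thesis
    using that S2_eq_sph[OF assms] by metis
qed

lemma continuous_on_vec3:
  fixes f :: "'a::topological_space \<Rightarrow> vec"
  assumes "continuous_on S (\<lambda>x. f x $ 1)" "continuous_on S (\<lambda>x. f x $ 2)" "continuous_on S (\<lambda>x. f x $ 3)"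
  shows "continuous_on S f"
proof -
  have "continuous_on S (\<lambda>x. \<chi> i. f x $ i)"
    by (rule continuous_on_vec_lambda) (use assms exhaust_3 in metis)
  then show ?thesis by simp
qed

lemma has_derivative_vec3:
  fixes f :: "'a::real_normed_vector \<Rightarrow> vec"
  assumes "((\<lambda>x. f x $ 1) has_derivative (\<lambda>v. f' v $ 1)) F"
    "((\<lambda>x. f x $ 2) has_derivative (\<lambda>v. f' v $ 2)) F"
    "((\<lambda>x. f x $ 3) has_derivative (\<lambda>v. f' v $ 3)) F"
  shows "(f has_derivative f') F"
proof -
  have d: "v = (v$1) *\<^sub>R axis 1 1 + (v$2) *\<^sub>R axis 2 1 + (v$3) *\<^sub>R axis 3 1" for v :: vec
    by (simp add: vec3_eq_iff axis_def)
  have "((\<lambda>x. (f x $1) *\<^sub>R axis 1 1 + (f x$2) *\<^sub>R axis 2 1 + (f x$3) *\<^sub>R axis 3 1 :: vec) has_derivative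
        (\<lambda>v. (f' v $1) *\<^sub>R axis 1 1 + (f' v$2) *\<^sub>R axis 2 1 + (f' v$3) *\<^sub>R axis 3 1)) F"
    by (intro has_derivative_add has_derivative_scaleR_left assms)
  then show ?thesis
    using d by simp
qed

lemma has_derivative_vec_nth:
  "((\<lambda>x::vec. x $ i) has_derivative (\<lambda>v. v $ i)) F"
  by (rule bounded_linear_imp_has_derivative) (rule bounded_linear_vec_nth)

section \<open>Integration over the sphere in spherical coordinates\<close>

lemma continuous_on_sph: "continuous_on A (\<lambda>(\<theta>,\<phi>). sph \<theta> \<phi>)"
  by (rule continuous_on_vec3) (auto simp: sph_def case_prod_beta intro!: continuous_intros)

lemma continuous_on_sph_comp:
  assumes "continuous_on S2 f"
  shows "continuous_on A (\<lambda>(\<theta>,\<phi>). f (sph \<theta> \<phi>))"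
  unfolding case_prod_unfold
  by (rule continuous_on_compose2[OF assms continuous_on_sph[unfolded case_prod_unfold]])
     (auto simp: sph_in_S2)

lemma continuous_on_sphere_integrand:
  fixes f :: "vec \<Rightarrow> real"
  assumes "continuous_on S2 f"
  shows "continuous_on A (\<lambda>(\<theta>,\<phi>). f (sph \<theta> \<phi>) * sin \<theta>)"
  using continuous_on_sph_comp[OF assms, of A]
  by (auto simp: case_prod_beta intro!: continuous_intros)

lemma sphere_integral_cong:
  assumes "\<And>p. p \<in> S2 \<Longrightarrow> f p = g p"
  shows "sphere_integral f = sphere_integral g"
  by (simp add: sphere_integral_def assms sph_in_S2)

lemma sphere_integral_add:
  assumes "continuous_on S2 f" "continuous_on S2 g"
  shows "sphere_integral (\<lambda>p. f p + g p) = sphere_integral f + sphere_integral g"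
proof -
  note c = continuous_on_sphere_integrand[where A = "cbox (0,0) (pi, 2*pi)"]
  show ?thesis
    unfolding sphere_integral_def
    using integral_add[OF integrable_continuous[OF c[OF assms(1)]] integrable_continuous[OF c[OF assms(2)]]]
    by (simp add: case_prod_unfold distrib_right)
qed

lemma sphere_integral_cmult: "sphere_integral (\<lambda>p. a * f p) = a * sphere_integral f"
  unfolding sphere_integral_def integral_mult_right[symmetric]
  by (intro arg_cong[where f = "integral _"]) (auto simp: fun_eq_iff)

lemma sphere_integral_uminus: "sphere_integral (\<lambda>p. - f p) = - sphere_integral f"
  using sphere_integral_cmult[of "-1" f] by simp

lemma sphere_integral_diff:
  assumes "continuous_on S2 f" "continuous_on S2 g"
  shows "sphere_integral (\<lambda>p. f p - g p) = sphere_integral f - sphere_integral g"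
  using sphere_integral_add[OF assms(1), of "\<lambda>p. - g p"] assms
  by (simp add: sphere_integral_uminus continuous_on_minus)

lemma sphere_integral_eq_0_imp:
  assumes c: "continuous_on S2 f" and nn: "\<And>p. p \<in> S2 \<Longrightarrow> 0 \<le> f p"
    and z: "sphere_integral f = 0" and p: "p \<in> S2"
  shows "f p = (0::real)"
proof -
  let ?I = "\<lambda>(\<theta>,\<phi>). f (sph \<theta> \<phi>) * sin \<theta>"
  let ?C = "cbox (0::real,0::real) (pi, 2*pi)"
  have cI: "continuous_on ?C ?I"
    by (rule continuous_on_sphere_integrand[OF c])
  have "(?I has_integral 0) ?C"
    using integrable_integral[OF integrable_continuous[OF cI]] z by (simp add: sphere_integral_def)
  moreover have "0 \<le> ?I x" if "x \<in> box (0,0) (pi, 2*pi)" for x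
  proof -
    have "fst x \<in> {0<..<pi}"
      using that by (cases x) (auto simp: mem_box Basis_prod_def)
    then show ?thesis
      by (cases x) (simp add: nn sph_in_S2 sin_ge_zero)
  qed
  moreover have "box (0::real,0::real) (pi, 2*pi) \<noteq> {}"
    by (auto simp: box_ne_empty Basis_prod_def)
  ultimately have I0: "?I x = 0" if "x \<in> ?C" for x
    using has_integral_0_cbox_imp_0[OF cI] that by blast
  obtain \<theta> \<phi> where tf: "\<theta> \<in> {0..pi}" "\<phi> \<in> {0..2*pi}" "p = sph \<theta> \<phi>"
    using S2_sphE[OF p] .
  \<comment> \<open>The weight \<open>sin\<close> vanishes at both ends of the interval, so the
    integrand carries no information at the poles; they are reached by continuity along a
    meridian.\<close>
  have "f (sph t \<phi>) = 0" if "t \<in> {0<..<pi}" for t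
  proof -
    have "(t,\<phi>) \<in> ?C"
      using that tf by (simp add: cbox_Pair_eq)
    from I0[OF this] show ?thesis
      using that sin_gt_zero[of t] by simp
  qed
  moreover have "continuous_on A (\<lambda>t. sph t \<phi>)" for A
    by (rule continuous_on_vec3) (auto simp: sph_def intro!: continuous_intros)
  then have "continuous_on (closure {0<..<pi}) (\<lambda>t. f (sph t \<phi>))"
    by (rule continuous_on_compose2[OF c]) (auto simp: sph_in_S2)
  moreover have "\<theta> \<in> closure {0<..<pi}"
    using tf by simp
  ultimately show ?thesis
    using continuous_constant_on_closure[of "{0<..<pi}" "\<lambda>t. f (sph t \<phi>)" 0 \<theta>] tf by auto
qed

section \<open>The divergence theorem on the sphere\<close>

text \<open>The regularity that the divergence theorem consumes, common to the chosen extensions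
  \<open>ext X\<close> and to explicit polynomial fields. The derivative is the ambient one, so F'
  depends on F off the sphere as well.\<close>

definition C1_on_S2 :: "(vec \<Rightarrow> 'a::real_normed_vector) \<Rightarrow> (vec \<Rightarrow> vec \<Rightarrow> 'a) \<Rightarrow> bool" where
  "C1_on_S2 F F' \<longleftrightarrow> (\<forall>p\<in>S2. (F has_derivative F' p) (at p)) \<and> (\<forall>v. continuous_on S2 (\<lambda>p. F' p v))"

lemma C1_on_S2_linear: "C1_on_S2 F F' \<Longrightarrow> p \<in> S2 \<Longrightarrow> linear (F' p)"
  by (auto simp: C1_on_S2_def intro: has_derivative_linear)

lemma C1_on_S2_continuous: "C1_on_S2 F F' \<Longrightarrow> continuous_on S2 F"
  by (meson C1_on_S2_def continuous_at_imp_continuous_on has_derivative_continuous)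

lemma linear_vec3:
  fixes f :: "vec \<Rightarrow> 'a::real_vector"
  assumes "linear f"
  shows "f v = (v$1) *\<^sub>R f (axis 1 1) + (v$2) *\<^sub>R f (axis 2 1) + (v$3) *\<^sub>R f (axis 3 1)"
proof -
  have "v = (v$1) *\<^sub>R axis 1 1 + (v$2) *\<^sub>R axis 2 1 + (v$3) *\<^sub>R axis 3 1"
    by (simp add: vec3_eq_iff axis_def)
  then have "f v = f ((v$1) *\<^sub>R axis 1 1 + (v$2) *\<^sub>R axis 2 1 + (v$3) *\<^sub>R axis 3 1)"
    by (rule arg_cong)
  then show ?thesis
    by (simp add: linear_add[OF assms] linear_scale[OF assms])
qed

lemma C1_on_S2_continuous_apply:
  assumes "C1_on_S2 F F'" "continuous_on S2 X"
  shows "continuous_on S2 (\<lambda>p. F' p (X p))"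
proof -
  have "continuous_on S2 (\<lambda>p. (X p$1) *\<^sub>R F' p (axis 1 1) + (X p$2) *\<^sub>R F' p (axis 2 1) + (X p$3) *\<^sub>R F' p (axis 3 1))"
    using assms by (auto simp: C1_on_S2_def intro!: continuous_intros)
  moreover have "F' p (X p) = (X p$1) *\<^sub>R F' p (axis 1 1) + (X p$2) *\<^sub>R F' p (axis 2 1) + (X p$3) *\<^sub>R F' p (axis 3 1)"
    if "p \<in> S2" for p
    by (rule linear_vec3[OF C1_on_S2_linear[OF assms(1) that]])
  ultimately show ?thesis
    using continuous_on_cong[OF refl, of S2 "\<lambda>p. F' p (X p)"] by simp
qed

lemma C1_on_S2_scaleR:
  assumes "C1_on_S2 f f'" "C1_on_S2 F F'"
  shows "C1_on_S2 (\<lambda>p. f p *\<^sub>R F p) (\<lambda>p v. f p *\<^sub>R F' p v + f' p v *\<^sub>R F p)"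
  using C1_on_S2_continuous[OF assms(1)] C1_on_S2_continuous[OF assms(2)] assms
  by (auto simp: C1_on_S2_def intro!: has_derivative_scaleR continuous_intros)

lemma C1_on_S2_mult:
  fixes f g :: "vec \<Rightarrow> real"
  assumes "C1_on_S2 f f'" "C1_on_S2 g g'"
  shows "C1_on_S2 (\<lambda>p. f p * g p) (\<lambda>p v. f p * g' p v + f' p v * g p)"
  using C1_on_S2_scaleR[OF assms] by simp

lemma C1_on_S2_inner:
  fixes F G :: "vec \<Rightarrow> vec"
  assumes "C1_on_S2 F F'" "C1_on_S2 G G'"
  shows "C1_on_S2 (\<lambda>p. F p \<bullet> G p) (\<lambda>p v. F p \<bullet> G' p v + F' p v \<bullet> G p)"
  using C1_on_S2_continuous[OF assms(1)] C1_on_S2_continuous[OF assms(2)] assms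
  by (auto simp: C1_on_S2_def intro!: has_derivative_inner continuous_intros)

text \<open>The unit vector along \<open>dph\<close>. It remains a unit vector at the poles, where
  \<open>dph\<close> vanishes, so the divergence theorem needs no division by sin theta.\<close>

definition ephi :: "real \<Rightarrow> vec" where
  "ephi \<phi> = vector [- sin \<phi>, cos \<phi>, 0]"

lemma dph_eq_ephi: "dph \<theta> \<phi> = sin \<theta> *\<^sub>R ephi \<phi>"
  by (simp add: dph_def ephi_def vec3_eq_iff)

lemma has_vector_derivative_sph_theta:
  "((\<lambda>t. sph t \<phi>) has_vector_derivative dth \<theta> \<phi>) (at \<theta>)"
  unfolding has_vector_derivative_def
  by (rule has_derivative_vec3) (auto simp: sph_def dth_def intro!: derivative_eq_intros)

lemma has_vector_derivative_sph_phi: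
  "((\<lambda>t. sph \<theta> t) has_vector_derivative dph \<theta> \<phi>) (at \<phi>)"
  unfolding has_vector_derivative_def
  by (rule has_derivative_vec3) (auto simp: sph_def dph_def intro!: derivative_eq_intros)

lemma has_vector_derivative_dth_theta:
  "((\<lambda>t. dth t \<phi>) has_vector_derivative (- sph \<theta> \<phi>)) (at \<theta>)"
  unfolding has_vector_derivative_def
  by (rule has_derivative_vec3) (auto simp: sph_def dth_def intro!: derivative_eq_intros)

lemma has_vector_derivative_ephi:
  "(ephi has_vector_derivative (vector [- cos \<phi>, - sin \<phi>, 0])) (at \<phi>)"
  unfolding has_vector_derivative_def
  by (rule has_derivative_vec3) (auto simp: ephi_def intro!: derivative_eq_intros)

text \<open>\<open>sph\<close>, \<open>dth\<close> and \<open>ephi\<close> form an orthonormal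
  frame, and a trace can be computed in any such frame.\<close>

lemma trace_spherical_frame:
  fixes f :: "vec \<Rightarrow> vec"
  assumes "linear f"
  shows "(\<Sum>i\<in>UNIV. f (axis i 1) $ i) - sph \<theta> \<phi> \<bullet> f (sph \<theta> \<phi>)
    = f (dth \<theta> \<phi>) \<bullet> dth \<theta> \<phi> + f (ephi \<phi>) \<bullet> ephi \<phi>"
proof -
  let ?ct = "cos \<theta>" and ?st = "sin \<theta>" and ?cf = "cos \<phi>" and ?sf = "sin \<phi>"
  have t: "?st * ?st = 1 - ?ct * ?ct" and f: "?sf * ?sf = 1 - ?cf * ?cf"
    using sin_cos_squared_add[of \<theta>] sin_cos_squared_add[of \<phi>] by (simp_all add: power2_eq_square)
  have t': "?st * (?st * a) = a - ?ct * ?ct * a" and f': "?sf * (?sf * a) = a - ?cf * ?cf * a" for a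
    using t f by (simp_all add: mult.assoc[symmetric] left_diff_distrib)
  show ?thesis
    unfolding linear_vec3[OF assms, of "sph \<theta> \<phi>"] linear_vec3[OF assms, of "dth \<theta> \<phi>"]
      linear_vec3[OF assms, of "ephi \<phi>"]
    by (simp add: sph_def dth_def ephi_def inner_vec3 sum_3 algebra_simps t f t' f')
qed

lemma integral_theta_derivative:
  fixes a a' :: "real \<Rightarrow> real \<Rightarrow> real"
  assumes der: "\<And>\<theta> \<phi>. ((\<lambda>t. a t \<phi>) has_vector_derivative a' \<theta> \<phi>) (at \<theta>)"
    and c: "continuous_on (cbox (0,0) (pi,2*pi)) (\<lambda>(\<theta>,\<phi>). a' \<theta> \<phi>)"
    and z: "\<And>\<phi>. a pi \<phi> = a 0 \<phi>"
  shows "integral (cbox (0,0) (pi,2*pi)) (\<lambda>(\<theta>,\<phi>). a' \<theta> \<phi>) = 0"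
proof -
  have "((\<lambda>t. a' t \<phi>) has_integral (a pi \<phi> - a 0 \<phi>)) {0..pi}" for \<phi>
    by (rule fundamental_theorem_of_calculus) (auto intro: der has_vector_derivative_at_within)
  then have "integral (cbox 0 pi) (\<lambda>t. a' t \<phi>) = 0" for \<phi>
    using z by (metis cbox_interval diff_self integral_unique)
  then show ?thesis
    using integral_prod_continuous[OF c] integral_swap_continuous[OF c] by simp
qed

lemma integral_phi_derivative:
  fixes a a' :: "real \<Rightarrow> real \<Rightarrow> real"
  assumes der: "\<And>\<theta> \<phi>. ((\<lambda>t. a \<theta> t) has_vector_derivative a' \<theta> \<phi>) (at \<phi>)"
    and c: "continuous_on (cbox (0,0) (pi,2*pi)) (\<lambda>(\<theta>,\<phi>). a' \<theta> \<phi>)"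
    and z: "\<And>\<theta>. a \<theta> (2*pi) = a \<theta> 0"
  shows "integral (cbox (0,0) (pi,2*pi)) (\<lambda>(\<theta>,\<phi>). a' \<theta> \<phi>) = 0"
proof -
  have "((\<lambda>t. a' \<theta> t) has_integral (a \<theta> (2*pi) - a \<theta> 0)) {0..2*pi}" for \<theta>
    by (rule fundamental_theorem_of_calculus) (auto intro: der has_vector_derivative_at_within)
  then have "integral (cbox 0 (2*pi)) (\<lambda>t. a' \<theta> t) = 0" for \<theta>
    using z by (metis cbox_interval diff_self integral_unique)
  then show ?thesis
    using integral_prod_continuous[OF c] by simp
qed

text \<open>Times sin theta, the divergence is d/dtheta (sin theta F_theta) + d/dphi F_phi. The
  first bracket vanishes at both poles and the second is 2 pi periodic, so each part integrates to
  zero.\<close>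

lemma sphere_divergence:
  fixes F :: "vec \<Rightarrow> vec"
  assumes C: "C1_on_S2 F F'" and tan: "\<And>p. p \<in> S2 \<Longrightarrow> F p \<bullet> p = 0"
  shows "sphere_integral (\<lambda>p. (\<Sum>i\<in>UNIV. F' p (axis i 1) $ i) - p \<bullet> F' p p) = 0"
proof -
  let ?C = "cbox (0::real,0::real) (pi, 2*pi)"
  define a where "a \<theta> \<phi> = sin \<theta> * (F (sph \<theta> \<phi>) \<bullet> dth \<theta> \<phi>)" for \<theta> \<phi>
  define a' where "a' \<theta> \<phi> = cos \<theta> * (F (sph \<theta> \<phi>) \<bullet> dth \<theta> \<phi>)
    + sin \<theta> * (F' (sph \<theta> \<phi>) (dth \<theta> \<phi>) \<bullet> dth \<theta> \<phi>)" for \<theta> \<phi>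
  define b where "b \<theta> \<phi> = F (sph \<theta> \<phi>) \<bullet> ephi \<phi>" for \<theta> \<phi>
  define b' where "b' \<theta> \<phi> = sin \<theta> * (F' (sph \<theta> \<phi>) (ephi \<phi>) \<bullet> ephi \<phi>)
    - cos \<theta> * (F (sph \<theta> \<phi>) \<bullet> dth \<theta> \<phi>)" for \<theta> \<phi>
  have dF: "(F has_derivative F' (sph \<theta> \<phi>)) (at (sph \<theta> \<phi>))" for \<theta> \<phi>
    using C sph_in_S2 by (auto simp: C1_on_S2_def)
  have lF: "linear (F' (sph \<theta> \<phi>))" for \<theta> \<phi>
    by (rule C1_on_S2_linear[OF C sph_in_S2])
  have dt: "((\<lambda>t. F (sph t \<phi>)) has_vector_derivative F' (sph \<theta> \<phi>) (dth \<theta> \<phi>)) (at \<theta>)" for \<theta> \<phi>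
    using vector_derivative_diff_chain_within[OF has_vector_derivative_sph_theta has_derivative_at_withinI[OF dF]]
    by (simp add: o_def)
  have dp: "((\<lambda>t. F (sph \<theta> t)) has_vector_derivative F' (sph \<theta> \<phi>) (dph \<theta> \<phi>)) (at \<phi>)" for \<theta> \<phi>
    using vector_derivative_diff_chain_within[OF has_vector_derivative_sph_phi has_derivative_at_withinI[OF dF]]
    by (simp add: o_def)
  have da: "((\<lambda>t. a t \<phi>) has_vector_derivative a' \<theta> \<phi>) (at \<theta>)" for \<theta> \<phi>
    using dt[of \<phi> \<theta>] has_vector_derivative_dth_theta[of \<phi> \<theta>] tan[OF sph_in_S2[of \<theta> \<phi>]]
    unfolding a_def a'_def has_vector_derivative_def
    by (auto intro!: derivative_eq_intros simp: algebra_simps inner_commute)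
  \<comment> \<open>The derivative of \<open>ephi\<close> points towards the axis. Its radial part
    is invisible to the tangent field F; its \<open>dth\<close> part produces the term - cos theta
    F_theta that cancels against the one in \<open>a'\<close>.\<close>
  have ephi': "vector [- cos \<phi>, - sin \<phi>, 0] = - (cos \<theta> *\<^sub>R dth \<theta> \<phi> + sin \<theta> *\<^sub>R sph \<theta> \<phi>)" for \<theta> \<phi>
  proof -
    have "cos \<theta> * (cos \<theta> * x) + sin \<theta> * (sin \<theta> * x) = x" for x
      using sin_cos_squared_add[of \<theta>] by algebra
    from this[of "cos \<phi>"] this[of "sin \<phi>"] show ?thesis
      by (simp add: vec3_eq_iff sph_def dth_def algebra_simps)
  qed
  have db: "((\<lambda>t. b \<theta> t) has_vector_derivative b' \<theta> \<phi>) (at \<phi>)" for \<theta> \<phi>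
    using dp[of \<theta> \<phi>] has_vector_derivative_ephi[of \<phi>, unfolded ephi'[of \<phi> \<theta>]] tan[OF sph_in_S2[of \<theta> \<phi>]]
    unfolding b_def b'_def has_vector_derivative_def dph_eq_ephi linear_scale[OF lF]
    by (auto intro!: derivative_eq_intros simp: algebra_simps inner_commute inner_diff_right inner_diff_left inner_add_right inner_add_left)
  have cF: "continuous_on A (\<lambda>x. F (sph (fst x) (snd x)))"
   and cF': "continuous_on A (\<lambda>x. F' (sph (fst x) (snd x)) v)" for A v
    using continuous_on_sph_comp[of F A] continuous_on_sph_comp[of "\<lambda>p. F' p v" A] C C1_on_S2_continuous[OF C]
    by (auto simp: case_prod_unfold C1_on_S2_def)
  have c1: "continuous_on A (\<lambda>x. dth (fst x) (snd x))" and c2: "continuous_on A (\<lambda>x. ephi (snd x))" for A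
    by (rule continuous_on_vec3; auto simp: dth_def ephi_def intro!: continuous_intros)+
  have ca: "continuous_on ?C (\<lambda>(\<theta>,\<phi>). a' \<theta> \<phi>)"
    unfolding a'_def linear_vec3[OF lF, of _ _ "dth _ _"] case_prod_unfold
    by (intro continuous_intros cF cF' c1 c2)
  have cb: "continuous_on ?C (\<lambda>(\<theta>,\<phi>). b' \<theta> \<phi>)"
    unfolding b'_def linear_vec3[OF lF, of _ _ "ephi _"] case_prod_unfold
    by (intro continuous_intros cF cF' c1 c2)
  have "((\<Sum>i\<in>UNIV. F' (sph \<theta> \<phi>) (axis i 1) $ i) - sph \<theta> \<phi> \<bullet> F' (sph \<theta> \<phi>) (sph \<theta> \<phi>)) * sin \<theta> = a' \<theta> \<phi> + b' \<theta> \<phi>" for \<theta> \<phi>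
    by (simp add: trace_spherical_frame[OF lF] a'_def b'_def algebra_simps)
  then have "sphere_integral (\<lambda>p. (\<Sum>i\<in>UNIV. F' p (axis i 1) $ i) - p \<bullet> F' p p)
     = integral ?C (\<lambda>x. (case x of (\<theta>,\<phi>) \<Rightarrow> a' \<theta> \<phi>) + (case x of (\<theta>,\<phi>) \<Rightarrow> b' \<theta> \<phi>))"
    by (simp add: sphere_integral_def case_prod_unfold)
  also have "\<dots> = integral ?C (\<lambda>(\<theta>,\<phi>). a' \<theta> \<phi>) + integral ?C (\<lambda>(\<theta>,\<phi>). b' \<theta> \<phi>)"
    by (rule integral_add) (rule integrable_continuous ca cb)+
  also have "integral ?C (\<lambda>(\<theta>,\<phi>). a' \<theta> \<phi>) = 0"
    by (rule integral_theta_derivative[OF da ca]) (simp add: a_def)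
  also have "integral ?C (\<lambda>(\<theta>,\<phi>). b' \<theta> \<phi>) = 0"
    by (rule integral_phi_derivative[OF db cb]) (simp add: b_def sph_def ephi_def)
  finally show ?thesis by simp
qed

section \<open>Fields modulo agreement on the sphere\<close>

definition eq_S2 :: "vf \<Rightarrow> vf \<Rightarrow> bool"  (infix \<open>\<simeq>\<close> 50) where
  "X \<simeq> Y \<longleftrightarrow> (\<forall>p\<in>S2. X p = Y p)"

lemma eq_S2_refl [simp]: "X \<simeq> X"
  by (simp add: eq_S2_def)

lemma eq_S2_trans [trans]: "X \<simeq> Y \<Longrightarrow> Y \<simeq> Z \<Longrightarrow> X \<simeq> Z"
  by (simp add: eq_S2_def)

text \<open>\<open>smooth_ext X\<close> sees X only through its values on \<open>S2\<close>, so both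
  sides choose from the same predicate. This is why the operators built on \<open>ext\<close>
  respect agreement on \<open>S2\<close>.\<close>

lemma eq_S2_ext: "X \<simeq> Y \<Longrightarrow> ext X = ext Y"
  by (simp add: ext_def smooth_ext_def eq_S2_def)

lemma eq_S2_Dv: "X \<simeq> Y \<Longrightarrow> Dv X = Dv Y"
  by (simp add: Dv_def[abs_def] eq_S2_ext)

lemma eq_S2_br: "X \<simeq> X' \<Longrightarrow> Y \<simeq> Y' \<Longrightarrow> br X Y \<simeq> br X' Y'"
  using eq_S2_Dv[of X X'] eq_S2_Dv[of Y Y'] by (auto simp: br_def eq_S2_def)

lemma eq_S2_ip: "X \<simeq> X' \<Longrightarrow> Y \<simeq> Y' \<Longrightarrow> ip X Y = ip X' Y'"
  unfolding ip_eq_sphere_integral by (rule sphere_integral_cong) (simp add: eq_S2_def)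

lemma eq_S2_Bop:
  assumes "X \<simeq> X'" "Y \<simeq> Y'"
  shows "Bop g X Y = Bop g X' Y'"
proof -
  have "ip X (br Y w) = ip X' (br Y' w)" for w
    by (intro eq_S2_ip eq_S2_br assms eq_S2_refl)
  then show ?thesis
    by (simp add: Bop_def)
qed

text \<open>The great circle through p in direction t stays on the sphere, where F and G coincide;
  differentiate along it.\<close>

lemma tangential_derivative_unique:
  fixes F G :: vf
  assumes F: "(F has_derivative F') (at p)" and G: "(G has_derivative G') (at p)"
    and "p \<in> S2" and FG: "F \<simeq> G" and t: "t \<bullet> p = 0"
  shows "F' t = G' t"
proof (cases "t = 0")
  case True
  then show ?thesis
    using linear_0[OF has_derivative_linear[OF F]] linear_0[OF has_derivative_linear[OF G]] by simp
next
  case False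
  define s where "s = t /\<^sub>R norm t"
  define c where "c r = cos r *\<^sub>R p + sin r *\<^sub>R s" for r :: real
  have s: "s \<bullet> s = 1" "s \<bullet> p = 0" "p \<bullet> s = 0"
    using False t inner_commute[of p t] by (simp_all add: s_def dot_square_norm power2_eq_square)
  have p: "p \<bullet> p = 1"
    using \<open>p \<in> S2\<close> by (simp add: mem_S2 inner_vec3)
  have "c r \<bullet> c r = 1" for r
    using s p sin_cos_squared_add[of r]
    by (simp add: c_def inner_add_left inner_add_right power2_eq_square)
  then have "c r \<in> S2" for r
    by (simp add: mem_S2 inner_vec3)
  then have FGc: "(\<lambda>r. F (c r)) = (\<lambda>r. G (c r))"
    using FG by (auto simp: eq_S2_def)
  have c': "(c has_vector_derivative s) (at 0)"
    unfolding c_def[abs_def] has_vector_derivative_def by (auto intro!: derivative_eq_intros)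
  have c0: "c 0 = p"
    by (simp add: c_def)
  have "((\<lambda>r. F (c r)) has_vector_derivative F' s) (at 0)"
    using vector_derivative_diff_chain_within[OF c', of F F'] F c0
    by (simp add: o_def has_derivative_at_withinI)
  moreover have "((\<lambda>r. G (c r)) has_vector_derivative G' s) (at 0)"
    using vector_derivative_diff_chain_within[OF c', of G G'] G c0
    by (simp add: o_def has_derivative_at_withinI)
  ultimately have "F' s = G' s"
    unfolding FGc by (rule vector_derivative_unique_at)
  moreover have "t = norm t *\<^sub>R s"
    using False by (simp add: s_def)
  ultimately show ?thesis
    using linear_scale[OF has_derivative_linear[OF F]] linear_scale[OF has_derivative_linear[OF G]] by metis
qed

lemma smooth_ext_C1:
  assumes "smooth_ext X F"
  shows "C1_on_S2 (ext X) (Dv X)" "ext X \<simeq> X"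
proof -
  have "smooth_ext X (ext X)"
    using someI[of "smooth_ext X", OF assms] by (simp add: ext_def)
  then obtain U where U: "open U" "S2 \<subseteq> U" "smooth_on U (ext X)" and e: "\<forall>p\<in>S2. ext X p = X p"
    by (auto simp: smooth_ext_def)
  from U(3) obtain S where S: "ext X \<in> S"
    "\<And>g. g \<in> S \<Longrightarrow> g differentiable_on U \<and> (\<forall>v. (\<lambda>x. frechet_derivative g (at x) v) \<in> S)"
    unfolding smooth_on_def by blast
  have "(ext X has_derivative Dv X p) (at p)" if "p \<in> S2" for p
  proof -
    have "ext X differentiable (at p)"
      using S U that by (meson differentiable_on_eq_differentiable_at subsetD)
    then show ?thesis
      by (simp add: Dv_def[abs_def] frechet_derivative_works)
  qed
  moreover have "continuous_on S2 (\<lambda>p. Dv X p v)" for v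
  proof -
    have "(\<lambda>p. Dv X p v) differentiable_on U"
      unfolding Dv_def using S by blast
    then show ?thesis
      using U(2) continuous_on_subset differentiable_imp_continuous_on by blast
  qed
  ultimately show "C1_on_S2 (ext X) (Dv X)"
    by (simp add: C1_on_S2_def)
  show "ext X \<simeq> X"
    using e by (simp add: eq_S2_def)
qed

lemma sdiff_S2_C1:
  assumes "X \<in> sdiff_S2"
  shows "C1_on_S2 (ext X) (Dv X)" "ext X \<simeq> X"
  using assms smooth_ext_C1 by (auto simp: sdiff_S2_def)

lemma sdiff_S2_tangent: "X \<in> sdiff_S2 \<Longrightarrow> p \<in> S2 \<Longrightarrow> X p \<bullet> p = 0"
  by (simp add: sdiff_S2_def)

lemma sdiff_S2_continuous:
  assumes "X \<in> sdiff_S2"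
  shows "continuous_on S2 X"
proof -
  have "continuous_on S2 (ext X)"
    by (rule C1_on_S2_continuous[OF sdiff_S2_C1(1)[OF assms]])
  then show ?thesis
    using sdiff_S2_C1(2)[OF assms] continuous_on_cong[of S2 S2 "ext X" X] by (simp add: eq_S2_def)
qed

section \<open>Surface divergence, bracket and integration by parts\<close>

text \<open>With P = I - p p^T both sides are the trace of P f P. The right one feeds only tangent
  vectors P e_i to f, so the derivatives of two extensions can be compared.\<close>

lemma trace_tangential:
  fixes f :: "vec \<Rightarrow> vec"
  assumes "linear f" "p \<in> S2"
  shows "(\<Sum>i\<in>UNIV. f (axis i 1) $ i) - p \<bullet> f p
    = (\<Sum>i\<in>UNIV. (axis i 1 - p $ i *\<^sub>R p) \<bullet> f (axis i 1 - p $ i *\<^sub>R p))"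
proof -
  have n: "p$1 * p$1 + p$2 * p$2 + p$3 * p$3 = 1"
    using assms(2) by (simp add: mem_S2)
  define m where "m i j = f (axis j 1) $ i" for i j
  have f: "f v $ i = v$1 * m i 1 + v$2 * m i 2 + v$3 * m i 3" for v i
    by (subst linear_vec3[OF assms(1)]) (simp add: m_def)
  show ?thesis
    unfolding inner_vec3 sum_3 f
    apply (simp add: axis_def)
    using n by algebra
qed

lemma tangential_projection: "p \<in> S2 \<Longrightarrow> (axis i 1 - p $ i *\<^sub>R p) \<bullet> p = 0"
  by (simp add: inner_diff_left inner_axis' S2_def norm_eq_1)

text \<open>The choice of extension does not matter: the surface divergence and the bracket
  only see tangential derivatives.\<close>

lemma sdiv_eq:
  assumes "smooth_ext X F" "C1_on_S2 F F'" "p \<in> S2"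
  shows "sdiv X p = (\<Sum>i\<in>UNIV. F' p (axis i 1) $ i) - p \<bullet> F' p p"
proof -
  note C = smooth_ext_C1[OF assms(1)]
  have FX: "ext X \<simeq> F"
    using assms(1) C(2) by (auto simp: smooth_ext_def eq_S2_def)
  have "Dv X p (axis i 1 - p $ i *\<^sub>R p) = F' p (axis i 1 - p $ i *\<^sub>R p)" for i
    by (rule tangential_derivative_unique[OF _ _ assms(3) FX tangential_projection[OF assms(3)]])
       (use C(1) assms(2,3) in \<open>auto simp: C1_on_S2_def\<close>)
  then show ?thesis
    unfolding sdiv_def trace_tangential[OF C1_on_S2_linear[OF C(1) assms(3)] assms(3)]
      trace_tangential[OF C1_on_S2_linear[OF assms(2,3)] assms(3)]
    by simp
qed

lemma Dv_eq:
  assumes "smooth_ext X F" "C1_on_S2 F F'" "p \<in> S2" "t \<bullet> p = 0"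
  shows "Dv X p t = F' p t"
proof -
  note C = smooth_ext_C1[OF assms(1)]
  have FX: "ext X \<simeq> F"
    using assms(1) C(2) by (auto simp: smooth_ext_def eq_S2_def)
  show ?thesis
    by (rule tangential_derivative_unique[OF _ _ assms(3) FX assms(4)])
       (use C(1) assms(2,3) in \<open>auto simp: C1_on_S2_def\<close>)
qed

text \<open>Since w is divergence free, dq(w) is the divergence of the tangent field q w.\<close>

lemma sphere_integral_gradient:
  fixes q :: "vec \<Rightarrow> real"
  assumes q: "C1_on_S2 q q'" and w: "w \<in> sdiff_S2"
  shows "sphere_integral (\<lambda>p. q' p (w p)) = 0"
proof -
  note C = sdiff_S2_C1[OF w]
  have wS: "ext w p = w p" "w p \<bullet> p = 0" "sdiv w p = 0" if "p \<in> S2" for p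
    using that w C(2) by (auto simp: eq_S2_def sdiff_S2_def)
  let ?D = "\<lambda>p. (\<Sum>i\<in>UNIV. (q p *\<^sub>R Dv w p (axis i 1) + q' p (axis i 1) *\<^sub>R ext w p) $ i)
      - p \<bullet> (q p *\<^sub>R Dv w p p + q' p p *\<^sub>R ext w p)"
  have "sphere_integral ?D = 0"
    by (rule sphere_divergence[OF C1_on_S2_scaleR[OF q C(1)]]) (simp add: wS)
  moreover have "?D p = q' p (w p)" if "p \<in> S2" for p
  proof -
    have "q' p (w p) = w p $ 1 * q' p (axis 1 1) + w p $ 2 * q' p (axis 2 1) + w p $ 3 * q' p (axis 3 1)"
      using linear_vec3[OF C1_on_S2_linear[OF q that], of "w p"] by simp
    then have E1: "(\<Sum>i\<in>UNIV. (q p *\<^sub>R Dv w p (axis i 1) + q' p (axis i 1) *\<^sub>R w p) $ i)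
      = q p * (\<Sum>i\<in>UNIV. Dv w p (axis i 1) $ i) + q' p (w p)"
      by (simp add: sum_3 distrib_left mult.commute)
    have E2: "p \<bullet> (q p *\<^sub>R Dv w p p + q' p p *\<^sub>R w p) = q p * (p \<bullet> Dv w p p)"
      using wS(2)[OF that] inner_commute[of p "w p"] by (simp add: inner_add_right)
    have E3: "(\<Sum>i\<in>UNIV. Dv w p (axis i 1) $ i) = p \<bullet> Dv w p p"
      using wS(3)[OF that] by (simp add: sdiv_def)
    show ?thesis
      unfolding wS(1)[OF that] E1 E2 E3 by simp
  qed
  then have "sphere_integral ?D = sphere_integral (\<lambda>p. q' p (w p))"
    by (rule sphere_integral_cong)
  ultimately show ?thesis
    by (rule trans[OF sym, rotated])
qed

text \<open>Invariant formula for the exterior derivative of the one-form dual to u, integrated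
  over the sphere; the terms v(u,w) and w(u,v) integrate to zero.\<close>

lemma ip_br:
  assumes u: "u \<in> sdiff_S2" and v: "v \<in> sdiff_S2" and w: "w \<in> sdiff_S2"
  shows "ip u (br v w) = - sphere_integral (\<lambda>p. Dv u p (v p) \<bullet> w p - Dv u p (w p) \<bullet> v p)"
proof -
  note Cu = sdiff_S2_C1[OF u] and Cv = sdiff_S2_C1[OF v] and Cw = sdiff_S2_C1[OF w]
  note c = sdiff_S2_continuous
  note a = C1_on_S2_continuous_apply
  let ?A = "\<lambda>p. ext u p \<bullet> Dv w p (v p) + Dv u p (v p) \<bullet> ext w p"
  let ?B = "\<lambda>p. ext u p \<bullet> Dv v p (w p) + Dv u p (w p) \<bullet> ext v p"
  have A: "sphere_integral ?A = 0"
    by (rule sphere_integral_gradient[OF C1_on_S2_inner[OF Cu(1) Cw(1)] v])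
  have B: "sphere_integral ?B = 0"
    by (rule sphere_integral_gradient[OF C1_on_S2_inner[OF Cu(1) Cv(1)] w])
  have cA: "continuous_on S2 ?A" and cB: "continuous_on S2 ?B"
    by (intro continuous_intros a[OF Cu(1)] a[OF Cv(1)] a[OF Cw(1)] c u v w
        C1_on_S2_continuous[OF Cu(1)] C1_on_S2_continuous[OF Cv(1)] C1_on_S2_continuous[OF Cw(1)])+
  have cD: "continuous_on S2 (\<lambda>p. - (Dv u p (v p) \<bullet> w p - Dv u p (w p) \<bullet> v p))"
    by (intro continuous_intros a[OF Cu(1)] c u v w)
  have "ip u (br v w) = sphere_integral (\<lambda>p. (?A p - ?B p) + - (Dv u p (v p) \<bullet> w p - Dv u p (w p) \<bullet> v p))"
    unfolding ip_eq_sphere_integral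
    by (rule sphere_integral_cong) (use Cu(2) Cv(2) Cw(2) in \<open>simp add: eq_S2_def br_def inner_diff_right\<close>)
  also have "\<dots> = - sphere_integral (\<lambda>p. Dv u p (v p) \<bullet> w p - Dv u p (w p) \<bullet> v p)"
    using A B sphere_integral_add[OF continuous_on_diff[OF cA cB] cD] sphere_integral_diff[OF cA cB]
      sphere_integral_uminus[of "\<lambda>p. Dv u p (v p) \<bullet> w p - Dv u p (w p) \<bullet> v p"]
    by simp
  finally show ?thesis .
qed

section \<open>Positivity of the inner product and uniqueness of B\<close>

lemma ip_commute: "ip X Y = ip Y X"
  by (simp add: ip_def inner_commute)

lemma ip_add_left:
  assumes "continuous_on S2 X" "continuous_on S2 Y" "continuous_on S2 Z"
  shows "ip (\<lambda>p. X p + Y p) Z = ip X Z + ip Y Z"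
  unfolding ip_eq_sphere_integral inner_add_left
  by (intro sphere_integral_add continuous_intros assms)

lemma ip_scale_left: "ip (\<lambda>p. a *\<^sub>R X p) Z = a * ip X Z"
  unfolding ip_eq_sphere_integral by (simp add: sphere_integral_cmult)

lemma ip_zero_left: "X \<simeq> (\<lambda>p. 0) \<Longrightarrow> ip X Y = 0"
  using eq_S2_ip[of X "\<lambda>p. 0" Y Y] ip_scale_left[of 0 X Y] by simp

lemma ip_self_nonneg: "continuous_on S2 X \<Longrightarrow> ip X X \<ge> 0"
  unfolding ip_def
  by (rule integral_nonneg, rule integrable_continuous)
     (use continuous_on_sphere_integrand[of "\<lambda>p. X p \<bullet> X p"] in
      \<open>auto intro!: continuous_intros mult_nonneg_nonneg sin_ge_zero simp: cbox_Pair_eq\<close>)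

lemma ip_self_eq_0:
  assumes "continuous_on S2 X" "ip X X = 0"
  shows "X \<simeq> (\<lambda>p. 0)"
  unfolding eq_S2_def
proof
  fix p assume p: "p \<in> S2"
  have "X p \<bullet> X p = 0"
    by (rule sphere_integral_eq_0_imp[OF _ _ _ p])
       (use assms in \<open>auto simp: ip_eq_sphere_integral intro!: continuous_intros\<close>)
  then show "X p = 0" by simp
qed

definition is_B :: "vf set \<Rightarrow> vf \<Rightarrow> vf \<Rightarrow> vf \<Rightarrow> bool" where
  "is_B g u v b \<longleftrightarrow> b \<in> g \<and> (\<forall>w\<in>g. ip b w = ip u (br v w))"

text \<open>The witness b makes the choice in \<open>Bop\<close> succeed. Both b and the chosen
  field lie in g and represent the same functional there; testing with each of them shows that their
  difference has norm zero.\<close>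

lemma Bop_eq:
  assumes g: "g \<subseteq> sdiff_S2" and b: "is_B g u v b"
  shows "Bop g u v \<simeq> b"
proof -
  let ?b = "Bop g u v"
  have b': "is_B g u v ?b"
    unfolding Bop_def is_B_def[symmetric] by (rule someI[of "is_B g u v", OF b])
  have c: "continuous_on S2 b" "continuous_on S2 ?b"
    using b b' g by (auto simp: is_B_def intro: sdiff_S2_continuous)
  have e: "ip b b = ip ?b b" "ip b ?b = ip ?b ?b"
    using b b' by (auto simp: is_B_def)
  let ?d = "\<lambda>p. ?b p + (-1) *\<^sub>R b p"
  have cd: "continuous_on S2 ?d" "continuous_on S2 (\<lambda>p. (-1) *\<^sub>R b p)"
    using c by (auto intro!: continuous_intros)
  have l: "ip ?d Y = ip ?b Y - ip b Y" if "continuous_on S2 Y" for Y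
    using ip_add_left[OF c(2) cd(2) that] ip_scale_left[of "-1" b Y] by simp
  have "ip ?d ?d = 0"
    using l[OF cd(1)] l[OF c(1)] l[OF c(2)] e by (metis ip_commute diff_self)
  from ip_self_eq_0[OF cd(1) this] show ?thesis
    by (simp add: eq_S2_def)
qed

section \<open>Polynomial maps are smooth\<close>

lemma real_polynomial_function_has_derivative:
  fixes f :: "vec \<Rightarrow> real"
  assumes "real_polynomial_function f"
  shows "\<exists>f'. (\<forall>x. (f has_derivative f' x) (at x)) \<and> (\<forall>v. real_polynomial_function (\<lambda>x. f' x v))"
  using assms
proof induction
  case (linear f)
  then show ?case
    by (intro exI[of _ "\<lambda>x. f"]) (auto intro: bounded_linear_imp_has_derivative)
next
  case (const c)
  then show ?case
    by (intro exI[of _ "\<lambda>x v. 0"]) auto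
next
  case (add f g)
  then obtain f' g' where "\<forall>x. (f has_derivative f' x) (at x)" "\<forall>v. real_polynomial_function (\<lambda>x. f' x v)"
    "\<forall>x. (g has_derivative g' x) (at x)" "\<forall>v. real_polynomial_function (\<lambda>x. g' x v)"
    by blast
  then show ?case
    by (intro exI[of _ "\<lambda>x v. f' x v + g' x v"]) (auto intro: has_derivative_add)
next
  case (mult f g)
  then obtain f' g' where "\<forall>x. (f has_derivative f' x) (at x)" "\<forall>v. real_polynomial_function (\<lambda>x. f' x v)"
    "\<forall>x. (g has_derivative g' x) (at x)" "\<forall>v. real_polynomial_function (\<lambda>x. g' x v)"
    by blast
  with mult.hyps show ?case
    by (intro exI[of _ "\<lambda>x v. f x * g' x v + f' x v * g x"]) (auto intro: has_derivative_mult intro!: real_polynomial_function.intros(3,4))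
qed

text \<open>The family demanded by \<open>smooth_on\<close> is that of all polynomial maps, which
  directional derivatives preserve.\<close>

lemma polynomial_smooth_on:
  assumes "\<And>i. real_polynomial_function (\<lambda>x. F x $ i)"
  shows "smooth_on U F"
proof -
  define S :: "vf set" where "S = {F. \<forall>i. real_polynomial_function (\<lambda>x. F x $ i)}"
  have "g differentiable_on U \<and> (\<forall>v. (\<lambda>x. frechet_derivative g (at x) v) \<in> S)" if "g \<in> S" for g
  proof -
    have "\<forall>i. \<exists>f'. (\<forall>x. ((\<lambda>x. g x $ i) has_derivative f' x) (at x)) \<and> (\<forall>v. real_polynomial_function (\<lambda>x. f' x v))"
      using that real_polynomial_function_has_derivative by (auto simp: S_def)
    then obtain f' where f': "\<And>i x. ((\<lambda>x. g x $ i) has_derivative f' i x) (at x)"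
      "\<And>i v. real_polynomial_function (\<lambda>x. f' i x v)"
      by metis
    have d: "(g has_derivative (\<lambda>v. \<chi> i. f' i x v)) (at x)" for x
      by (rule has_derivative_vec3) (auto simp: f')
    then have "frechet_derivative g (at x) = (\<lambda>v. \<chi> i. f' i x v)" for x
      using frechet_derivative_at by metis
    moreover have "g differentiable_on U"
      using d by (meson differentiableI differentiable_at_imp_differentiable_on)
    ultimately show ?thesis
      using f'(2) by (simp add: S_def)
  qed
  moreover have "F \<in> S"
    using assms by (simp add: S_def)
  ultimately show ?thesis
    unfolding smooth_on_def by blast
qed

section \<open>Stream functions of fixed azimuthal order\<close>

text \<open>\<open>H1 c M\<close> and \<open>H1 (i c) M\<close> are the x and y derivatives of
  \<open>H0 c M\<close>. Likewise \<open>H2 c M\<close> and \<open>H2 (i c) M\<close> are its xx and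
  xy derivatives, the yy derivative being \<open>- H2 c M\<close> by harmonicity. Where M - 1 or M -
  2 is truncated, the numerical factor is zero.\<close>

definition H0 :: "complex \<Rightarrow> nat \<Rightarrow> vec \<Rightarrow> real" where
  "H0 c M p = Re (c * Complex (p$1) (p$2) ^ M)"
definition H1 :: "complex \<Rightarrow> nat \<Rightarrow> vec \<Rightarrow> real" where
  "H1 c M p = real M * H0 c (M - 1) p"
definition H2 :: "complex \<Rightarrow> nat \<Rightarrow> vec \<Rightarrow> real" where
  "H2 c M p = real M * (real M - 1) * H0 c (M - 2) p"

lemma H_uminus [simp]:
  "H0 (- c) M p = - H0 c M p" "H1 (- c) M p = - H1 c M p" "H2 (- c) M p = - H2 c M p"
proof -
  have H0: "H0 (- c) M p = - H0 c M p" for M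
    by (simp add: H0_def)
  show "H0 (- c) M p = - H0 c M p" "H1 (- c) M p = - H1 c M p" "H2 (- c) M p = - H2 c M p"
    by (simp_all add: H0 H1_def H2_def)
qed

lemma ii_ii [simp]: "\<i> * (\<i> * c) = - c"
  by (simp add: mult.assoc[symmetric])

lemma Complex_Suc: "Re (c * (Complex x y * w)) = x * Re (c * w) + y * Re (\<i> * c * w)"
   "Re (\<i> * c * (Complex x y * w)) = x * Re (\<i> * c * w) - y * Re (c * w)"
  by (simp_all add: algebra_simps)

text \<open>The first identity is homogeneity of degree M. The second is the derivative along the
  rotation x d/dy - y d/dx, which replaces c by i c and multiplies by M.\<close>

lemma H_Euler:
  "p$1 * H1 c M p + p$2 * H1 (\<i> * c) M p = real M * H0 c M p"
  "p$1 * H1 (\<i> * c) M p - p$2 * H1 c M p = real M * H0 (\<i> * c) M p"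
proof -
  show "p$1 * H1 c M p + p$2 * H1 (\<i> * c) M p = real M * H0 c M p"
    unfolding H1_def H0_def by (cases M) (simp_all only: power_Suc Complex_Suc, simp_all add: algebra_simps)
  show "p$1 * H1 (\<i> * c) M p - p$2 * H1 c M p = real M * H0 (\<i> * c) M p"
    unfolding H1_def H0_def by (cases M) (simp_all only: power_Suc Complex_Suc, simp_all add: algebra_simps)
qed

lemma H_Euler2:
  "p$1 * H2 c M p + p$2 * H2 (\<i> * c) M p = (real M - 1) * H1 c M p"
  "p$1 * H2 (\<i> * c) M p - p$2 * H2 c M p = (real M - 1) * H1 (\<i> * c) M p"
proof -
  have H2: "H2 c M p = real M * H1 c (M - 1) p" for c
    by (cases M; cases "M - 1") (auto simp: H2_def H1_def)
  show "p$1 * H2 c M p + p$2 * H2 (\<i> * c) M p = (real M - 1) * H1 c M p"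
  proof (cases M)
    case (Suc n)
    have "p$1 * H2 c M p + p$2 * H2 (\<i> * c) M p = real M * (p$1 * H1 c n p + p$2 * H1 (\<i> * c) n p)"
      unfolding H2 by (simp add: Suc algebra_simps)
    then show ?thesis
      unfolding H_Euler using Suc by (simp add: H1_def)
  qed (simp add: H1_def H2_def)
  show "p$1 * H2 (\<i> * c) M p - p$2 * H2 c M p = (real M - 1) * H1 (\<i> * c) M p"
  proof (cases M)
    case (Suc n)
    have "p$1 * H2 (\<i> * c) M p - p$2 * H2 c M p = real M * (p$1 * H1 (\<i> * c) n p - p$2 * H1 c n p)"
      unfolding H2 by (simp add: Suc algebra_simps)
    then show ?thesis
      unfolding H_Euler using Suc by (simp add: H1_def)
  qed (simp add: H1_def H2_def)
qed

lemma H0_has_derivative: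
  "(H0 c M has_derivative (\<lambda>v. H1 c M p * v$1 + H1 (\<i> * c) M p * v$2)) (at p)"
proof -
  have Z: "((\<lambda>p. Complex (p$1) (p$2)) has_derivative (\<lambda>v. Complex (v$1) (v$2))) (at p)"
    unfolding Complex_eq
    by (auto intro!: derivative_eq_intros has_derivative_vec_nth has_derivative_of_real)
  have "((\<lambda>p. Re (c * Complex (p$1) (p$2) ^ M)) has_derivative
      (\<lambda>v. Re (c * (of_nat M * Complex (v$1) (v$2) * Complex (p$1) (p$2) ^ (M - 1))))) (at p)"
    by (intro bounded_linear.has_derivative[OF bounded_linear_Re] has_derivative_mult_right has_derivative_power[OF Z])
  moreover have "Re (c * (of_nat M * Complex (v$1) (v$2) * Complex (p$1) (p$2) ^ (M - 1)))
      = H1 c M p * v$1 + H1 (\<i> * c) M p * v$2" for v :: vec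
  proof -
    have "c * (of_nat M * Complex (v$1) (v$2) * Complex (p$1) (p$2) ^ (M - 1))
      = of_real (real M) * (c * (Complex (v$1) (v$2) * Complex (p$1) (p$2) ^ (M - 1)))"
      by simp
    then show ?thesis
      by (simp only: Re_complex_of_real Im_complex_of_real times_complex.sel(1)[of "of_real (real M)"] Complex_Suc)
         (simp add: H1_def H0_def algebra_simps)
  qed
  ultimately show ?thesis
    by (simp only: H0_def[abs_def])
qed

lemma H1_has_derivative:
  "(H1 c M has_derivative (\<lambda>v. H2 c M p * v$1 + H2 (\<i> * c) M p * v$2)) (at p)"
proof -
  have "((\<lambda>p. real M * H0 c (M - 1) p) has_derivative
      (\<lambda>v. real M * (H1 c (M - 1) p * v$1 + H1 (\<i> * c) (M - 1) p * v$2))) (at p)"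
    by (intro has_derivative_mult_right H0_has_derivative)
  moreover have "real M * H1 c (M - 1) p = H2 c M p" for c
    by (cases M; cases "M - 1") (auto simp: H2_def H1_def)
  ultimately show ?thesis
    by (simp add: H1_def[abs_def] distrib_left mult.assoc[symmetric])
qed

lemma poly_nth_has_derivative:
  "((\<lambda>p::vec. poly q (p$i)) has_derivative (\<lambda>v. v$i * poly (pderiv q) (p$i))) (at p)"
  by (rule DERIV_compose_FDERIV[OF poly_DERIV has_derivative_vec_nth])

lemma H0_polynomial: "real_polynomial_function (H0 c M)"
proof (induction M arbitrary: c)
  case 0
  then show ?case by (simp add: H0_def[abs_def] real_polynomial_function.intros(2))
next
  case (Suc M)
  have "real_polynomial_function (\<lambda>p. p$1 * H0 c M p + p$2 * H0 (\<i> * c) M p)"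
    by (intro real_polynomial_function.intros Suc bounded_linear_vec_nth)
  then show ?case
    by (simp only: H0_def[abs_def] power_Suc Complex_Suc)
qed

lemma poly_nth_polynomial: "real_polynomial_function (\<lambda>p::vec. poly q (p$i))"
proof (induction q)
  case 0
  then show ?case by (simp add: real_polynomial_function.intros(2))
next
  case (pCons a q)
  have "real_polynomial_function (\<lambda>p::vec. a + p$i * poly q (p$i))"
    by (intro real_polynomial_function.intros pCons bounded_linear_vec_nth)
  then show ?case by simp
qed

definition stream :: "complex \<Rightarrow> nat \<Rightarrow> real poly \<Rightarrow> vec \<Rightarrow> real" where
  "stream c M q p = H0 c M p * poly q (p$3)"

definition dstream :: "complex \<Rightarrow> nat \<Rightarrow> real poly \<Rightarrow> vec \<Rightarrow> vec \<Rightarrow> real" where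
  "dstream c M q p v = H1 c M p * poly q (p$3) * v$1 + H1 (\<i> * c) M p * poly q (p$3) * v$2
     + H0 c M p * poly (pderiv q) (p$3) * v$3"

text \<open>The symplectic gradient of a function f on the sphere is the cross product of
  the ambient gradient of f with the position vector.\<close>

definition sfield :: "complex \<Rightarrow> nat \<Rightarrow> real poly \<Rightarrow> vf" where
  "sfield c M q p = vector
    [H1 (\<i> * c) M p * poly q (p$3) * p$3 - H0 c M p * poly (pderiv q) (p$3) * p$2,
     H0 c M p * poly (pderiv q) (p$3) * p$1 - H1 c M p * poly q (p$3) * p$3,
     H1 c M p * poly q (p$3) * p$2 - H1 (\<i> * c) M p * poly q (p$3) * p$1]"

lemma sfield_nth:
  "sfield c M q p $ 1 = H1 (\<i> * c) M p * poly q (p$3) * p$3 - H0 c M p * poly (pderiv q) (p$3) * p$2"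
  "sfield c M q p $ 2 = H0 c M p * poly (pderiv q) (p$3) * p$1 - H1 c M p * poly q (p$3) * p$3"
  "sfield c M q p $ 3 = H1 c M p * poly q (p$3) * p$2 - H1 (\<i> * c) M p * poly q (p$3) * p$1"
  by (simp_all add: sfield_def)

text \<open>Differentials of the x and y components of the ambient gradient of
  \<open>stream c M q\<close>. The z component is \<open>stream c M (pderiv q)\<close>, whose
  differential is already \<open>dstream\<close>.\<close>

definition dx1 where "dx1 c M q p v = H2 c M p * poly q (p$3) * v$1 + H2 (\<i> * c) M p * poly q (p$3) * v$2
     + H1 c M p * poly (pderiv q) (p$3) * v$3" for p v :: vec
definition dx2 where "dx2 c M q p v = H2 (\<i> * c) M p * poly q (p$3) * v$1 - H2 c M p * poly q (p$3) * v$2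
     + H1 (\<i> * c) M p * poly (pderiv q) (p$3) * v$3" for p v :: vec

definition dsfield :: "complex \<Rightarrow> nat \<Rightarrow> real poly \<Rightarrow> vec \<Rightarrow> vec \<Rightarrow> vec" where
  "dsfield c M q p v = vector
    [dx2 c M q p v * p$3 + H1 (\<i> * c) M p * poly q (p$3) * v$3
       - dstream c M (pderiv q) p v * p$2 - H0 c M p * poly (pderiv q) (p$3) * v$2,
     dstream c M (pderiv q) p v * p$1 + H0 c M p * poly (pderiv q) (p$3) * v$1
       - dx1 c M q p v * p$3 - H1 c M p * poly q (p$3) * v$3,
     dx1 c M q p v * p$2 + H1 c M p * poly q (p$3) * v$2
       - dx2 c M q p v * p$1 - H1 (\<i> * c) M p * poly q (p$3) * v$1]"

lemma stream_has_derivative: "(stream c M q has_derivative dstream c M q p) (at p)"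
  unfolding stream_def[abs_def] dstream_def[abs_def]
  by (rule has_derivative_eq_rhs[OF has_derivative_mult[OF H0_has_derivative poly_nth_has_derivative]])
     (simp add: fun_eq_iff algebra_simps)

lemma H1_stream_has_derivative:
  "((\<lambda>p. H1 c M p * poly q (p$3)) has_derivative dx1 c M q p) (at p)"
  "((\<lambda>p. H1 (\<i> * c) M p * poly q (p$3)) has_derivative dx2 c M q p) (at p)"
  unfolding dx1_def[abs_def] dx2_def[abs_def]
  by (rule has_derivative_eq_rhs[OF has_derivative_mult[OF H1_has_derivative poly_nth_has_derivative]];
      simp add: fun_eq_iff algebra_simps)+

lemma sfield_has_derivative: "(sfield c M q has_derivative dsfield c M q p) (at p)"
proof -
  note m = has_derivative_mult[OF _ has_derivative_vec_nth]
  note a = m[OF H1_stream_has_derivative(1)[of c M q p]] and b = m[OF H1_stream_has_derivative(2)[of c M q p]]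
    and d = m[OF stream_has_derivative[of c M "pderiv q" p, unfolded stream_def[abs_def]]]
  show ?thesis
  proof (rule has_derivative_vec3)
    show "((\<lambda>x. sfield c M q x $ 1) has_derivative (\<lambda>v. dsfield c M q p v $ 1)) (at p)"
      unfolding sfield_nth
      by (rule has_derivative_eq_rhs[OF has_derivative_diff[OF b d]])
         (simp add: dsfield_def fun_eq_iff algebra_simps)
    show "((\<lambda>x. sfield c M q x $ 2) has_derivative (\<lambda>v. dsfield c M q p v $ 2)) (at p)"
      unfolding sfield_nth
      by (rule has_derivative_eq_rhs[OF has_derivative_diff[OF d a]])
         (simp add: dsfield_def fun_eq_iff algebra_simps)
    show "((\<lambda>x. sfield c M q x $ 3) has_derivative (\<lambda>v. dsfield c M q p v $ 3)) (at p)"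
      unfolding sfield_nth
      by (rule has_derivative_eq_rhs[OF has_derivative_diff[OF a b]])
         (simp add: dsfield_def fun_eq_iff algebra_simps)
  qed
qed

lemma H1_polynomial: "real_polynomial_function (H1 c M)"
  unfolding H1_def[abs_def] by (intro real_polynomial_function.intros H0_polynomial)

lemma real_polynomial_continuous_on:
  fixes f :: "vec \<Rightarrow> real"
  shows "real_polynomial_function f \<Longrightarrow> continuous_on A f"
  by (simp add: continuous_on_polymonial_function real_polynomial_function_eq)

lemma sfield_polynomial: "real_polynomial_function (\<lambda>p. sfield c M q p $ i)"
proof -
  have "i = 1 \<or> i = 2 \<or> i = 3"
    by (rule exhaust_3)
  then show ?thesis
    by (elim disjE; simp only: sfield_nth)
       (intro real_polynomial_function_diff real_polynomial_function.intros H0_polynomial H1_polynomial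
         poly_nth_polynomial bounded_linear_vec_nth)+
qed

lemma sfield_smooth_ext: "X \<simeq> sfield c M q \<Longrightarrow> smooth_ext X (sfield c M q)"
  by (auto simp: smooth_ext_def eq_S2_def intro!: exI[of _ UNIV] polynomial_smooth_on sfield_polynomial)

lemma C1_stream: "C1_on_S2 (stream c M q) (dstream c M q)"
proof -
  note c = H0_polynomial[THEN real_polynomial_continuous_on] H1_polynomial[THEN real_polynomial_continuous_on]
    poly_nth_polynomial[THEN real_polynomial_continuous_on]
  have "continuous_on S2 (\<lambda>p. dstream c M q p v)" for v
    unfolding dstream_def by (intro continuous_intros c)
  then show ?thesis
    using stream_has_derivative by (simp add: C1_on_S2_def)
qed

lemma C1_sfield: "C1_on_S2 (sfield c M q) (dsfield c M q)"
proof -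
  have "real_polynomial_function (H2 c M)" for c
    unfolding H2_def[abs_def] by (intro real_polynomial_function.intros H0_polynomial)
  note c = this[THEN real_polynomial_continuous_on] H0_polynomial[THEN real_polynomial_continuous_on]
     H1_polynomial[THEN real_polynomial_continuous_on] poly_nth_polynomial[THEN real_polynomial_continuous_on]
  have "continuous_on S2 (\<lambda>p. dsfield c M q p v)" for v
    by (rule continuous_on_vec3; simp add: dsfield_def dx1_def dx2_def dstream_def; intro continuous_intros c)
  then show ?thesis
    using sfield_has_derivative by (simp add: C1_on_S2_def)
qed

lemma sfield_tangent: "sfield c M q p \<bullet> p = 0"
  by (simp add: inner_vec3 sfield_nth algebra_simps)

lemma sfield_in_sdiff_S2: "sfield c M q \<in> sdiff_S2"
proof -
  have "sdiv (sfield c M q) p = 0" if "p \<in> S2" for p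
  proof -
    have "sdiv (sfield c M q) p = (\<Sum>i\<in>UNIV. dsfield c M q p (axis i 1) $ i) - p \<bullet> dsfield c M q p p"
      by (rule sdiv_eq[OF sfield_smooth_ext C1_sfield that]) simp
    also have "\<dots> = 0"
      by (simp add: sum_3 inner_vec3 dsfield_def dx1_def dx2_def dstream_def axis_def algebra_simps)
    finally show ?thesis .
  qed
  then show ?thesis
    using sfield_smooth_ext[of "sfield c M q" c M q] by (auto simp: sdiff_S2_def sfield_tangent)
qed

lemma sfield_continuous: "continuous_on S2 (sfield c M q)"
  by (rule sdiff_S2_continuous[OF sfield_in_sdiff_S2])

section \<open>The area form and the curl of a symplectic gradient\<close>

text \<open>The cross product of two tangent vectors is a multiple of the unit normal p.\<close>

lemma cross_tangent:
  fixes p1 p2 p3 v1 v2 v3 w1 w2 w3 :: real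
  assumes "p1*p1 + p2*p2 + p3*p3 = 1" "v1*p1 + v2*p2 + v3*p3 = 0" "w1*p1 + w2*p2 + w3*p3 = 0"
  shows "v2*w3 - v3*w2 = (p1*(v2*w3 - v3*w2) + p2*(v3*w1 - v1*w3) + p3*(v1*w2 - v2*w1)) * p1"
    "v3*w1 - v1*w3 = (p1*(v2*w3 - v3*w2) + p2*(v3*w1 - v1*w3) + p3*(v1*w2 - v2*w1)) * p2"
    "v1*w2 - v2*w1 = (p1*(v2*w3 - v3*w2) + p2*(v3*w1 - v1*w3) + p3*(v1*w2 - v2*w1)) * p3"
  using assms by algebra+

text \<open>The area form of the sphere at p, as the determinant of p, v, w.\<close>

definition triple :: "vec \<Rightarrow> vec \<Rightarrow> vec \<Rightarrow> real" where
  "triple p v w = p$1*(v$2*w$3 - v$3*w$2) + p$2*(v$3*w$1 - v$1*w$3) + p$3*(v$1*w$2 - v$2*w$1)"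

text \<open>The associated Legendre operator after splitting off \<open>H0 c M\<close>, which
  carries the factor (1 - z^2)^(M/2); hence the shifted coefficients 2 (M + 1) and M (M +
  1).\<close>

definition Lam :: "nat \<Rightarrow> real poly \<Rightarrow> real poly" where
  "Lam M q = [:-1, 0, 1:] * pderiv (pderiv q) + smult (2 * (real M + 1)) ([:0, 1:] * pderiv q)
     + smult (real M * (real M + 1)) q"

lemma poly_Lam: "poly (Lam M q) z = (z * z - 1) * poly (pderiv (pderiv q)) z
    + 2 * (real M + 1) * z * poly (pderiv q) z + real M * (real M + 1) * poly q z"
  by (simp add: Lam_def algebra_simps)

text \<open>Lam is minus the Laplace-Beltrami operator, which appears here as the curl of sfield.\<close>

lemma curl_sfield:
  assumes "p \<in> S2" "v \<bullet> p = 0" "w \<bullet> p = 0"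
  shows "dsfield c M q p v \<bullet> w - dsfield c M q p w \<bullet> v = stream c M (Lam M q) p * triple p v w"
proof -
  let ?s = "triple p v w" and ?Q0 = "poly q (p$3)" and ?Q1 = "poly (pderiv q) (p$3)" and ?Q2 = "poly (pderiv (pderiv q)) (p$3)"
  define g1 g2 g3 where g: "g1 = H1 c M p * ?Q0" "g2 = H1 (\<i> * c) M p * ?Q0" "g3 = H0 c M p * ?Q1"
  define a b d e' f where h: "a = H2 c M p * ?Q0" "b = H2 (\<i> * c) M p * ?Q0" "d = H1 c M p * ?Q1"
    "e' = H1 (\<i> * c) M p * ?Q1" "f = H0 c M p * ?Q2"
  have s: "v$2*w$3 - v$3*w$2 = ?s * p$1" "v$3*w$1 - v$1*w$3 = ?s * p$2" "v$1*w$2 - v$2*w$1 = ?s * p$3"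
    unfolding triple_def
    by (rule cross_tangent; use assms in \<open>simp add: mem_S2 inner_vec3\<close>)+
  have D: "dx1 c M q p v = a * v$1 + b * v$2 + d * v$3" "dx2 c M q p v = b * v$1 - a * v$2 + e' * v$3"
     "dstream c M (pderiv q) p v = d * v$1 + e' * v$2 + f * v$3" for v
    by (simp_all add: dx1_def dx2_def dstream_def h)
  \<comment> \<open>For the gradient G = (g1, g2, g3) this is curl (G x p) = 2 G + (p . grad) G -
    (div G) p, paired with v x w. Here div G is just f, because \<open>H0 c M\<close> is harmonic in
    x and y.\<close>
  have "dsfield c M q p v \<bullet> w - dsfield c M q p w \<bullet> v
     = (2 * g1 + a * p$1 + b * p$2 + d * p$3) * (v$2*w$3 - v$3*w$2)
      + (2 * g2 + b * p$1 - a * p$2 + e' * p$3) * (v$3*w$1 - v$1*w$3)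
      + (2 * g3 + d * p$1 + e' * p$2 + f * p$3) * (v$1*w$2 - v$2*w$1) - f * ?s"
    by (simp add: dsfield_def inner_vec3 D g[symmetric] triple_def algebra_simps)
  also have "\<dots> = ?s * (2 * (g1 * p$1 + g2 * p$2 + g3 * p$3)
       + p$1 * (a * p$1 + b * p$2) + p$2 * (b * p$1 - a * p$2) + 2 * p$3 * (d * p$1 + e' * p$2) + (p$3 * p$3 - 1) * f)"
    unfolding s by (simp add: algebra_simps)
  also have "g1 * p$1 + g2 * p$2 + g3 * p$3 = H0 c M p * (real M * ?Q0 + p$3 * ?Q1)"
    using H_Euler(1)[of p c M] unfolding g by algebra
  also have "a * p$1 + b * p$2 = (real M - 1) * H1 c M p * ?Q0"
    using H_Euler2(1)[of p c M] unfolding h by algebra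
  also have "b * p$1 - a * p$2 = (real M - 1) * H1 (\<i> * c) M p * ?Q0"
    using H_Euler2(2)[of p c M] unfolding h by algebra
  also have "d * p$1 + e' * p$2 = real M * H0 c M p * ?Q1"
    using H_Euler(1)[of p c M] unfolding h by algebra
  also have "?s * (2 * (H0 c M p * (real M * ?Q0 + p$3 * ?Q1)) + p$1 * ((real M - 1) * H1 c M p * ?Q0)
      + p$2 * ((real M - 1) * H1 (\<i> * c) M p * ?Q0) + 2 * p$3 * (real M * H0 c M p * ?Q1) + (p$3 * p$3 - 1) * f)
     = stream c M (Lam M q) p * ?s"
    using H_Euler(1)[of p c M] unfolding h stream_def poly_Lam by algebra
  finally show ?thesis .
qed

text \<open>The defining property of a symplectic gradient: contracting the area form with it gives
  the differential of the stream function.\<close>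

lemma triple_sfield:
  assumes "p \<in> S2" "w \<bullet> p = 0"
  shows "triple p (sfield c M q p) w = dstream c M q p w"
  using assms unfolding triple_def sfield_nth dstream_def mem_S2 inner_vec3 by algebra

lemma Dv_sfield: "p \<in> S2 \<Longrightarrow> t \<bullet> p = 0 \<Longrightarrow> Dv (sfield c M q) p t = dsfield c M q p t"
  by (rule Dv_eq[OF sfield_smooth_ext C1_sfield]) auto

text \<open>No derivative of w is left on the right, so what remains is to represent a one-form,
  evaluated on w, by a divergence-free field.\<close>

lemma ip_br_sfield:
  assumes w: "w \<in> sdiff_S2"
  shows "ip (sfield c M q) (br (sfield c' M' q') w)
    = - sphere_integral (\<lambda>p. stream c M (Lam M q) p * dstream c' M' q' p (w p))"
  unfolding ip_br[OF sfield_in_sdiff_S2 sfield_in_sdiff_S2 w]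
  by (rule arg_cong[where f = uminus], rule sphere_integral_cong)
     (simp add: Dv_sfield sfield_tangent sdiff_S2_tangent[OF w] curl_sfield triple_sfield)

text \<open>Cartan's formula for the rotation field about the polar axis produces the potential of the
  closed form on the left.\<close>

lemma hodge_pointwise:
  assumes "p \<in> S2" "w \<bullet> p = 0"
  shows "stream c M (Lam M r) p * w$3 + real M * (sfield (- (\<i> * c)) M r p \<bullet> w)
    = - dstream c M ([:1, 0, -1:] * pderiv r - smult (real M) ([:0, 1:] * r)) p w"
proof -
  let ?z = "p$3" and ?r = "poly r (p$3)" and ?r1 = "poly (pderiv r) (p$3)" and ?r2 = "poly (pderiv (pderiv r)) (p$3)"
  \<comment> \<open>On the sphere \<open>stream c M ?t\<close> is the inner product of
    \<open>sfield c M r\<close> with the rotation field (-y, x, 0), that is, the contraction in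
    Cartan's formula.\<close>
  let ?t = "[:1, 0, -1:] * pderiv r - smult (real M) ([:0, 1:] * r)"
  have t: "poly ?t ?z = (1 - ?z * ?z) * ?r1 - real M * ?z * ?r"
    by (simp add: algebra_simps)
  have t': "poly (pderiv ?t) ?z = (1 - ?z * ?z) * ?r2 - 2 * ?z * ?r1 - real M * ?r - real M * ?z * ?r1"
    by (simp add: pderiv_diff pderiv_add pderiv_minus pderiv_mult pderiv_smult pderiv_pCons algebra_simps)
  have e1: "p$1 * H1 c M p + p$2 * H1 (\<i> * c) M p = real M * H0 c M p"
   and e2: "p$1 * H1 (\<i> * c) M p - p$2 * H1 c M p = real M * H0 (\<i> * c) M p"
    by (rule H_Euler)+
  have n: "p$1 * p$1 + p$2 * p$2 + p$3 * p$3 = 1" "w$1 * p$1 + w$2 * p$2 + w$3 * p$3 = 0"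
    using assms by (simp_all add: mem_S2 inner_vec3)
  have F: "sfield (- (\<i> * c)) M r p \<bullet> w = ?r * ?z * (H1 c M p * w$1 + H1 (\<i> * c) M p * w$2)
      + H0 (\<i> * c) M p * ?r1 * (p$2 * w$1 - p$1 * w$2)
      - ?r * (p$1 * H1 c M p + p$2 * H1 (\<i> * c) M p) * w$3"
    by (simp add: inner_vec3 sfield_nth algebra_simps)
  show ?thesis
    unfolding F stream_def dstream_def poly_Lam t t'
    using e1 e2 n by algebra
qed

lemma exists_antiderivative: "\<exists>T. pderiv T = (t::real poly)"
proof -
  let ?T = "\<Sum>i\<le>degree t. monom (coeff t i / real (Suc i)) (Suc i)"
  have "pderiv (\<Sum>i\<in>A. f i) = (\<Sum>i\<in>A. pderiv (f i))" for f :: "nat \<Rightarrow> real poly" and A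
    by (induction A rule: infinite_finite_induct) (auto simp: pderiv_add)
  then have "pderiv ?T = (\<Sum>i\<le>degree t. monom (coeff t i) i)"
    by (simp add: pderiv_monom del: of_nat_Suc)
  also have "\<dots> = t"
    by (rule poly_as_sum_of_monoms)
  finally show ?thesis by blast
qed

text \<open>Integration of \<open>hodge_pointwise\<close> removes its exact right-hand side and
  leaves the divergence-free part of the one-form \<open>stream c M t\<close> dz. For M = 0 that
  form is itself exact and both sides vanish; this branch avoids inverting the Laplacian on
  constants.\<close>

lemma sphere_integral_hodge:
  assumes w: "w \<in> sdiff_S2" and r: "M = 0 \<or> Lam M r = t"
  shows "sphere_integral (\<lambda>p. stream c M t p * w p $ 3) = real M * ip (sfield (\<i> * c) M r) w"
proof (cases "M = 0")
  case True
  obtain T where T: "pderiv T = t"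
    using exists_antiderivative by blast
  have "sphere_integral (\<lambda>p. dstream c M T p (w p)) = 0"
    by (rule sphere_integral_gradient[OF C1_stream w])
  moreover have "dstream c M T p v = stream c M t p * v$3" for p v
    using True T by (simp add: dstream_def stream_def H1_def)
  ultimately show ?thesis
    using True by simp
next
  case False
  let ?t = "[:1, 0, -1:] * pderiv r - smult (real M) ([:0, 1:] * r)"
  have c: "continuous_on S2 (\<lambda>p. dstream c M ?t p (w p))" "continuous_on S2 (\<lambda>p. sfield (- (\<i> * c)) M r p \<bullet> w p)"
    by (intro C1_on_S2_continuous_apply[OF C1_stream] continuous_intros sfield_continuous sdiff_S2_continuous w)+
  have z: "sphere_integral (\<lambda>p. dstream c M ?t p (w p)) = 0"
    by (rule sphere_integral_gradient[OF C1_stream w])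
  have "sphere_integral (\<lambda>p. stream c M t p * w p $ 3)
     = sphere_integral (\<lambda>p. - dstream c M ?t p (w p) + (- real M) * (sfield (- (\<i> * c)) M r p \<bullet> w p))"
  proof (rule sphere_integral_cong)
    fix p assume "p \<in> S2"
    from hodge_pointwise[OF this sdiff_S2_tangent[OF w this], of c M r] r False
    show "stream c M t p * w p $ 3 = - dstream c M ?t p (w p) + (- real M) * (sfield (- (\<i> * c)) M r p \<bullet> w p)"
      by simp
  qed
  also have "\<dots> = - real M * ip (sfield (- (\<i> * c)) M r) w"
    using z c by (subst sphere_integral_add)
      (auto simp: sphere_integral_uminus sphere_integral_cmult ip_eq_sphere_integral intro!: continuous_intros
        simp del: mult_minus_left)
  also have "sfield (- (\<i> * c)) M r = (\<lambda>p. (-1) *\<^sub>R sfield (\<i> * c) M r p)"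
    by (simp add: fun_eq_iff vec3_eq_iff sfield_nth)
  finally show ?thesis
    unfolding ip_scale_left by simp
qed

lemma sfield_smult: "sfield c M (smult a q) p = a *\<^sub>R sfield c M q p"
  by (simp add: vec3_eq_iff sfield_nth pderiv_smult algebra_simps)

lemma sfield_add: "sfield c M (q + r) p = sfield c M q p + sfield c M r p"
  by (simp add: vec3_eq_iff sfield_nth pderiv_add algebra_simps)

lemma sfield_uminus: "sfield c M (- q) p = - sfield c M q p"
  by (simp add: vec3_eq_iff sfield_nth pderiv_minus algebra_simps)

lemma sfield_diff: "sfield c M (q - r) p = sfield c M q p - sfield c M r p"
  by (simp add: vec3_eq_iff sfield_nth pderiv_diff algebra_simps)

lemma sfield_0 [simp]: "sfield c M 0 p = 0"
  by (simp add: vec3_eq_iff sfield_nth)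

section \<open>Bracket, B and connection with one zonal argument\<close>

text \<open>The zonal field is f'(z) times the rotation, which fixes z. Hence it acts on
  \<open>stream c M q\<close> only through the azimuthal factor: c becomes i c, and q acquires the
  factor M f'.\<close>

lemma br_zonal:
  "br (sfield 1 0 f) (sfield c M q) \<simeq> sfield (\<i> * c) M (smult (real M) (pderiv f * q))"
  unfolding eq_S2_def
proof
  fix p assume p: "p \<in> S2"
  let ?z = "p$3" and ?h = "poly (pderiv f) (p$3)"
  let ?Q0 = "poly q ?z" and ?Q1 = "poly (pderiv q) ?z" and ?Q2 = "poly (pderiv (pderiv q)) ?z"
  have n: "p$1 * p$1 + p$2 * p$2 + p$3 * p$3 = 1"
    using p by (simp add: mem_S2)
  have U: "sfield 1 0 f p $ 1 = - ?h * p$2" "sfield 1 0 f p $ 2 = ?h * p$1" "sfield 1 0 f p $ 3 = 0"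
    by (simp_all add: sfield_nth H1_def H0_def)
  have U': "dsfield 1 0 f p v = vector [- poly (pderiv (pderiv f)) ?z * v$3 * p$2 - ?h * v$2,
     poly (pderiv (pderiv f)) ?z * v$3 * p$1 + ?h * v$1, 0]" for v
    by (simp add: vec3_eq_iff dsfield_def dx1_def dx2_def dstream_def H2_def H1_def H0_def)
  have br: "br (sfield 1 0 f) (sfield c M q) p = dsfield c M q p (sfield 1 0 f p) - dsfield 1 0 f p (sfield c M q p)"
    by (simp add: br_def Dv_sfield[OF p] sfield_tangent)
  have e: "p$1 * H1 c M p + p$2 * H1 (\<i> * c) M p = real M * H0 c M p"
    "p$1 * H1 (\<i> * c) M p - p$2 * H1 c M p = real M * H0 (\<i> * c) M p"
    "p$1 * H2 c M p + p$2 * H2 (\<i> * c) M p = (real M - 1) * H1 c M p"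
    "p$1 * H2 (\<i> * c) M p - p$2 * H2 c M p = (real M - 1) * H1 (\<i> * c) M p"
    by (rule H_Euler H_Euler2)+
  have hq: "poly (smult (real M) (pderiv f * q)) ?z = real M * ?h * ?Q0"
    "poly (pderiv (smult (real M) (pderiv f * q))) ?z = real M * (?h * ?Q1 + ?Q0 * poly (pderiv (pderiv f)) ?z)"
    by (simp_all add: pderiv_smult pderiv_mult algebra_simps)
  show "br (sfield 1 0 f) (sfield c M q) p = sfield (\<i> * c) M (smult (real M) (pderiv f * q)) p"
    unfolding br vec3_eq_iff vector_minus_component U' sfield_nth(1,2,3)[of "\<i> * c"] hq ii_ii H_uminus
    apply (simp add: dsfield_def dx1_def dx2_def dstream_def U)
    apply (simp add: sfield_nth)
    apply (intro conjI)
    using e apply algebra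
    using e apply algebra
    using e apply algebra
    done
qed

text \<open>A field grad F x p satisfies X(-p) = - X(p) when F is odd. \<open>H0 c M\<close>
  contributes the parity (-1)^M, so q has to supply the opposite one.\<close>

definition admissible :: "vf set \<Rightarrow> nat \<Rightarrow> real poly \<Rightarrow> bool" where
  "admissible g M q \<longleftrightarrow> g = sdiff_S2 \<or> g = sdiff_RP2 \<and> (\<forall>z. poly q (- z) = (-1) ^ Suc M * poly q z)"

lemma admissible_subset: "admissible g M q \<Longrightarrow> g \<subseteq> sdiff_S2"
  by (auto simp: admissible_def sdiff_RP2_def)

lemma admissible_add: "admissible g M q \<Longrightarrow> admissible g M r \<Longrightarrow> admissible g M (q + r)"
  by (auto simp: admissible_def algebra_simps)

lemma admissible_smult: "admissible g M q \<Longrightarrow> admissible g M (smult a q)"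
  by (auto simp: admissible_def algebra_simps)

lemma H0_antipodal: "H0 c M (- p) = (-1) ^ M * H0 c M p"
proof -
  have "Complex (- x) (- y) = - Complex x y" for x y
    by (simp add: complex_eq_iff)
  then have "Complex (- x) (- y) ^ M = of_real ((-1) ^ M) * Complex x y ^ M" for x y
    by (simp add: power_minus[of "Complex x y"])
  then have "c * Complex (- x) (- y) ^ M = of_real ((-1) ^ M) * (c * Complex x y ^ M)" for x y
    by (simp only: mult.left_commute)
  then show ?thesis
    unfolding H0_def vector_uminus_component
    by (simp only: Re_complex_of_real Im_complex_of_real times_complex.sel(1)[of "of_real ((-1) ^ M)"])
qed

lemma H1_antipodal: "H1 c M (- p) = - ((-1) ^ M * H1 c M p)"
  by (cases M) (simp_all add: H1_def H0_antipodal)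

lemma poly_pderiv_parity:
  fixes q :: "real poly"
  assumes "\<And>z. poly q (- z) = a * poly q z"
  shows "poly (pderiv q) (- z) = - a * poly (pderiv q) z"
proof -
  have "pcompose q [:0, -1:] = smult a q"
    by (rule poly_ext) (simp add: poly_pcompose assms)
  then have "poly (pderiv (pcompose q [:0, -1:])) z = poly (pderiv (smult a q)) z"
    by simp
  then show ?thesis
    by (simp add: pderiv_pcompose poly_pcompose pderiv_smult pderiv_pCons)
qed

lemma admissible_sfield:
  assumes "admissible g M q"
  shows "sfield c M q \<in> g"
proof -
  have "sfield c M q (- p) = - sfield c M q p" if "\<forall>z. poly q (- z) = (-1) ^ Suc M * poly q z" for p
  proof -
    have q': "poly (pderiv q) (- z) = (-1) ^ M * poly (pderiv q) z" for z
      using poly_pderiv_parity[of q "(-1) ^ Suc M" z] that by simp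
    have "(-1) ^ M * ((-1) ^ M * x) = x" for x :: real
      by (simp add: mult.assoc[symmetric] power_mult_distrib[symmetric])
    then show ?thesis
      by (simp add: vec3_eq_iff sfield_nth H0_antipodal H1_antipodal that q' algebra_simps)
  qed
  then show ?thesis
    using assms sfield_in_sdiff_S2[of c M q] by (auto simp: admissible_def sdiff_RP2_def)
qed

lemma sfield_c_uminus: "sfield (- c) M q p = - sfield c M q p"
  by (simp add: vec3_eq_iff sfield_nth)

lemma Lam_add: "Lam M (q + r) = Lam M q + Lam M r"
  by (rule poly_ext) (simp add: poly_Lam pderiv_add algebra_simps)

lemma Lam_smult: "Lam M (smult a q) = smult a (Lam M q)"
  by (rule poly_ext) (simp add: poly_Lam pderiv_smult algebra_simps)

lemma Lam_0 [simp]: "Lam M 0 = 0"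
  by (simp add: Lam_def)

lemma zonal_stream:
  "stream 1 0 f p = poly f (p$3)" "dstream 1 0 f p v = poly (pderiv f) (p$3) * v$3"
  by (simp_all add: stream_def dstream_def H0_def H1_def)

lemma sfield_smult_eq: "sfield c M (smult a q) = (\<lambda>p. a *\<^sub>R sfield c M q p)"
  by (simp add: fun_eq_iff sfield_smult)

text \<open>F dG = d(F G) - G dF moves the derivative onto the zonal stream function, whose
  differential is f'(z) dz; then the one-form has the shape treated in
  \<open>sphere_integral_hodge\<close>.\<close>

lemma is_B_zonal_left:
  assumes f: "Lam 0 f = smult \<mu> f" and r: "M = 0 \<or> Lam M r = pderiv f * q" and adm: "admissible g M r"
  shows "is_B g (sfield 1 0 f) (sfield c M q) (sfield (\<i> * c) M (smult (\<mu> * real M) r))"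
  unfolding is_B_def
proof (intro conjI ballI)
  show "sfield (\<i> * c) M (smult (\<mu> * real M) r) \<in> g"
    by (intro admissible_sfield admissible_smult adm)
  fix w assume "w \<in> g"
  then have w: "w \<in> sdiff_S2"
    using admissible_subset[OF adm] by blast
  let ?A = "\<lambda>p. stream 1 0 f p * dstream c M q p (w p)" and ?B = "\<lambda>p. dstream 1 0 f p (w p) * stream c M q p"
  have cA: "continuous_on S2 ?A" "continuous_on S2 ?B"
    by (intro continuous_intros C1_on_S2_continuous_apply[OF C1_stream] C1_on_S2_continuous[OF C1_stream]
        sdiff_S2_continuous w)+
  have "sphere_integral (\<lambda>p. ?A p + ?B p) = 0"
    by (rule sphere_integral_gradient[OF C1_on_S2_mult[OF C1_stream C1_stream] w])
  then have AB: "sphere_integral ?A = - sphere_integral ?B"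
    using sphere_integral_add[OF cA] by simp
  have "ip (sfield 1 0 f) (br (sfield c M q) w)
      = - sphere_integral (\<lambda>p. \<mu> * ?A p)"
    unfolding ip_br_sfield[OF w] f by (simp add: stream_def mult.assoc mult.left_commute)
  also have "\<dots> = \<mu> * sphere_integral ?B"
    by (simp add: sphere_integral_cmult AB)
  also have "?B = (\<lambda>p. stream c M (pderiv f * q) p * w p $ 3)"
    by (simp add: fun_eq_iff zonal_stream stream_def)
  also have "sphere_integral \<dots> = real M * ip (sfield (\<i> * c) M r) w"
    by (rule sphere_integral_hodge[OF w r])
  finally show "ip (sfield (\<i> * c) M (smult (\<mu> * real M) r)) w = ip (sfield 1 0 f) (br (sfield c M q) w)"
    by (simp add: sfield_smult_eq ip_scale_left)
qed

text \<open>Here the one-form left by \<open>ip_br_sfield\<close> is a multiple of dz from the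
  start.\<close>

lemma is_B_zonal_right:
  assumes s: "M = 0 \<or> Lam M s = pderiv f * Lam M q" and adm: "admissible g M s"
  shows "is_B g (sfield c M q) (sfield 1 0 f) (sfield (\<i> * c) M (smult (- real M) s))"
  unfolding is_B_def
proof (intro conjI ballI)
  show "sfield (\<i> * c) M (smult (- real M) s) \<in> g"
    by (intro admissible_sfield admissible_smult adm)
  fix w assume "w \<in> g"
  then have w: "w \<in> sdiff_S2"
    using admissible_subset[OF adm] by blast
  have "ip (sfield c M q) (br (sfield 1 0 f) w)
      = - sphere_integral (\<lambda>p. stream c M (pderiv f * Lam M q) p * w p $ 3)"
    unfolding ip_br_sfield[OF w] zonal_stream by (simp add: stream_def mult_ac)
  also have "\<dots> = - (real M * ip (sfield (\<i> * c) M s) w)"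
    using sphere_integral_hodge[OF w s, of c] by simp
  finally show "ip (sfield (\<i> * c) M (smult (- real M) s)) w = ip (sfield c M q) (br (sfield 1 0 f) w)"
    by (simp only: sfield_smult_eq ip_scale_left)
qed

text \<open>The real connection of which \<open>cnabla\<close> is the complex bilinear
  extension.\<close>

definition rnabla :: "vf set \<Rightarrow> vf \<Rightarrow> vf \<Rightarrow> vf" where
  "rnabla g X Y = (\<lambda>p. (1/2) *\<^sub>R (br X Y p - Bop g X Y p - Bop g Y X p))"

lemma cnabla_eq_cbil: "cnabla g u v = cbil (rnabla g) u v"
  by (simp add: cnabla_def cbr_def cB_def cbil_def rnabla_def cscale_def csub_def fscale_def fsub_def fadd_def
      fun_eq_iff algebra_simps)

lemma eq_S2_rnabla: "X \<simeq> X' \<Longrightarrow> Y \<simeq> Y' \<Longrightarrow> rnabla g X Y \<simeq> rnabla g X' Y'"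
  using eq_S2_br[of X X' Y Y'] eq_S2_Bop[of X X' Y Y' g] eq_S2_Bop[of Y Y' X X' g]
  by (simp add: rnabla_def eq_S2_def)

text \<open>r and s are preimages under the Laplacian that belong to B(U, v) and B(v, U). The B
  terms enter symmetrically, so the two orders of the arguments differ only in the sign of the
  bracket term.\<close>

lemma rnabla_zonal:
  assumes f: "Lam 0 f = smult \<mu> f"
    and r: "M = 0 \<or> Lam M r = pderiv f * q" "admissible g M r"
    and s: "M = 0 \<or> Lam M s = pderiv f * Lam M q" "admissible g M s"
  shows "rnabla g (sfield 1 0 f) (sfield c M q)
      \<simeq> sfield (\<i> * c) M (smult (real M / 2) (pderiv f * q + (s - smult \<mu> r)))"
    and "rnabla g (sfield c M q) (sfield 1 0 f)
      \<simeq> sfield (\<i> * c) M (smult (real M / 2) (- (pderiv f * q) + (s - smult \<mu> r)))"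
proof -
  let ?U = "sfield 1 0 f" and ?X = "sfield c M q"
  note g = admissible_subset[OF r(2)]
  note B = Bop_eq[OF g is_B_zonal_left[OF f r]] Bop_eq[OF g is_B_zonal_right[OF s]]
  have br: "br ?X ?U p = - br ?U ?X p" for p
    by (simp add: br_def)
  have "rnabla g ?U ?X p = sfield (\<i> * c) M (smult (real M / 2) (pderiv f * q + (s - smult \<mu> r))) p"
    "rnabla g ?X ?U p = sfield (\<i> * c) M (smult (real M / 2) (- (pderiv f * q) + (s - smult \<mu> r))) p"
    if p: "p \<in> S2" for p
    using br_zonal[of f c M q] B p
    by (simp_all add: rnabla_def br eq_S2_def sfield_smult sfield_add sfield_diff sfield_uminus algebra_simps)
  then show "rnabla g ?U ?X \<simeq> sfield (\<i> * c) M (smult (real M / 2) (pderiv f * q + (s - smult \<mu> r)))"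
    "rnabla g ?X ?U \<simeq> sfield (\<i> * c) M (smult (real M / 2) (- (pderiv f * q) + (s - smult \<mu> r)))"
    by (simp_all add: eq_S2_def)
qed

lemma sfield_zero_eq: "sfield c M 0 = (\<lambda>p. 0)"
  by (simp add: fun_eq_iff)

lemma admissible_0:
  assumes "admissible g M q"
  shows "admissible g M' 0"
  using assms by (auto simp: admissible_def)

text \<open>Zonal flows are steady: with M = 0 the result of \<open>rnabla_zonal\<close> has the
  factor zero.\<close>

lemma rnabla_zonal_self:
  assumes f: "Lam 0 f = smult \<mu> f" and adm: "admissible g 0 0"
  shows "rnabla g (sfield 1 0 f) (sfield 1 0 f) \<simeq> (\<lambda>p. 0)"
  using rnabla_zonal(1)[OF f _ adm _ adm, of f 1] by (simp add: sfield_zero_eq)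

text \<open>Linearity of \<open>Bop\<close> not being at hand, the zero field is read as the zonal
  field with f = 0, to which \<open>rnabla_zonal\<close> applies. It is wanted for the vanishing
  imaginary part of \<open>e 3 0\<close>.\<close>

lemma rnabla_zero:
  assumes "admissible g M 0" "X \<simeq> sfield c M q" "Z \<simeq> (\<lambda>p. 0)"
  shows "rnabla g Z X \<simeq> (\<lambda>p. 0)" "rnabla g X Z \<simeq> (\<lambda>p. 0)" "br Z X \<simeq> (\<lambda>p. 0)"
proof -
  have Z: "Z \<simeq> sfield 1 0 0"
    using assms(3) by (simp add: sfield_zero_eq)
  note r = rnabla_zonal[where f = 0 and \<mu> = 0 and r = 0 and s = 0 and q = q and c = c, OF _ _ assms(1) _ assms(1)]
  show "rnabla g Z X \<simeq> (\<lambda>p. 0)"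
    using eq_S2_trans[OF eq_S2_rnabla[OF Z assms(2)] r(1)] by (simp add: sfield_zero_eq)
  show "rnabla g X Z \<simeq> (\<lambda>p. 0)"
    using eq_S2_trans[OF eq_S2_rnabla[OF assms(2) Z] r(2)] by (simp add: sfield_zero_eq)
  show "br Z X \<simeq> (\<lambda>p. 0)"
    using eq_S2_trans[OF eq_S2_br[OF Z assms(2)] br_zonal] by (simp add: sfield_zero_eq)
qed

section \<open>Associated Legendre functions\<close>

definition rodrigues :: "nat \<Rightarrow> real poly" where
  "rodrigues n = smult (1 / (2 ^ n * fact n)) ([:-1, 0, 1:] ^ n)"

text \<open>The polynomial factor of the associated Legendre function of degree k and order M; the zero
  convention for k < 0 makes the three-term recurrence valid from k = 0 on.\<close>

definition leg :: "nat \<Rightarrow> int \<Rightarrow> real poly" where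
  "leg M k = (if k < 0 then 0 else (pderiv ^^ (nat k + M)) (rodrigues (nat k)))"

lemma pderiv_rodrigues_Suc: "pderiv (rodrigues (Suc n)) = [:0, 1:] * rodrigues n"
  by (simp add: rodrigues_def pderiv_smult pderiv_power_Suc pderiv_pCons smult_add_left[symmetric] field_simps
      del: power_Suc of_nat_Suc) simp

lemma rodrigues_Suc: "[:-1, 0, 1:] * rodrigues n = smult (2 * real n + 2) (rodrigues (Suc n))"
proof -
  have "1 / (2 ^ n * fact n) = (2 * real n + 2) * (1 / (2 ^ Suc n * fact (Suc n)))"
    by (simp add: divide_simps)
  then show ?thesis
    by (simp only: rodrigues_def mult_smult_right smult_smult power_Suc)
qed

text \<open>Differentiated n more times this is P'_(n+1) = (2 n + 1) P_n + P'_(n-1).\<close>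

lemma pderiv2_rodrigues:
  "pderiv (pderiv (rodrigues (Suc n))) = smult (2 * real n + 1) (rodrigues n)
     + (if n = 0 then 0 else rodrigues (n - 1))"
proof (cases n)
  case 0
  then show ?thesis
    by (simp add: pderiv_rodrigues_Suc) (simp add: rodrigues_def pderiv_pCons)
next
  case (Suc j)
  have "[:0, 1:] * ([:0, 1:] * rodrigues j) = [:-1, 0, 1:] * rodrigues j + rodrigues j"
    by (rule poly_ext) (simp add: algebra_simps)
  also have "\<dots> = smult (2 * real j + 2) (rodrigues n) + rodrigues j"
    by (simp only: rodrigues_Suc Suc)
  finally have *: "[:0, 1:] * ([:0, 1:] * rodrigues j) = smult (2 * real j + 2) (rodrigues n) + rodrigues j" .
  have "pderiv (pderiv (rodrigues (Suc n))) = rodrigues n + [:0, 1:] * ([:0, 1:] * rodrigues j)"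
    unfolding pderiv_rodrigues_Suc pderiv_mult by (simp add: pderiv_pCons Suc pderiv_rodrigues_Suc)
  also have "\<dots> = smult (2 * real n + 1) (rodrigues n) + rodrigues j"
    unfolding * by (rule poly_ext) (simp add: Suc algebra_simps)
  finally show ?thesis
    by (simp add: Suc)
qed

lemma higher_pderiv_diff: "(pderiv ^^ n) (p - q) = (pderiv ^^ n) p - (pderiv ^^ n) q" for p q :: "real poly"
  by (induction n) (simp_all add: pderiv_diff)

lemma higher_pderiv_times_x:
  "(pderiv ^^ n) ([:0, 1:] * f) = [:0, 1:] * (pderiv ^^ n) f + smult (real n) ((pderiv ^^ (n - 1)) f)"
  for f :: "real poly"
proof (induction n)
  case (Suc n)
  have "pderiv ((pderiv ^^ n) ([:0, 1:] * f)) = [:0, 1:] * pderiv ((pderiv ^^ n) f) + (pderiv ^^ n) f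
      + smult (real n) (pderiv ((pderiv ^^ (n - 1)) f))"
    unfolding Suc by (simp add: pderiv_add pderiv_smult pderiv_pCons)
  also have "smult (real n) (pderiv ((pderiv ^^ (n - 1)) f)) = smult (real n) ((pderiv ^^ n) f)"
    by (cases n) simp_all
  finally show ?case
    by (simp add: smult_add_left add.commute)
qed simp

text \<open>With V_n for \<open>rodrigues n\<close>, the degree k + 1 is expressed twice: by Leibniz
  from V_(n+1)' = x V_n, and from the second derivative of V_(n+1). Both contain the derivative of
  order n + M - 1 of V_n, which is eliminated.\<close>

lemma leg_recurrence:
  assumes "k \<ge> 0"
  shows "smult (2 * of_int k + 1) ([:0, 1:] * leg M k)
    = smult (of_int k + 1 - real M) (leg M (k + 1)) + smult (of_int k + real M) (leg M (k - 1))"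
proof -
  define n where "n = nat k"
  have k: "k = int n"
    using assms by (simp add: n_def)
  have l1: "leg M (k + 1) = (pderiv ^^ (n + M)) (pderiv (rodrigues (Suc n)))"
    by (simp add: leg_def k nat_add_distrib funpow_swap1)
  then have E1: "leg M (k + 1) = [:0, 1:] * leg M k + smult (real (n + M)) ((pderiv ^^ (n + M - 1)) (rodrigues n))"
    unfolding pderiv_rodrigues_Suc higher_pderiv_times_x by (simp add: leg_def k)
  show ?thesis
  \<comment> \<open>For n + M = 0 the order n + M - 1 is truncated, but its coefficient is zero and
    E1 alone is the claim.\<close>
  proof (cases "n + M = 0")
    case True
    then show ?thesis
      using E1 by (simp add: k)
  next
    case False
    have "leg M (k + 1) = (pderiv ^^ (n + M - 1)) (pderiv (pderiv (rodrigues (Suc n))))"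
      using False unfolding l1 by (cases "n + M") (simp_all add: funpow_swap1)
    also have "\<dots> = smult (2 * real n + 1) ((pderiv ^^ (n + M - 1)) (rodrigues n))
        + (pderiv ^^ (n + M - 1)) (if n = 0 then 0 else rodrigues (n - 1))"
      unfolding pderiv2_rodrigues by (simp add: higher_pderiv_add higher_pderiv_smult)
    also have "(pderiv ^^ (n + M - 1)) (if n = 0 then 0 else rodrigues (n - 1)) = leg M (k - 1)"
      by (cases n) (simp_all add: leg_def k)
    finally have E2: "smult (2 * real n + 1) ((pderiv ^^ (n + M - 1)) (rodrigues n)) = leg M (k + 1) - leg M (k - 1)"
      by simp
    have "smult (2 * real n + 1) (leg M (k + 1)) = smult (2 * real n + 1) ([:0, 1:] * leg M k)
        + smult (real (n + M)) (smult (2 * real n + 1) ((pderiv ^^ (n + M - 1)) (rodrigues n)))"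
      by (subst E1) (simp add: smult_add_right mult.commute)
    then have "smult (2 * real n + 1) ([:0, 1:] * leg M k)
       = smult (2 * real n + 1) (leg M (k + 1)) - smult (real (n + M)) (leg M (k + 1) - leg M (k - 1))"
      unfolding E2 by simp
    also have "\<dots> = smult (real n + 1 - real M) (leg M (k + 1)) + smult (real n + real M) (leg M (k - 1))"
      by (rule poly_ext) (simp add: algebra_simps)
    finally show ?thesis
      by (simp add: k)
  qed
qed

definition ev :: "int \<Rightarrow> real" where "ev k = of_int k * (of_int k + 1)"

text \<open>V = \<open>rodrigues n\<close> satisfies (x^2 - 1) V' = 2 n x V; differentiating n + M +
  1 times yields the associated Legendre equation.\<close>

lemma Lam_leg: "Lam M (leg M k) = smult (ev k) (leg M k)"
proof (cases "k < 0")
  case False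
  define n N where "n = nat k" and "N = n + M"
  have k: "k = int n"
    using False by (simp add: n_def)
  let ?V = "rodrigues n" and ?y = "leg M k" and ?x = "[:0, 1:] :: real poly"
  have y: "?y = (pderiv ^^ N) ?V"
    by (simp add: leg_def N_def k)
  have rel: "?x * (?x * pderiv ?V) - pderiv ?V = smult (2 * real n) (?x * ?V)"
  proof (cases n)
    case 0
    then show ?thesis by (simp add: rodrigues_def)
  next
    case (Suc j)
    have "?x * (?x * pderiv ?V) - pderiv ?V = [:-1, 0, 1:] * pderiv ?V"
      by (rule poly_ext) (simp add: algebra_simps)
    also have "\<dots> = ?x * ([:-1, 0, 1:] * rodrigues j)"
      unfolding Suc pderiv_rodrigues_Suc by (rule mult.left_commute)
    also have "\<dots> = smult (2 * real n) (?x * ?V)"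
      unfolding rodrigues_Suc by (simp add: Suc add.commute)
    finally show ?thesis .
  qed
  have d: "(pderiv ^^ Suc N) ?V = pderiv ?y" "(pderiv ^^ N) (pderiv ?V) = pderiv ?y"
    "(pderiv ^^ Suc N) (pderiv ?V) = pderiv (pderiv ?y)"
    by (simp_all add: y funpow_swap1)
  have d': "smult (real N) ((pderiv ^^ (N - 1)) (pderiv ?V)) = smult (real N) ?y"
    by (cases N) (simp_all add: y funpow_swap1)
  have "(pderiv ^^ Suc N) (?x * (?x * pderiv ?V) - pderiv ?V)
      = ?x * (?x * pderiv (pderiv ?y) + smult (real (Suc N)) (pderiv ?y))
        + smult (real (Suc N)) (?x * pderiv ?y + smult (real N) ?y) - pderiv (pderiv ?y)"
    unfolding higher_pderiv_diff higher_pderiv_times_x d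
    by (simp only: diff_Suc_1 higher_pderiv_times_x d d')
  moreover have "(pderiv ^^ Suc N) (smult (2 * real n) (?x * ?V))
      = smult (2 * real n) (?x * pderiv ?y + smult (real (Suc N)) ?y)"
    unfolding higher_pderiv_smult higher_pderiv_times_x d by (simp add: y)
  ultimately have E: "?x * (?x * pderiv (pderiv ?y) + smult (real (Suc N)) (pderiv ?y))
        + smult (real (Suc N)) (?x * pderiv ?y + smult (real N) ?y) - pderiv (pderiv ?y)
      = smult (2 * real n) (?x * pderiv ?y + smult (real (Suc N)) ?y)"
    using rel by simp
  show ?thesis
  proof (rule poly_ext)
    fix z
    from arg_cong[OF E, of "\<lambda>p. poly p z"]
    show "poly (Lam M ?y) z = poly (smult (ev k) ?y) z"
      by (simp add: poly_Lam ev_def k N_def algebra_simps)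
  qed
qed (simp add: leg_def)

lemma leg_parity: "poly (leg M k) (- z) = (-1) ^ (nat k + M) * poly (leg M k) z"
proof -
  have "poly ((pderiv ^^ n) (rodrigues j)) (- z) = (-1) ^ n * poly ((pderiv ^^ n) (rodrigues j)) z" for n j z
  proof (induction n arbitrary: z)
    case 0
    then show ?case by (simp add: rodrigues_def)
  next
    case (Suc n)
    show ?case
      using poly_pderiv_parity[OF Suc] by simp
  qed
  then show ?thesis
    by (simp add: leg_def)
qed

text \<open>The stream function of degree k has parity (-1)^k, so odd degrees descend to the
  projective plane.\<close>

lemma leg_admissible:
  assumes "g = sdiff_S2 \<or> g = sdiff_RP2 \<and> odd k"
  shows "admissible g M (leg M k)"
proof (cases "k < 0")
  case True
  then show ?thesis
    using assms by (auto simp: admissible_def leg_def)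
next
  case False
  then have "odd k \<Longrightarrow> odd (nat k)"
    by (simp add: even_nat_iff)
  then show ?thesis
    using assms by (auto simp: admissible_def leg_parity power_add)
qed

section \<open>Multiplication by the zonal profile\<close>

definition up :: "nat \<Rightarrow> int \<Rightarrow> real" where
  "up M k = (of_int k + 1 - real M) / (2 * of_int k + 1)"
definition down :: "nat \<Rightarrow> int \<Rightarrow> real" where
  "down M k = (of_int k + real M) / (2 * of_int k + 1)"

lemma x_leg:
  assumes "k \<ge> 0"
  shows "z * poly (leg M k) z = up M k * poly (leg M (k + 1)) z + down M k * poly (leg M (k - 1)) z"
proof -
  have "(2 * of_int k + 1) * (z * poly (leg M k) z)
      = (of_int k + 1 - real M) * poly (leg M (k + 1)) z + (of_int k + real M) * poly (leg M (k - 1)) z"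
    using arg_cong[OF leg_recurrence[OF assms, of M], of "\<lambda>p. poly p z"] by (simp add: mult.left_commute)
  moreover have "2 * of_int k + 1 \<noteq> (0::real)"
    using assms by linarith
  ultimately show ?thesis
    by (simp add: up_def down_def divide_simps) (simp add: algebra_simps)
qed

text \<open>Matrix coefficients of multiplication by the zonal profile of the flow in the basis of
  Legendre polynomials.\<close>

definition al :: "nat \<Rightarrow> int \<Rightarrow> real" where "al M k = 5 * up M k * up M (k + 1)"
definition be :: "nat \<Rightarrow> int \<Rightarrow> real" where
  "be M k = 5 * (up M k * down M (k + 1) + down M k * up M (k - 1)) - 1"
definition de :: "nat \<Rightarrow> int \<Rightarrow> real" where "de M k = 5 * down M k * down M (k - 1)"

text \<open>One application of the three-band matrix to degree k. The weight w, depending on the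
  target degree, carries functions of the Laplacian such as 1 / ev; V is left free so that lifts can
  be nested and linear maps pushed inside.\<close>

definition lift :: "nat \<Rightarrow> (int \<Rightarrow> real) \<Rightarrow> int \<Rightarrow> (int \<Rightarrow> real poly) \<Rightarrow> real poly" where
  "lift M w k V = smult (al M k * w (k + 2)) (V (k + 2)) + smult (be M k * w k) (V k)
     + smult (de M k * w (k - 2)) (V (k - 2))"

abbreviation profile :: "real poly" where "profile \<equiv> [:-1, 0, 5:]"

lemma profile_leg:
  assumes "k \<ge> 1"
  shows "profile * leg M k = lift M (\<lambda>i. 1) k (leg M)"
proof (rule poly_ext)
  fix z
  have "poly (profile * leg M k) z = 5 * (z * (z * poly (leg M k) z)) - poly (leg M k) z"
    by (simp add: algebra_simps)
  also have "z * poly (leg M k) z = up M k * poly (leg M (k + 1)) z + down M k * poly (leg M (k - 1)) z"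
    using assms by (intro x_leg) simp
  also have "z * \<dots> = up M k * (z * poly (leg M (k + 1)) z) + down M k * (z * poly (leg M (k - 1)) z)"
    by (simp add: algebra_simps)
  also have "z * poly (leg M (k + 1)) z = up M (k + 1) * poly (leg M (k + 2)) z + down M (k + 1) * poly (leg M k) z"
    using x_leg[of "k + 1" z M] assms by (simp add: add.assoc)
  also have "z * poly (leg M (k - 1)) z = up M (k - 1) * poly (leg M k) z + down M (k - 1) * poly (leg M (k - 2)) z"
    using x_leg[of "k - 1" z M] assms by simp
  finally show "poly (profile * leg M k) z = poly (lift M (\<lambda>i. 1) k (leg M)) z"
    by (simp add: lift_def al_def be_def de_def algebra_simps)
qed

lemma lift_linear:
  assumes "\<And>x y. \<Phi> (x + y) = \<Phi> x + \<Phi> y" "\<And>a x. \<Phi> (smult a x) = smult a (\<Phi> x)"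
  shows "\<Phi> (lift M w k V) = lift M w k (\<lambda>i. \<Phi> (V i))"
  by (simp add: lift_def assms)

lemma lift_admissible:
  assumes "admissible g M (V (k + 2))" "admissible g M (V k)" "admissible g M (V (k - 2))"
  shows "admissible g M (lift M w k V)"
  unfolding lift_def by (intro admissible_add admissible_smult assms)

lemma lift_cong:
  assumes "V (k + 2) = V' (k + 2)" "V k = V' k" "V (k - 2) = V' (k - 2)"
  shows "lift M w k V = lift M w k V'"
  by (simp add: lift_def assms)

text \<open>\<open>ev\<close> vanishes at i = -1 and i = 0, but there \<open>leg M i\<close> is zero
  as well: by convention at -1, and at 0 because M > 0 derivatives are taken of a constant. The
  bound -1 is the lowest degree that \<open>lift\<close> reaches from k = 1.\<close>

lemma leg_ev_cancel:
  assumes "M \<noteq> 0" "i \<ge> -1"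
  shows "smult (a * (1 / ev i)) (smult (ev i) (leg M i)) = smult a (leg M i)"
proof -
  consider "i = -1" | "i = 0" | "i \<ge> 1"
    using assms by linarith
  then show ?thesis
  proof cases
    case 2
    obtain n where "M = Suc n"
      using assms(1) not0_implies_Suc by blast
    moreover have "(pderiv ^^ n) (pderiv (rodrigues 0)) = 0"
      by (simp add: rodrigues_def higher_pderiv_0)
    ultimately have "leg M 0 = 0"
      by (simp add: leg_def funpow_swap1)
    then show ?thesis
      by (simp add: 2)
  next
    case 3
    then have "of_int i \<ge> (1::real)"
      by simp
    then show ?thesis
      by (simp add: ev_def)
  qed (simp add: leg_def)
qed

definition inv_profile :: "nat \<Rightarrow> int \<Rightarrow> real poly" where
  "inv_profile M k = lift M (\<lambda>i. 1 / ev i) k (leg M)"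

lemma Lam_inv_profile:
  assumes "M \<noteq> 0" "k \<ge> 1"
  shows "Lam M (inv_profile M k) = profile * leg M k"
proof -
  have "Lam M (inv_profile M k) = lift M (\<lambda>i. 1 / ev i) k (\<lambda>i. smult (ev i) (leg M i))"
    unfolding inv_profile_def by (subst lift_linear) (simp_all add: Lam_add Lam_smult Lam_leg)
  also have "\<dots> = lift M (\<lambda>i. 1) k (leg M)"
  proof -
    have k: "k + 2 \<ge> -1" "k \<ge> -1" "k - 2 \<ge> -1"
      using assms(2) by auto
    show ?thesis
      by (simp only: lift_def leg_ev_cancel[OF assms(1) k(1)] leg_ev_cancel[OF assms(1) k(2)]
          leg_ev_cancel[OF assms(1) k(3)] mult_1_right)
  qed
  finally show ?thesis
    by (simp only: profile_leg[OF assms(2)])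
qed

lemma profile_combination:
  assumes "k \<ge> 1"
  shows "smult x (profile * leg M k) + smult y (inv_profile M k) = lift M (\<lambda>i. x + y / ev i) k (leg M)"
  unfolding profile_leg[OF assms] inv_profile_def
  by (rule poly_ext) (simp add: lift_def algebra_simps)

text \<open>In the weight, -1 is the bracket, ev k / ev i comes from B(v, U) and mu / ev i from B(U,
  v).\<close>

lemma rnabla_leg:
  assumes f: "Lam 0 f = smult \<mu> f" "pderiv f = smult \<kappa> profile" and k: "k \<ge> 1"
    and adm: "\<And>i. even (i - k) \<Longrightarrow> admissible g M (leg M i)"
  shows "rnabla g (sfield c M (leg M k)) (sfield 1 0 f)
    \<simeq> sfield (\<i> * c) M (smult (real M / 2 * \<kappa>) (lift M (\<lambda>i. -1 + (ev k - \<mu>) / ev i) k (leg M)))"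
proof -
  let ?r = "smult \<kappa> (inv_profile M k)" and ?s = "smult (\<kappa> * ev k) (inv_profile M k)"
  have r: "M = 0 \<or> Lam M ?r = pderiv f * leg M k" and s: "M = 0 \<or> Lam M ?s = pderiv f * Lam M (leg M k)"
    using Lam_inv_profile[OF _ k, of M]
    by (cases "M = 0"; simp only: f(2) Lam_smult Lam_leg mult_smult_left mult_smult_right smult_smult mult.commute
        not_False_eq_True simp_thms)+
  have a: "admissible g M ?r" "admissible g M ?s"
    unfolding inv_profile_def by (intro admissible_smult lift_admissible adm; simp)+
  have "smult (real M / 2) (- (pderiv f * leg M k) + (?s - smult \<mu> ?r))
      = smult (real M / 2 * \<kappa>) (smult (-1) (profile * leg M k) + smult (ev k - \<mu>) (inv_profile M k))"
    unfolding f(2) by (rule poly_ext) (simp add: algebra_simps)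
  then show ?thesis
    using rnabla_zonal(2)[OF f(1) r a(1) s a(2), of c] by (simp only: profile_combination[OF k])
qed

text \<open>The second connection step, applied to a field spread over degrees l + 2, l and l - 2,
  each with its own eigenvalue ev k. The bound on l keeps all three at least 1, as
  \<open>profile_leg\<close> asks.\<close>

lemma rnabla_lift:
  assumes f: "Lam 0 f = smult \<mu> f" "pderiv f = smult \<kappa> profile" and l: "l \<ge> 3"
    and adm: "\<And>i. even (i - l) \<Longrightarrow> admissible g M (leg M i)"
  shows "rnabla g (sfield 1 0 f) (sfield c M (smult a (lift M w l (leg M))))
    \<simeq> sfield (\<i> * c) M (smult (real M / 2 * (a * \<kappa>)) (lift M w l (\<lambda>k. lift M (\<lambda>i. 1 + (ev k - \<mu>) / ev i) k (leg M))))"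
   (is ?A)
  and "rnabla g (sfield c M (smult a (lift M w l (leg M)))) (sfield 1 0 f)
    \<simeq> sfield (\<i> * c) M (smult (real M / 2 * (a * \<kappa>)) (lift M w l (\<lambda>k. lift M (\<lambda>i. -1 + (ev k - \<mu>) / ev i) k (leg M))))"
   (is ?B)
proof -
  let ?q = "smult a (lift M w l (leg M))"
  let ?r = "smult (a * \<kappa>) (lift M w l (inv_profile M))"
    and ?s = "smult (a * \<kappa>) (lift M w l (\<lambda>k. smult (ev k) (inv_profile M k)))"
  have hq: "pderiv f * ?q = smult (a * \<kappa>) (lift M w l (\<lambda>k. profile * leg M k))"
    unfolding f(2) by (rule poly_ext) (simp add: lift_def algebra_simps)
  have k: "l + 2 \<ge> 1" "l \<ge> 1" "l - 2 \<ge> 1"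
    using l by auto
  have inv: "Lam M (inv_profile M (l + 2)) = profile * leg M (l + 2)" "Lam M (inv_profile M l) = profile * leg M l"
    "Lam M (inv_profile M (l - 2)) = profile * leg M (l - 2)" if "M \<noteq> 0"
    using k Lam_inv_profile[OF that] by auto
  have "Lam M ?r = pderiv f * ?q" if "M \<noteq> 0"
  proof -
    have "Lam M ?r = smult (a * \<kappa>) (lift M w l (\<lambda>k. Lam M (inv_profile M k)))"
      by (simp only: Lam_smult lift_linear[of "Lam M", OF Lam_add Lam_smult])
    also have "lift M w l (\<lambda>k. Lam M (inv_profile M k)) = lift M w l (\<lambda>k. profile * leg M k)"
      by (rule lift_cong) (rule inv[OF that])+
    finally show ?thesis
      by (simp only: hq)
  qed
  then have r: "M = 0 \<or> Lam M ?r = pderiv f * ?q"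
    by blast
  have "Lam M ?s = pderiv f * Lam M ?q" if "M \<noteq> 0"
  proof -
    have "Lam M ?s = smult (a * \<kappa>) (lift M w l (\<lambda>k. smult (ev k) (Lam M (inv_profile M k))))"
      by (simp only: Lam_smult lift_linear[of "Lam M", OF Lam_add Lam_smult])
    also have "lift M w l (\<lambda>k. smult (ev k) (Lam M (inv_profile M k))) = lift M w l (\<lambda>k. smult (ev k) (profile * leg M k))"
      by (rule lift_cong) (simp_all only: inv[OF that])
    also have "smult (a * \<kappa>) \<dots> = pderiv f * smult a (lift M w l (\<lambda>k. smult (ev k) (leg M k)))"
      unfolding f(2) by (rule poly_ext) (simp add: lift_def algebra_simps)
    also have "\<dots> = pderiv f * Lam M ?q"
      by (simp only: Lam_smult lift_linear[of "Lam M", OF Lam_add Lam_smult] Lam_leg)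
    finally show ?thesis .
  qed
  then have s: "M = 0 \<or> Lam M ?s = pderiv f * Lam M ?q"
    by blast
  have a: "admissible g M ?r" "admissible g M ?s"
    unfolding inv_profile_def by (intro admissible_smult lift_admissible adm; simp)+
  have comb: "smult (real M / 2) (smult x (pderiv f * ?q) + (?s - smult \<mu> ?r))
     = smult (real M / 2 * (a * \<kappa>)) (lift M w l (\<lambda>k. lift M (\<lambda>i. x + (ev k - \<mu>) / ev i) k (leg M)))" for x
  proof -
    have "smult (real M / 2) (smult x (pderiv f * ?q) + (?s - smult \<mu> ?r))
      = smult (real M / 2 * (a * \<kappa>)) (lift M w l (\<lambda>k. smult x (profile * leg M k) + smult (ev k - \<mu>) (inv_profile M k)))"
      unfolding hq by (rule poly_ext) (simp add: lift_def algebra_simps)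
    also have "lift M w l (\<lambda>k. smult x (profile * leg M k) + smult (ev k - \<mu>) (inv_profile M k))
      = lift M w l (\<lambda>k. lift M (\<lambda>i. x + (ev k - \<mu>) / ev i) k (leg M))"
      by (rule lift_cong) (rule profile_combination, use l in simp)+
    finally show ?thesis .
  qed
  show ?A
    using rnabla_zonal(1)[OF f(1) r a(1) s a(2), of c] comb[of 1] by simp
  show ?B
    using rnabla_zonal(2)[OF f(1) r a(1) s a(2), of c] comb[of "-1"] by simp
qed

section \<open>Orthogonality relations\<close>

text \<open>Green's identity. The z component of \<open>sfield d M r\<close> is -M times the stream
  function with d turned into i d, so \<open>sphere_integral_hodge\<close>, read backwards, does the
  integration by parts.\<close>

lemma ip_sfield:
  assumes "M \<noteq> 0" "Lam M q = smult a q"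
  shows "ip (sfield c M q) (sfield d M r) = a * sphere_integral (\<lambda>p. stream (\<i> * c) M q p * stream (\<i> * d) M r p)"
proof -
  have w: "sfield d M r p $ 3 = - real M * stream (\<i> * d) M r p" for p
    using H_Euler(2)[of p d M] unfolding sfield_nth stream_def by algebra
  have "real M * ip (sfield c M q) (sfield d M r) = real M * ip (sfield (\<i> * - (\<i> * c)) M q) (sfield d M r)"
    by simp
  also have "\<dots> = sphere_integral (\<lambda>p. stream (- (\<i> * c)) M (smult a q) p * sfield d M r p $ 3)"
    by (rule sphere_integral_hodge[symmetric]) (use assms sfield_in_sdiff_S2 in auto)
  also have "\<dots> = sphere_integral (\<lambda>p. (real M * a) * (stream (\<i> * c) M q p * stream (\<i> * d) M r p))"
    by (rule sphere_integral_cong) (simp only: w, simp add: stream_def)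
  also have "\<dots> = real M * (a * sphere_integral (\<lambda>p. stream (\<i> * c) M q p * stream (\<i> * d) M r p))"
    by (simp only: sphere_integral_cmult mult.assoc)
  finally show ?thesis
    using assms(1) by simp
qed

lemma ip_leg_orthogonal:
  assumes "M \<noteq> 0" "k \<ge> -1" "l \<ge> 1" "k \<noteq> l"
  shows "ip (sfield c M (leg M k)) (sfield d M (leg M l)) = 0"
proof -
  let ?J = "sphere_integral (\<lambda>p. stream (\<i> * c) M (leg M k) p * stream (\<i> * d) M (leg M l) p)"
  have "ip (sfield c M (leg M k)) (sfield d M (leg M l)) = ev k * ?J"
    by (rule ip_sfield[OF assms(1) Lam_leg])
  moreover have "ip (sfield c M (leg M k)) (sfield d M (leg M l)) = ev l * ?J"
    using ip_sfield[OF assms(1) Lam_leg, of d l c "leg M k"] ip_commute by (simp add: mult.commute)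
  ultimately have "(ev k - ev l) * ?J = 0"
    unfolding left_diff_distrib by linarith
  moreover have "ev k \<noteq> ev l"
  proof
    assume "ev k = ev l"
    then have "(of_int k - of_int l) * (of_int k + of_int l + 1) = (0::real)"
      by (simp add: ev_def algebra_simps)
    then have "k = l \<or> real_of_int (k + l + 1) = 0"
      by auto
    then show False
      using assms by linarith
  qed
  ultimately show ?thesis
    using ip_sfield[OF assms(1) Lam_leg, of c k d "leg M l"] by simp
qed

text \<open>Up to the factor M, the integrand is the derivative of \<open>stream (-i c) M t\<close>
  along the divergence-free rotation field.\<close>

lemma sphere_integral_stream:
  assumes "M \<noteq> 0"
  shows "sphere_integral (stream c M t) = 0"
proof -
  have "sphere_integral (\<lambda>p. dstream (- (\<i> * c)) M t p (sfield 1 0 [:0, 1:] p)) = 0"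
    by (rule sphere_integral_gradient[OF C1_stream sfield_in_sdiff_S2])
  moreover have "dstream (- (\<i> * c)) M t p (sfield 1 0 [:0, 1:] p) = real M * stream c M t p" for p
  proof -
    have U: "sfield 1 0 [:0, 1:] p $ 1 = - p$2" "sfield 1 0 [:0, 1:] p $ 2 = p$1" "sfield 1 0 [:0, 1:] p $ 3 = 0"
      by (simp_all add: sfield_nth H0_def H1_def pderiv_pCons)
    have H: "H1 (- (\<i> * c)) M p = - H1 (\<i> * c) M p" "H1 (\<i> * - (\<i> * c)) M p = H1 c M p"
      by simp_all
    show ?thesis
      using H_Euler(1)[of p c M] unfolding dstream_def stream_def U H by algebra
  qed
  ultimately show ?thesis
    using assms by (simp add: sphere_integral_cmult)
qed

text \<open>The pointwise inner product is again a stream function of order M, so its integral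
  vanishes.\<close>

lemma ip_zonal:
  assumes "M \<noteq> 0"
  shows "ip (sfield 1 0 f) (sfield c M q) = 0"
proof -
  let ?t = "pderiv f * ([:1, 0, -1:] * pderiv q - smult (real M) ([:0, 1:] * q))"
  have "ip (sfield 1 0 f) (sfield c M q) = sphere_integral (stream c M ?t)"
    unfolding ip_eq_sphere_integral
  proof (rule sphere_integral_cong)
    fix p assume "p \<in> S2"
    then have n: "p$1 * p$1 + p$2 * p$2 + p$3 * p$3 = 1"
      by (simp add: mem_S2)
    let ?h = "poly (pderiv f) (p$3)"
    have U: "sfield 1 0 f p $ 1 = - ?h * p$2" "sfield 1 0 f p $ 2 = ?h * p$1" "sfield 1 0 f p $ 3 = 0"
      by (simp_all add: sfield_nth H1_def H0_def)
    have t: "poly ?t (p$3) = ?h * ((1 - p$3 * p$3) * poly (pderiv q) (p$3) - real M * p$3 * poly q (p$3))"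
      by (simp add: algebra_simps)
    show "sfield 1 0 f p \<bullet> sfield c M q p = stream c M ?t p"
      unfolding inner_vec3 U stream_def t sfield_nth(1,2,3)[of c M]
      using n H_Euler(1)[of p c M] by algebra
  qed
  then show ?thesis
    by (simp add: sphere_integral_stream[OF assms])
qed

section \<open>The basis fields as polynomial fields\<close>

text \<open>Makes the filter in \<open>field_of_sph\<close> proper, so that \<open>Lim\<close> is
  determined at the poles. The sphere is connected, hence perfect, and stays so near p after removal
  of two points.\<close>

lemma poles_islimpt:
  assumes "p \<in> S2"
  shows "p islimpt (S2 - poles)"
proof -
  have "poles \<subseteq> {vector [0, 0, 1], vector [0, 0, -1]}"
  proof
    fix q :: vec assume "q \<in> poles"
    then have "q$1 * q$1 + q$2 * q$2 + q$3 * q$3 = 1" "q$3 = 1 \<or> q$3 = -1"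
      by (auto simp: poles_def mem_S2)
    moreover from this have "q$1 * q$1 + q$2 * q$2 = 0"
      by auto
    then have "q$1 = 0" "q$2 = 0"
      by (simp_all add: sum_squares_eq_zero_iff)
    ultimately show "q \<in> {vector [0, 0, 1], vector [0, 0, -1]}"
      by (auto simp: vec3_eq_iff)
  qed
  then have "finite poles"
    using finite_subset by blast
  have "connected S2"
    unfolding S2_def by (rule connected_sphere) simp
  moreover have "S2 \<noteq> {x}" for x
  proof
    assume "S2 = {x}"
    then have "vector [0, 0, 1] = x" "vector [0, 0, -1] = x"
      using mem_S2[of "vector [0, 0, 1]"] mem_S2[of "vector [0, 0, -1]"] by auto
    then show False
      by (auto simp: vec3_eq_iff)
  qed
  ultimately have "p islimpt S2"
    using connected_imp_perfect assms by blast
  then have "p islimpt (poles \<union> (S2 - poles))"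
    by (rule islimpt_subset) auto
  then show ?thesis
    using islimpt_Un_finite[OF \<open>finite poles\<close>] by blast
qed

lemma field_of_sph_eq:
  assumes W: "\<And>\<theta> \<phi>. 0 < \<theta> \<Longrightarrow> \<theta> < pi \<Longrightarrow> W \<theta> \<phi> = F (sph \<theta> \<phi>)" and c: "continuous_on S2 F"
  shows "field_of_sph W \<simeq> F"
  unfolding eq_S2_def
proof
  fix p assume p: "p \<in> S2"
  have off: "W (arccos (q$3)) (Arg (Complex (q$1) (q$2))) = F q" if q: "q \<in> S2 - poles" for q
  proof -
    have "(q$3)\<^sup>2 \<le> 1"
      using q unfolding Diff_iff mem_S2 power2_eq_square by (smt (verit) zero_le_square)
    then have "-1 \<le> q$3" "q$3 \<le> 1"
      by (auto simp: abs_square_le_1)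
    moreover have "q$3 \<noteq> 1" "q$3 \<noteq> -1"
      using q by (auto simp: poles_def)
    ultimately have "-1 < q$3" "q$3 < 1"
      by auto
    then have "0 < arccos (q$3)" "arccos (q$3) < pi"
      using arccos_lt_bounded by blast+
    then show ?thesis
      using W S2_eq_sph[of q] q by auto
  qed
  show "field_of_sph W p = F p"
  proof (cases "p \<in> poles")
    case False
    then show ?thesis
      using off p by (simp add: field_of_sph_def)
  next
    case True
    have "(F \<longlongrightarrow> F p) (at p within (S2 - poles))"
      using c p unfolding continuous_on_def by (meson Diff_subset tendsto_within_subset)
    then have "((\<lambda>q. W (arccos (q$3)) (Arg (Complex (q$1) (q$2)))) \<longlongrightarrow> F p) (at p within (S2 - poles))"
      by (rule Lim_transform_eventually) (auto simp: eventually_at_filter off intro!: always_eventually)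
    moreover have "at p within (S2 - poles) \<noteq> bot"
      using poles_islimpt[OF p] by (simp add: trivial_limit_within)
    ultimately have "Lim (at p within (S2 - poles)) (\<lambda>q. W (arccos (q$3)) (Arg (Complex (q$1) (q$2)))) = F p"
      by (rule tendsto_Lim[rotated])
    then show ?thesis
      using True by (simp add: field_of_sph_def)
  qed
qed

lemma sgrad_sph_eq:
  assumes h: "\<And>\<theta> \<phi>. 0 < \<theta> \<Longrightarrow> \<theta> < pi \<Longrightarrow> h \<theta> \<phi> = stream c M q (sph \<theta> \<phi>)" and t: "0 < \<theta>" "\<theta> < pi"
  shows "sgrad_sph h \<theta> \<phi> = sfield c M q (sph \<theta> \<phi>)"
proof -
  let ?p = "sph \<theta> \<phi>"
  have "((\<lambda>t. stream c M q (sph \<theta> t)) has_real_derivative dstream c M q ?p (dph \<theta> \<phi>)) (at \<phi>)"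
    using vector_derivative_diff_chain_within[OF has_vector_derivative_sph_phi[of \<theta> \<phi>]
        has_derivative_at_withinI[OF stream_has_derivative[of c M q ?p]]]
    by (simp add: o_def has_real_derivative_iff_has_vector_derivative)
  moreover have "h \<theta> = (\<lambda>t. stream c M q (sph \<theta> t))"
    using h t by auto
  ultimately have d1: "deriv (\<lambda>t. h \<theta> t) \<phi> = dstream c M q ?p (dph \<theta> \<phi>)"
    by (simp add: DERIV_imp_deriv)
  have "((\<lambda>t. stream c M q (sph t \<phi>)) has_real_derivative dstream c M q ?p (dth \<theta> \<phi>)) (at \<theta>)"
    using vector_derivative_diff_chain_within[OF has_vector_derivative_sph_theta[of \<phi> \<theta>]
        has_derivative_at_withinI[OF stream_has_derivative[of c M q ?p]]]
    by (simp add: o_def has_real_derivative_iff_has_vector_derivative)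
  then have "((\<lambda>t. h t \<phi>) has_real_derivative dstream c M q ?p (dth \<theta> \<phi>)) (at \<theta>)"
    by (rule has_field_derivative_transform_within_open[of _ _ _ "{0<..<pi}"]) (use h t in auto)
  then have d2: "deriv (\<lambda>t. h t \<phi>) \<theta> = dstream c M q ?p (dth \<theta> \<phi>)"
    by (rule DERIV_imp_deriv)
  define g1 g2 g3 where g: "g1 = H1 c M ?p * poly q (?p$3)" "g2 = H1 (\<i> * c) M ?p * poly q (?p$3)"
    "g3 = H0 c M ?p * poly (pderiv q) (?p$3)"
  have d: "dstream c M q ?p v = g1 * v$1 + g2 * v$2 + g3 * v$3" for v
    by (simp add: dstream_def g)
  have f: "cos \<phi> * cos \<phi> + sin \<phi> * sin \<phi> = 1"
    using sin_cos_squared_add[of \<phi>] by (simp add: power2_eq_square)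
  have s: "sin \<theta> \<noteq> 0"
    using t sin_gt_zero[of \<theta>] by simp
  \<comment> \<open>With G = (g1, g2, g3) the left side is G x (dth x dph), and dth x dph is sin
    theta times the position vector.\<close>
  have "dstream c M q ?p (dph \<theta> \<phi>) *\<^sub>R dth \<theta> \<phi> - dstream c M q ?p (dth \<theta> \<phi>) *\<^sub>R dph \<theta> \<phi>
     = sin \<theta> *\<^sub>R sfield c M q ?p"
    unfolding vec3_eq_iff vector_minus_component vector_scaleR_component sfield_nth d g[symmetric]
    apply (simp add: dth_def dph_def sph_def)
    apply (intro conjI)
    using f apply algebra
    using f apply algebra
    apply (simp add: algebra_simps)
    done
  then show ?thesis
    unfolding sgrad_sph_def d1 d2 using s by simp
qed

lemma H0_sph:
  "H0 (Complex a b) M (sph \<theta> \<phi>) = (a * cos (real M * \<phi>) - b * sin (real M * \<phi>)) * sin \<theta> ^ M"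
proof -
  have "Complex (sph \<theta> \<phi> $ 1) (sph \<theta> \<phi> $ 2) = of_real (sin \<theta>) * cis \<phi>"
    by (simp add: sph_def complex_eq_iff)
  then have "Complex (sph \<theta> \<phi> $ 1) (sph \<theta> \<phi> $ 2) ^ M = of_real (sin \<theta> ^ M) * cis (real M * \<phi>)"
    by (simp add: power_mult_distrib Complex.DeMoivre)
  then show ?thesis
    unfolding H0_def by (simp only:) (simp add: algebra_simps)
qed

text \<open>sigma is the sign of m. The imaginary part of the harmonic is the real part after
  multiplication by -i, with sigma accounting for conjugation.\<close>

lemma e_eq_sfield:
  assumes Y: "\<And>\<theta> \<phi>. 0 < \<theta> \<Longrightarrow> \<theta> < pi \<Longrightarrow>
      Ylm l m \<theta> \<phi> = of_real K * cis (\<sigma> * (real M * \<phi>)) * of_real (sin \<theta> ^ M * poly q (cos \<theta>))"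
    and \<sigma>: "\<sigma> = 1 \<or> \<sigma> = -1"
  defines "C \<equiv> K / sqrt (real l * (real l + 1))"
  shows "fst (e l m) \<simeq> sfield (of_real C) M q"
    "snd (e l m) \<simeq> sfield (- (\<i> * of_real (\<sigma> * C))) M q"
proof -
  have c: "complex_of_real C = Complex C 0" "- (\<i> * of_real (\<sigma> * C)) = Complex 0 (- \<sigma> * C)"
    by (simp_all add: complex_eq_iff)
  have "Re (Ylm l m \<theta> \<phi>) / sqrt (real l * (real l + 1)) = stream (of_real C) M q (sph \<theta> \<phi>)"
    if "0 < \<theta>" "\<theta> < pi" for \<theta> \<phi>
    unfolding Y[OF that] c stream_def H0_sph using \<sigma> by (auto simp: C_def sph_def simp del: of_real_mult)
  then show "fst (e l m) \<simeq> sfield (of_real C) M q"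
    unfolding e_def fst_conv by (intro field_of_sph_eq sgrad_sph_eq sfield_continuous)
  have "Im (Ylm l m \<theta> \<phi>) / sqrt (real l * (real l + 1)) = stream (- (\<i> * of_real (\<sigma> * C))) M q (sph \<theta> \<phi>)"
    if "0 < \<theta>" "\<theta> < pi" for \<theta> \<phi>
    unfolding Y[OF that] c stream_def H0_sph using \<sigma> by (auto simp: C_def sph_def simp del: of_real_mult)
  then show "snd (e l m) \<simeq> sfield (- (\<i> * of_real (\<sigma> * C))) M q"
    unfolding e_def snd_conv by (intro field_of_sph_eq sgrad_sph_eq sfield_continuous)
qed

lemma higher_deriv_poly: "(deriv ^^ n) (poly p) = poly ((pderiv ^^ n) p)" for p :: "real poly"
proof (induction n)
  case (Suc n)
  have "deriv (poly q) = poly (pderiv q)" for q :: "real poly"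
    using poly_DERIV DERIV_imp_deriv by blast
  then show ?case
    using Suc by simp
qed simp

lemma assocP_eq:
  "assocP l m z = (1 - z^2) powr (of_int m / 2) * poly ((pderiv ^^ nat (int l + m)) (rodrigues l)) z"
proof -
  have "(\<lambda>t::real. (t^2 - 1)^l) = poly ([:-1, 0, 1:] ^ l)"
    by (simp add: fun_eq_iff poly_power power2_eq_square)
  then show ?thesis
    by (simp add: assocP_def higher_deriv_poly rodrigues_def higher_pderiv_smult)
qed

lemma sin_powr:
  assumes "0 < \<theta>" "\<theta> < pi"
  shows "(1 - (cos \<theta>)^2) powr (real M / 2) = sin \<theta> ^ M"
    "(1 - (cos \<theta>)^2) powr (- (real M / 2)) = 1 / sin \<theta> ^ M"
proof -
  have s: "sin \<theta> > 0"
    using assms by (rule sin_gt_zero)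
  have "1 - (cos \<theta>)^2 = sin \<theta> powr 2"
    using s by (simp add: sin_squared_eq)
  then show 1: "(1 - (cos \<theta>)^2) powr (real M / 2) = sin \<theta> ^ M"
    using s by (simp only: powr_powr) (simp add: powr_realpow)
  then show "(1 - (cos \<theta>)^2) powr (- (real M / 2)) = 1 / sin \<theta> ^ M"
    by (simp add: powr_minus_divide)
qed

text \<open>(x^2 - 1)^n vanishes to order n at 1; this fixes the constant of integration in
  \<open>leg_reflection\<close>.\<close>

lemma rodrigues_root: "j < n \<Longrightarrow> poly ((pderiv ^^ j) (rodrigues n)) 1 = 0"
proof (induction n arbitrary: j)
  case (Suc n)
  show ?case
  proof (cases j)
    case 0
    then show ?thesis by (simp add: rodrigues_def)
  next
    case (Suc i)
    then have "i < n" "i - 1 < n"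
      using Suc.prems by auto
    moreover have "(pderiv ^^ j) (rodrigues (Suc n)) = (pderiv ^^ i) ([:0, 1:] * rodrigues n)"
      by (simp only: Suc funpow_Suc_right o_apply pderiv_rodrigues_Suc)
    ultimately show ?thesis
      unfolding higher_pderiv_times_x using Suc.IH by simp
  qed
qed simp

text \<open>The functions of order M and -M are proportional. Legendre's equation in self-adjoint
  form makes the derivative of X^(M+1) y' a multiple of X^M y, where X = x^2 - 1; integrate once and
  compare at 1. The factor (l - M) (l + M + 1) gained in each step is nonzero for M < l.\<close>

lemma leg_reflection:
  assumes "M \<le> l"
  shows "\<exists>c\<noteq>0. [:-1, 0, 1:] ^ M * leg M (int l) = smult c ((pderiv ^^ (l - M)) (rodrigues l))"
  using assms
proof (induction M)
  case 0
  then show ?case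
    by (intro exI[of _ 1]) (simp add: leg_def)
next
  case (Suc M)
  let ?X = "[:-1, 0, 1:] :: real poly" and ?y = "leg M (int l)"
  obtain c where c: "c \<noteq> 0" "?X ^ M * ?y = smult c ((pderiv ^^ (l - M)) (rodrigues l))"
    using Suc by auto
  define a where "a = (real l - real M) * (real l + real M + 1)"
  have y': "leg (Suc M) (int l) = pderiv ?y"
    by (simp add: leg_def)
  have Lam: "?X * pderiv (pderiv ?y) + smult (2 * (real M + 1)) ([:0, 1:] * pderiv ?y) = smult a ?y"
  proof (rule poly_ext)
    fix z
    from arg_cong[OF Lam_leg[of M "int l"], of "\<lambda>p. poly p z"]
    show "poly (?X * pderiv (pderiv ?y) + smult (2 * (real M + 1)) ([:0, 1:] * pderiv ?y)) z = poly (smult a ?y) z"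
      by (simp add: poly_Lam a_def ev_def algebra_simps)
  qed
  have "pderiv (?X ^ Suc M * pderiv ?y)
      = ?X ^ M * (?X * pderiv (pderiv ?y) + smult (2 * (real M + 1)) ([:0, 1:] * pderiv ?y))"
    unfolding pderiv_mult pderiv_power_Suc
    by (rule poly_ext) (simp add: pderiv_pCons algebra_simps)
  also have "\<dots> = smult a (?X ^ M * ?y)"
    unfolding Lam by simp
  also have "\<dots> = smult (a * c) ((pderiv ^^ (l - M)) (rodrigues l))"
    unfolding c by simp
  also have "l - M = Suc (l - Suc M)"
    using Suc.prems by simp
  also have "smult (a * c) ((pderiv ^^ Suc (l - Suc M)) (rodrigues l))
      = pderiv (smult (a * c) ((pderiv ^^ (l - Suc M)) (rodrigues l)))"
    by (simp add: pderiv_smult)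
  finally have "pderiv (?X ^ Suc M * pderiv ?y - smult (a * c) ((pderiv ^^ (l - Suc M)) (rodrigues l))) = 0"
    by (simp add: pderiv_diff)
  then have "degree (?X ^ Suc M * pderiv ?y - smult (a * c) ((pderiv ^^ (l - Suc M)) (rodrigues l))) = 0"
    by (simp only: pderiv_eq_0_iff)
  then obtain b where b: "?X ^ Suc M * pderiv ?y - smult (a * c) ((pderiv ^^ (l - Suc M)) (rodrigues l)) = [:b:]"
    using degree_eq_zeroE by blast
  have "poly ((pderiv ^^ (l - Suc M)) (rodrigues l)) 1 = 0"
    using Suc.prems by (intro rodrigues_root) simp
  with arg_cong[OF b, of "\<lambda>p. poly p 1"] have "b = 0"
    by simp
  with b have "?X ^ Suc M * leg (Suc M) (int l) = smult (a * c) ((pderiv ^^ (l - Suc M)) (rodrigues l))"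
    by (simp add: y')
  moreover have "a * c \<noteq> 0"
    using Suc.prems c by (simp add: a_def)
  ultimately show ?case
    by blast
qed

lemma e_nonneg:
  fixes M l :: nat
  defines "C \<equiv> sqrt (fact (l - M) / fact (l + M) * (2 * real l + 1) / (4 * pi)) / sqrt (real l * (real l + 1))"
  assumes "M \<le> l"
  shows "fst (e l (int M)) \<simeq> sfield (of_real C) M (leg M (int l))"
    "snd (e l (int M)) \<simeq> sfield (- (\<i> * of_real C)) M (leg M (int l))"
proof -
  have "nat (int l - int M) = l - M" "nat (int l + int M) = l + M"
    using assms(2) by auto
  then have "Ylm l (int M) \<theta> \<phi> = of_real (sqrt (fact (l - M) / fact (l + M) * (2 * real l + 1) / (4 * pi)))
      * cis (1 * (real M * \<phi>)) * of_real (sin \<theta> ^ M * poly (leg M (int l)) (cos \<theta>))"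
    if "0 < \<theta>" "\<theta> < pi" for \<theta> \<phi>
    by (simp add: Ylm_def assocP_eq sin_powr[OF that] leg_def)
  from e_eq_sfield[OF this] show "fst (e l (int M)) \<simeq> sfield (of_real C) M (leg M (int l))"
    "snd (e l (int M)) \<simeq> sfield (- (\<i> * of_real C)) M (leg M (int l))"
    by (simp_all add: C_def)
qed

lemma e_sfield:
  assumes "1 \<le> l" "- int l \<le> m" "m \<le> int l"
  obtains C d where "C \<noteq> 0" "fst (e l m) \<simeq> sfield (of_real C) (nat \<bar>m\<bar>) (leg (nat \<bar>m\<bar>) (int l))"
    "snd (e l m) \<simeq> sfield d (nat \<bar>m\<bar>) (leg (nat \<bar>m\<bar>) (int l))"
proof (cases "m \<ge> 0")
  case True
  define M where "M = nat \<bar>m\<bar>"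
  have m: "m = int M" and M: "M \<le> l"
    using True assms by (auto simp: M_def)
  have "sqrt (fact (l - M) / fact (l + M) * (2 * real l + 1) / (4 * pi)) / sqrt (real l * (real l + 1)) \<noteq> 0"
    using assms(1) by (simp add: add_nonneg_eq_0_iff)
  from that[OF this, folded M_def] show ?thesis
    using e_nonneg[OF M] unfolding m by blast
next
  case False
  define M where "M = nat \<bar>m\<bar>"
  have m: "m = - int M" and M: "M \<le> l"
    using False assms by (auto simp: M_def)
  obtain c where c: "c \<noteq> 0" "[:-1, 0, 1:] ^ M * leg M (int l) = smult c ((pderiv ^^ (l - M)) (rodrigues l))"
    using leg_reflection[OF M] by blast
  let ?N = "sqrt (fact (l + M) / fact (l - M) * (2 * real l + 1) / (4 * pi))"
  have n: "nat (int l - m) = l + M" "nat (int l + m) = l - M"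
    using M by (auto simp: m)
  have "Ylm l m \<theta> \<phi> = of_real (?N * ((-1) ^ M / c)) * cis ((-1) * (real M * \<phi>)) * of_real (sin \<theta> ^ M * poly (leg M (int l)) (cos \<theta>))"
    if "0 < \<theta>" "\<theta> < pi" for \<theta> \<phi>
  proof -
    have s: "sin \<theta> \<noteq> 0"
      using sin_gt_zero[OF that] by simp
    have "((cos \<theta>)^2 - 1) ^ M * poly (leg M (int l)) (cos \<theta>) = c * poly ((pderiv ^^ (l - M)) (rodrigues l)) (cos \<theta>)"
      using arg_cong[OF c(2), of "\<lambda>p. poly p (cos \<theta>)"] by (simp add: poly_power power2_eq_square)
    \<comment> \<open>Order -M brings sin^(-M) and the reflection sin^(2 M), which leaves the same
      sin^M as for order M.\<close>
    moreover have "((cos \<theta>)^2 - 1) ^ M = (-1) ^ M * (sin \<theta> ^ M * sin \<theta> ^ M)"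
    proof -
      have "(cos \<theta>)^2 - 1 = (-1) * (sin \<theta> * sin \<theta>)"
        using sin_cos_squared_add[of \<theta>] by (simp add: power2_eq_square)
      then show ?thesis
        by (simp only: power_mult_distrib)
    qed
    ultimately have "poly ((pderiv ^^ (l - M)) (rodrigues l)) (cos \<theta>)
        = (-1) ^ M / c * (sin \<theta> ^ M * sin \<theta> ^ M) * poly (leg M (int l)) (cos \<theta>)"
      using c(1) by (simp add: field_simps)
    then have "assocP l m (cos \<theta>) = (-1) ^ M / c * (sin \<theta> ^ M * poly (leg M (int l)) (cos \<theta>))"
      using s sin_powr(2)[OF that, of M] by (simp add: assocP_eq n, simp add: m)
    then show ?thesis
      unfolding Ylm_def n by (simp add: m)
  qed
  note E = e_eq_sfield[OF this]
  have "?N \<noteq> 0"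
    by (simp add: add_nonneg_eq_0_iff) 
  then have "?N * ((-1) ^ M / c) / sqrt (real l * (real l + 1)) \<noteq> 0"
    using c(1) assms(1) by simp
  then show ?thesis
    using that E unfolding M_def[symmetric] by blast
qed

section \<open>The curvature\<close>

definition eq_C :: "cvf \<Rightarrow> cvf \<Rightarrow> bool" where
  "eq_C u v \<longleftrightarrow> fst u \<simeq> fst v \<and> snd u \<simeq> snd v"

lemma eq_C_herm: "eq_C u u' \<Longrightarrow> eq_C v v' \<Longrightarrow> herm u v = herm u' v'"
  using eq_S2_ip[of "fst u" "fst u'" "fst v" "fst v'"] eq_S2_ip[of "fst u" "fst u'" "snd v" "snd v'"]
    eq_S2_ip[of "snd u" "snd u'" "fst v" "fst v'"] eq_S2_ip[of "snd u" "snd u'" "snd v" "snd v'"]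
  by (simp add: herm_def eq_C_def)

text \<open>u is real, so the bilinear operators act separately on the two parts of x; the terms
  with \<open>snd u\<close> are removed by \<open>rnabla_zero\<close>.\<close>

lemma cnabla_zonal:
  assumes adm: "admissible g M 0"
    and u: "fst u \<simeq> U" "snd u \<simeq> (\<lambda>p. 0)"
    and x: "fst x \<simeq> sfield c M q" "snd x \<simeq> sfield d M q"
  shows "rnabla g U (sfield c M q) \<simeq> A \<Longrightarrow> rnabla g U (sfield d M q) \<simeq> B \<Longrightarrow> eq_C (cnabla g u x) (A, B)"
    "rnabla g (sfield c M q) U \<simeq> A \<Longrightarrow> rnabla g (sfield d M q) U \<simeq> B \<Longrightarrow> eq_C (cnabla g x u) (A, B)"
    "br U (sfield c M q) \<simeq> A \<Longrightarrow> br U (sfield d M q) \<simeq> B \<Longrightarrow> eq_C (cbr u x) (A, B)"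
proof -
  note z = rnabla_zero[OF adm x(1) u(2)] rnabla_zero[OF adm x(2) u(2)]
  show "eq_C (cnabla g u x) (A, B)" if "rnabla g U (sfield c M q) \<simeq> A" "rnabla g U (sfield d M q) \<simeq> B"
    using z that eq_S2_rnabla[OF u(1) x(1), of g] eq_S2_rnabla[OF u(1) x(2), of g]
    by (simp add: cnabla_eq_cbil cbil_def eq_C_def eq_S2_def fsub_def fadd_def)
  show "eq_C (cnabla g x u) (A, B)" if "rnabla g (sfield c M q) U \<simeq> A" "rnabla g (sfield d M q) U \<simeq> B"
    using z that eq_S2_rnabla[OF x(1) u(1), of g] eq_S2_rnabla[OF x(2) u(1), of g]
    by (simp add: cnabla_eq_cbil cbil_def eq_C_def eq_S2_def fsub_def fadd_def)
  show "eq_C (cbr u x) (A, B)" if "br U (sfield c M q) \<simeq> A" "br U (sfield d M q) \<simeq> B"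
    using z that eq_S2_br[OF u(1) x(1)] eq_S2_br[OF u(1) x(2)]
    by (simp add: cbr_def cbil_def eq_C_def eq_S2_def fsub_def fadd_def)
qed

text \<open>The bracket and each connection step multiply c by i. Thus i * i = -1 makes the term -
  nabla_u nabla_v u positive and the term nabla_[u,v] u negative in T, while nabla_v nabla_u u
  vanishes because u is steady.\<close>

lemma cR_zonal:
  assumes f: "Lam 0 f = smult \<mu> f" "pderiv f = smult \<kappa> profile" and l: "l \<ge> 3"
    and adm: "\<And>i. even (i - l) \<Longrightarrow> admissible g M (leg M i)"
    and u: "fst u \<simeq> sfield 1 0 f" "snd u \<simeq> (\<lambda>p. 0)"
    and v: "fst v \<simeq> sfield c M (leg M l)" "snd v \<simeq> sfield d M (leg M l)"
  defines "T \<equiv> smult ((real M * \<kappa>)\<^sup>2 / 4) (lift M (\<lambda>k. -1 + (ev l - \<mu>) / ev k) l (\<lambda>k. lift M (\<lambda>i. 1 + (ev k - \<mu>) / ev i) k (leg M)))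
     - smult ((real M * \<kappa>)\<^sup>2 / 2) (lift M (\<lambda>k. 1) l (\<lambda>k. lift M (\<lambda>i. -1 + (ev k - \<mu>) / ev i) k (leg M)))"
  shows "eq_C (cR g u v u) (sfield c M T, sfield d M T)"
proof -
  have a0: "admissible g M' 0" for M'
    using admissible_0[OF adm[of l]] by simp
  have l1: "l \<ge> 1"
    using l by simp
  let ?q1 = "smult (real M / 2 * \<kappa>) (lift M (\<lambda>i. -1 + (ev l - \<mu>) / ev i) l (leg M))"
  let ?q2 = "smult (real M * \<kappa>) (lift M (\<lambda>i. 1) l (leg M))"
  let ?T1 = "smult (real M / 2 * (real M / 2 * \<kappa> * \<kappa>)) (lift M (\<lambda>i. -1 + (ev l - \<mu>) / ev i) l
      (\<lambda>k. lift M (\<lambda>i. 1 + (ev k - \<mu>) / ev i) k (leg M)))"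
  let ?T2 = "smult (real M / 2 * (real M * \<kappa> * \<kappa>)) (lift M (\<lambda>i. 1) l
      (\<lambda>k. lift M (\<lambda>i. -1 + (ev k - \<mu>) / ev i) k (leg M)))"
  have 1: "eq_C (cnabla g v u) (sfield (\<i> * c) M ?q1, sfield (\<i> * d) M ?q1)"
    by (rule cnabla_zonal(2)[OF a0 u v]) (rule rnabla_leg[OF f l1 adm], assumption)+
  have 2: "eq_C (cnabla g u (cnabla g v u)) (sfield (\<i> * (\<i> * c)) M ?T1, sfield (\<i> * (\<i> * d)) M ?T1)"
    by (rule cnabla_zonal(1)[OF a0 u 1[unfolded eq_C_def fst_conv snd_conv, THEN conjunct1]
          1[unfolded eq_C_def fst_conv snd_conv, THEN conjunct2]])
       (rule rnabla_lift(1)[OF f l adm], assumption)+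
  have z: "snd u \<simeq> sfield 1 0 0"
    using u(2) by (simp add: sfield_zero_eq)
  have 3: "eq_C (cnabla g u u) ((\<lambda>p. 0), (\<lambda>p. 0))"
  proof -
    note s = eq_S2_trans[OF eq_S2_rnabla[OF u(1) u(1)] rnabla_zonal_self[OF f(1) a0[of 0]]]
    note z = rnabla_zero[OF a0[of 0] u(1) u(2)] rnabla_zero[OF a0[of 0] z u(2)]
    show ?thesis
      using s z by (simp add: cnabla_eq_cbil cbil_def eq_C_def eq_S2_def fsub_def fadd_def)
  qed
  have 4: "eq_C (cnabla g v (cnabla g u u)) ((\<lambda>p. 0), (\<lambda>p. 0))"
  proof -
    have w: "fst (cnabla g u u) \<simeq> (\<lambda>p. 0)" "snd (cnabla g u u) \<simeq> (\<lambda>p. 0)"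
      using 3 by (simp_all add: eq_C_def)
    note z = rnabla_zero(2)[OF a0 v(1) w(1)] rnabla_zero(2)[OF a0 v(2) w(1)]
      rnabla_zero(2)[OF a0 v(1) w(2)] rnabla_zero(2)[OF a0 v(2) w(2)]
    show ?thesis
      unfolding cnabla_eq_cbil[of g v]
      using z by (simp add: cbil_def eq_C_def eq_S2_def fsub_def fadd_def)
  qed
  have q2: "smult (real M) (pderiv f * leg M l) = ?q2"
    using profile_leg[OF l1, of M] by (simp only: f(2) mult_smult_left smult_smult)
  have 5: "eq_C (cbr u v) (sfield (\<i> * c) M ?q2, sfield (\<i> * d) M ?q2)"
    by (rule cnabla_zonal(3)[OF a0 u v]) (rule br_zonal[of f _ M "leg M l", unfolded q2])+
  have 6: "eq_C (cnabla g (cbr u v) u) (sfield (\<i> * (\<i> * c)) M ?T2, sfield (\<i> * (\<i> * d)) M ?T2)"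
    by (rule cnabla_zonal(2)[OF a0 u 5[unfolded eq_C_def fst_conv snd_conv, THEN conjunct1]
          5[unfolded eq_C_def fst_conv snd_conv, THEN conjunct2]])
       (rule rnabla_lift(2)[OF f l adm], assumption)+
  have T: "T = ?T1 - ?T2"
    unfolding T_def by (simp add: power2_eq_square mult_ac)
  show ?thesis
    unfolding cR_def T using 2 4 6
    by (simp add: eq_C_def eq_S2_def cadd_def cneg_def fadd_def fscale_def sfield_diff sfield_c_uminus)
qed

section \<open>The component of the curvature operator along degree l\<close>

lemma ip_sfield_add:
  "ip (sfield c M (q + r)) (sfield d N s) = ip (sfield c M q) (sfield d N s) + ip (sfield c M r) (sfield d N s)"
proof -
  have "sfield c M (q + r) = (\<lambda>p. sfield c M q p + sfield c M r p)"
    by (simp add: fun_eq_iff sfield_add)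
  then show ?thesis
    using ip_add_left[OF sfield_continuous sfield_continuous sfield_continuous] by metis
qed

lemma ip_sfield_smult: "ip (sfield c M (smult a q)) Y = a * ip (sfield c M q) Y"
  by (simp add: sfield_smult_eq ip_scale_left)

lemma ip_sfield_diff:
  "ip (sfield c M (q - r)) (sfield d N s) = ip (sfield c M q) (sfield d N s) - ip (sfield c M r) (sfield d N s)"
  using ip_sfield_add[of c M q "smult (-1) r" d N s] ip_sfield_smult[of c M "-1" r] by simp

lemma ip_lift:
  "ip (sfield c M (lift M w k V)) (sfield d M s) = al M k * w (k + 2) * ip (sfield c M (V (k + 2))) (sfield d M s)
    + be M k * w k * ip (sfield c M (V k)) (sfield d M s) + de M k * w (k - 2) * ip (sfield c M (V (k - 2))) (sfield d M s)"
  by (simp add: lift_def ip_sfield_add ip_sfield_smult)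

text \<open>Of the paths of two steps from l, only those through l + 2, l and l - 2 that return to l
  contribute; all other end points are at least l - 4 and orthogonal to degree l.\<close>

lemma ip_lift_lift:
  assumes "M \<noteq> 0" "l \<ge> 3"
  shows "ip (sfield c M (lift M w l (\<lambda>k. lift M (x k) k (leg M)))) (sfield d M (leg M l))
   = (al M l * de M (l + 2) * w (l + 2) * x (l + 2) l + be M l * be M l * w l * x l l
      + de M l * al M (l - 2) * w (l - 2) * x (l - 2) l) * ip (sfield c M (leg M l)) (sfield d M (leg M l))"
proof -
  have 0: "ip (sfield c M (leg M k)) (sfield d M (leg M l)) = 0" if "k \<ge> -1" "k \<noteq> l" for k
    using ip_leg_orthogonal[OF assms(1) that(1) _ that(2)] assms(2) by simp
  show ?thesis
    using assms(2)
    by (simp add: ip_lift 0 algebra_simps)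
qed

text \<open>A, B and D are the squares of the matrix elements of z^2 - 1/5 from degree l to l + 2, l
  - 2 and l in an orthonormal basis; 25 is the square of the factor 5 in the profile.\<close>

lemma coefficient_products:
  assumes "l \<ge> 3"
  shows "al M (int l) * de M (int l + 2) = 25 * cA l (int M)"
    "be M (int l) * be M (int l) = 25 * cD l (int M)"
    "de M (int l) * al M (int l - 2) = 25 * cBc l (int M)"
proof -
  have l: "real l \<ge> 3"
    using assms by simp
  have n: "2 * real l + 1 \<noteq> 0" "2 * real l + 3 \<noteq> 0" "2 * real l + 5 \<noteq> 0" "2 * real l - 1 \<noteq> 0" "2 * real l - 3 \<noteq> 0"
    using l by auto
  have e: "2 * (real l + 1) + 1 = 2 * real l + 3" "2 * (real l + 2) + 1 = 2 * real l + 5"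
    "2 * (real l - 1) + 1 = 2 * real l - 1" "2 * (real l - 2) + 1 = 2 * real l - 3"
    by auto
  show "al M (int l) * de M (int l + 2) = 25 * cA l (int M)"
    by (simp add: al_def de_def up_def down_def cA_def e add.commute[of 1] power2_eq_square) (use n in \<open>simp add: divide_simps, algebra\<close>)
  show "de M (int l) * al M (int l - 2) = 25 * cBc l (int M)"
    by (simp add: al_def de_def up_def down_def cBc_def e power2_eq_square) (use n in \<open>simp add: divide_simps, algebra\<close>)
  define Z where "Z = ((real l)^2 - (real M)^2) / ((2 * real l + 1) * (2 * real l - 1))
            + ((real l + 1)^2 - (real M)^2) / ((2 * real l + 3) * (2 * real l + 1)) - 1/5"
  have "be M (int l) = 5 * Z"
    by (simp add: Z_def be_def up_def down_def e power2_eq_square) (use n in \<open>simp add: divide_simps, algebra\<close>)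
  moreover have "cD l (int M) = Z\<^sup>2"
    by (simp add: cD_def Z_def)
  ultimately show "be M (int l) * be M (int l) = 25 * cD l (int M)"
    by (simp add: power2_eq_square)
qed

text \<open>The weight of the path l to k to l, with x = ev k and y = ev l. For k = l + 2 and l - 2
  the ratio y / x is \<open>r1 l\<close> and \<open>r2 l\<close>.\<close>

lemma curvature_term:
  fixes x y :: real
  assumes "x \<noteq> 0" "y \<noteq> 0"
  shows "(-1 + (y - 12) / x) * (1 + (x - 12) / y) - 2 * (-1 + (x - 12) / y)
    = - (3 * (x / y) - 2 * (12 / y + 1) - (12 / y - 1)\<^sup>2 * (y / x))"
  using assms by (simp add: divide_simps power2_eq_square) (simp add: algebra_simps)

text \<open>\<open>w\<close> and \<open>a\<close> weigh the two connection steps of nabla_u nabla_v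
  u; \<open>b\<close> weighs the connection step of nabla_[u,v] u, whose first step, the bracket,
  has weight 1.\<close>

lemma curvature_coefficient:
  assumes "l \<ge> 3" and k: "\<kappa>\<^sup>2 = 21 / (64 * pi)" and M: "real M ^ 2 = (of_int m)\<^sup>2"
  defines "w \<equiv> \<lambda>k. -1 + (ev (int l) - 12) / ev k"
    and "a \<equiv> \<lambda>k. 1 + (ev k - 12) / ev (int l)" and "b \<equiv> \<lambda>k. -1 + (ev k - 12) / ev (int l)"
  shows "(real M * \<kappa>)\<^sup>2 / 4 * (al M (int l) * de M (int l + 2) * w (int l + 2) * a (int l + 2)
       + be M (int l) * be M (int l) * w (int l) * a (int l) + de M (int l) * al M (int l - 2) * w (int l - 2) * a (int l - 2))
     - (real M * \<kappa>)\<^sup>2 / 2 * (al M (int l) * de M (int l + 2) * b (int l + 2)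
       + be M (int l) * be M (int l) * b (int l) + de M (int l) * al M (int l - 2) * b (int l - 2))
     = curv_formula l m"
proof -
  let ?y = "ev (int l)"
  have l: "real l \<ge> 3"
    using assms(1) by simp
  have y: "?y = real l * (real l + 1)" "ev (int l + 2) = (real l + 2) * (real l + 3)" "ev (int l - 2) = (real l - 2) * (real l - 1)"
    by (simp_all add: ev_def add.assoc)
  have n: "?y \<noteq> 0" "ev (int l + 2) \<noteq> 0" "ev (int l - 2) \<noteq> 0"
    using l by (auto simp: y)
  define h where "h x = - (3 * (x / ?y) - 2 * (12 / ?y + 1) - (12 / ?y - 1)\<^sup>2 * (?y / x))" for x
  have t: "w k * a k - 2 * b k = h (ev k)" if "ev k \<noteq> 0" for k
    unfolding w_def a_def b_def h_def by (rule curvature_term[OF that n(1)])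
  have c: "cA l (int M) = cA l m" "cBc l (int M) = cBc l m" "cD l (int M) = cD l m"
    using M by (simp_all add: cA_def cBc_def cD_def)
  note cp = coefficient_products[OF assms(1), of M, unfolded c]
  have "(real M * \<kappa>)\<^sup>2 / 4 * (25 * cA l m * w (int l + 2) * a (int l + 2)
       + 25 * cD l m * w (int l) * a (int l) + 25 * cBc l m * w (int l - 2) * a (int l - 2))
     - (real M * \<kappa>)\<^sup>2 / 2 * (25 * cA l m * b (int l + 2)
       + 25 * cD l m * b (int l) + 25 * cBc l m * b (int l - 2))
    = (real M * \<kappa>)\<^sup>2 / 4 * 25 * (cA l m * (w (int l + 2) * a (int l + 2) - 2 * b (int l + 2))
       + cD l m * (w (int l) * a (int l) - 2 * b (int l)) + cBc l m * (w (int l - 2) * a (int l - 2) - 2 * b (int l - 2)))"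
    by (simp add: algebra_simps)
  also have "\<dots> = (real M * \<kappa>)\<^sup>2 / 4 * 25 * (cA l m * h (ev (int l + 2)) + cD l m * h ?y + cBc l m * h (ev (int l - 2)))"
    by (simp only: t[OF n(1)] t[OF n(2)] t[OF n(3)])
  \<comment> \<open>525 = 25 * 21, where 21 / (64 pi) is kappa^2. The last division by 8 matches the
    factors 1/8 in \<open>vartheta\<close>, \<open>varrho\<close> and
    \<open>gamma_lm\<close>.\<close>
  also have "(real M * \<kappa>)\<^sup>2 / 4 * 25 = 525 * (of_int m)\<^sup>2 / (32 * pi) / 8"
    by (simp add: power_mult_distrib k M field_simps)
  also have "\<dots> * (cA l m * h (ev (int l + 2)) + cD l m * h ?y + cBc l m * h (ev (int l - 2))) = curv_formula l m"
  proof -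
    have r: "X / r1 l = X * (ev (int l + 2) / ?y)" "X * r1 l = X * (?y / ev (int l + 2))"
      "X / r2 l = X * (ev (int l - 2) / ?y)" "X * r2 l = X * (?y / ev (int l - 2))" for X
      by (simp_all add: r1_def r2_def y)
    have alg: "A * - (3 * t1 - 2 * (i + 1) - j * s1) + D * - (3 * 1 - 2 * (i + 1) - j * 1) + B * - (3 * t2 - 2 * (i + 1) - j * s2)
       = - 8 * (3 * ((A * t1 + B * t2 + D) / 8) - 2 * (i + 1) * ((A + B + D) / 8) - j * ((A * s1 + B * s2 + D) / 8))"
      for A B D t1 t2 s1 s2 i j :: real
      by (simp add: field_simps)
    have "cA l m * h (ev (int l + 2)) + cD l m * h ?y + cBc l m * h (ev (int l - 2))
      = - 8 * (3 * gamma_lm l m - 2 * (12 / ?y + 1) * varrho l m - (12 / ?y - 1)\<^sup>2 * vartheta l m)"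
      unfolding gamma_lm_def varrho_def vartheta_def r h_def divide_self[OF n(1)] by (rule alg)
    moreover have "a / 8 * (- 8 * Q) = - a * Q" for a Q :: real
      by simp
    ultimately show ?thesis
      by (simp only: curv_formula_def y(1)[symmetric])
  qed
  finally show ?thesis
    unfolding cp .
qed

section \<open>The zonal field of degree three and the norms\<close>

lemma pderiv_leg_3: "pderiv (leg 0 3) = smult (3/2) profile"
proof -
  have "[:-1, 0, 1:] ^ 3 = [:-1, 0, 3, 0, -3, 0, 1 :: real:]"
    by (simp add: power3_eq_cube)
  then show ?thesis
    by (simp add: leg_def rodrigues_def numeral_3_eq_3 fact_numeral pderiv_pCons pderiv_smult)
qed

text \<open>kappa^2 is the square of (1/8) sqrt (21 / pi), the constant in the explicit form of the
  zonal field.\<close>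

lemma e_3_0:
  obtains f \<kappa> where "Lam 0 f = smult 12 f" "pderiv f = smult \<kappa> profile" "\<kappa>\<^sup>2 = 21 / (64 * pi)"
    "fst (e 3 0) \<simeq> sfield 1 0 f" "snd (e 3 0) \<simeq> (\<lambda>p. 0)"
proof -
  define C where "C = sqrt (fact (3 - 0) / fact (3 + 0) * (2 * real 3 + 1) / (4 * pi)) / sqrt (real 3 * (real 3 + 1))"
  let ?f = "smult C (leg 0 3)"
  have "fst (e 3 0) \<simeq> sfield (of_real C) 0 (leg 0 3)" "snd (e 3 0) \<simeq> sfield (- (\<i> * of_real C)) 0 (leg 0 3)"
    using e_nonneg[of 0 3] unfolding C_def by simp_all
  moreover have "sfield (of_real C) 0 (leg 0 3) = sfield 1 0 ?f" "sfield (- (\<i> * of_real C)) 0 (leg 0 3) = (\<lambda>p. 0)"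
    by (simp_all add: fun_eq_iff vec3_eq_iff sfield_nth H0_def H1_def pderiv_smult)
  ultimately have e: "fst (e 3 0) \<simeq> sfield 1 0 ?f" "snd (e 3 0) \<simeq> (\<lambda>p. 0)"
    by simp_all
  have 1: "Lam 0 ?f = smult 12 ?f"
    by (simp add: Lam_smult Lam_leg ev_def mult.commute)
  have 2: "pderiv ?f = smult (C * 3 / 2) profile"
    by (simp add: pderiv_smult pderiv_leg_3)
  have "C\<^sup>2 = 7 / (48 * pi)"
    by (simp add: C_def power_divide)
  then have 3: "(C * 3 / 2)\<^sup>2 = 21 / (64 * pi)"
    by (simp add: power_mult_distrib power_divide)
  show ?thesis
    by (rule that[OF 1 2 3 e])
qed

lemma ip_zonal_self:
  assumes f: "pderiv f = smult \<kappa> profile" and k: "\<kappa>\<^sup>2 = 21 / (64 * pi)"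
  shows "ip (sfield 1 0 f) (sfield 1 0 f) = 1"
proof -
  let ?I = "\<lambda>\<theta>. \<kappa>\<^sup>2 * (5 * cos \<theta> ^ 2 - 1)\<^sup>2 * sin \<theta> ^ 3"
  have U: "sfield 1 0 f p $ 1 = - (\<kappa> * (5 * p$3 ^ 2 - 1)) * p$2" "sfield 1 0 f p $ 2 = \<kappa> * (5 * p$3 ^ 2 - 1) * p$1"
    "sfield 1 0 f p $ 3 = 0" for p
    by (simp_all add: sfield_nth H1_def H0_def f power2_eq_square algebra_simps)
  have I: "(sfield 1 0 f (sph \<theta> \<phi>) \<bullet> sfield 1 0 f (sph \<theta> \<phi>)) * sin \<theta> = ?I \<theta>" for \<theta> \<phi>
  proof -
    have "(sfield 1 0 f (sph \<theta> \<phi>) \<bullet> sfield 1 0 f (sph \<theta> \<phi>)) * sin \<theta> = ?I \<theta> * ((sin \<phi>)\<^sup>2 + (cos \<phi>)\<^sup>2)"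
      unfolding inner_vec3 U sph_def vector_3 by algebra
    then show ?thesis by simp
  qed
  \<comment> \<open>An antiderivative of (5 z^2 - 1)^2 (1 - z^2), for the substitution z = cos
    theta; Q(1) - Q(-1) = 32/21.\<close>
  define Q :: "real \<Rightarrow> real" where "Q z = - 25 / 7 * z ^ 7 + 7 * z ^ 5 - 11 / 3 * z ^ 3 + z" for z
  have "((\<lambda>t. - \<kappa>\<^sup>2 * Q (cos t)) has_vector_derivative ?I t) (at t within {0..pi})" for t
  proof -
    have "((\<lambda>t. - \<kappa>\<^sup>2 * Q (cos t)) has_real_derivative
        - \<kappa>\<^sup>2 * ((- 25 * cos t ^ 6 + 35 * cos t ^ 4 - 11 * cos t ^ 2 + 1) * - sin t)) (at t within {0..pi})"
      unfolding Q_def by (auto intro!: derivative_eq_intros simp: algebra_simps)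
    moreover have "- 25 * cos t ^ 6 + 35 * cos t ^ 4 - 11 * cos t ^ 2 + 1 = (5 * cos t ^ 2 - 1)\<^sup>2 * sin t ^ 2"
      unfolding sin_squared_eq by algebra
    ultimately show ?thesis
      by (simp add: has_real_derivative_iff_has_vector_derivative power2_eq_square power3_eq_cube mult_ac)
  qed
  then have "(?I has_integral (- \<kappa>\<^sup>2 * Q (cos pi) - - \<kappa>\<^sup>2 * Q (cos 0))) {0..pi}"
    by (intro fundamental_theorem_of_calculus) auto
  then have i: "integral {0..pi} ?I = \<kappa>\<^sup>2 * (32 / 21)"
    by (auto simp: Q_def dest!: integral_unique)
  have "ip (sfield 1 0 f) (sfield 1 0 f) = integral (cbox (0,0) (pi, 2*pi)) (\<lambda>(\<theta>,\<phi>). ?I \<theta>)"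
    unfolding ip_def I ..
  also have "\<dots> = integral (cbox 0 pi) (\<lambda>\<theta>. integral (cbox 0 (2*pi)) (\<lambda>\<phi>. ?I \<theta>))"
    by (subst integral_prod_continuous) (auto intro!: continuous_intros simp: case_prod_unfold)
  also have "\<dots> = integral {0..pi} (\<lambda>\<theta>. 2 * pi * ?I \<theta>)"
    unfolding cbox_interval by (rule integral_cong) simp
  also have "\<dots> = 2 * pi * (\<kappa>\<^sup>2 * (32 / 21))"
    unfolding integral_mult_right i ..
  also have "\<dots> = 1"
    by (simp add: k)
  finally show ?thesis .
qed

lemma higher_pderiv_eq_0:
  fixes p :: "real poly"
  shows "(pderiv ^^ n) p = 0 \<Longrightarrow> p = 0 \<or> degree p < n"
proof (induction n arbitrary: p)
  case (Suc n)
  then have "pderiv p = 0 \<or> degree (pderiv p) < n"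
    by (simp add: funpow_swap1)
  then show ?case
    by (auto simp: pderiv_eq_0_iff degree_pderiv)
qed simp

text \<open>\<open>rodrigues l\<close> has degree 2 l, and l + M derivatives with M at most l cannot
  annihilate it.\<close>

lemma leg_nonzero:
  assumes "M \<le> l"
  shows "leg M (int l) \<noteq> 0"
proof
  assume "leg M (int l) = 0"
  then have "(pderiv ^^ (l + M)) (rodrigues l) = 0"
    by (simp add: leg_def)
  then have "rodrigues l = 0 \<or> degree (rodrigues l) < l + M"
    by (rule higher_pderiv_eq_0)
  moreover have "degree (rodrigues l) = 2 * l" "rodrigues l \<noteq> 0"
    by (simp_all add: rodrigues_def degree_power_eq)
  ultimately show False
    using assms by simp
qed

text \<open>A field of norm zero has vanishing z component, which is a nonzero azimuthal factor
  times the polynomial on a suitable meridian; the polynomial would then have infinitely many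
  zeros.\<close>

lemma ip_leg_pos:
  assumes "M \<noteq> 0" "M \<le> l" "C \<noteq> (0::real)"
  shows "ip (sfield (of_real C) M (leg M (int l))) (sfield (of_real C) M (leg M (int l))) > 0"
proof (rule ccontr)
  let ?X = "sfield (of_real C) M (leg M (int l))"
  assume "\<not> ip ?X ?X > 0"
  then have "ip ?X ?X = 0"
    using ip_self_nonneg[OF sfield_continuous, of "of_real C" M "leg M (int l)"] by simp
  then have z: "?X \<simeq> (\<lambda>p. 0)"
    by (rule ip_self_eq_0[OF sfield_continuous])
  have "poly (leg M (int l)) x = 0" if "x \<in> {-1<..<1}" for x
  proof -
    \<comment> \<open>At this angle sin (M phi) = 1, so the azimuthal factor attached to i C does
      not vanish.\<close>
    let ?p = "sph (arccos x) (pi / (2 * real M))"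
    have "?X ?p $ 3 = 0"
      using z sph_in_S2 by (simp add: eq_S2_def)
    then have "real M * H0 (\<i> * of_real C) M ?p * poly (leg M (int l)) (?p $ 3) = 0"
      using H_Euler(2)[of ?p "of_real C" M] unfolding sfield_nth by algebra
    moreover have "\<i> * of_real C = Complex 0 C"
      by (simp add: complex_eq_iff)
    moreover have "sin (arccos x) \<noteq> 0"
      using that sin_arccos_nonzero[of x] by auto
    ultimately show ?thesis
      using assms that by (simp add: H0_sph) (simp add: sph_def)
  qed
  then have "{-1<..<1::real} \<subseteq> {x. poly (leg M (int l)) x = 0}"
    by auto
  moreover have "infinite {-1<..<1::real}"
    by simp
  ultimately have "leg M (int l) = 0"
    using poly_roots_finite finite_subset by blast
  then show False
    using leg_nonzero[OF assms(2)] by simp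
qed

lemma sec_curv_e:
  assumes l: "l \<ge> 3" and m: "- int l \<le> m" "m \<le> int l"
    and g: "g = sdiff_S2 \<or> g = sdiff_RP2 \<and> odd l"
  shows "sec_curv g (e 3 0) (e l m) = complex_of_real (curv_formula l m)"
proof -
  define M where "M = nat \<bar>m\<bar>"
  have M: "M \<le> l" "real M ^ 2 = (of_int m)\<^sup>2" "M = 0 \<longleftrightarrow> m = 0"
    using m by (auto simp: M_def)
  obtain f \<kappa> where f: "Lam 0 f = smult 12 f" "pderiv f = smult \<kappa> profile" and k: "\<kappa>\<^sup>2 = 21 / (64 * pi)"
    and u: "fst (e 3 0) \<simeq> sfield 1 0 f" "snd (e 3 0) \<simeq> (\<lambda>p. 0)"
    by (rule e_3_0)
  obtain C d where C: "C \<noteq> 0" and v: "fst (e l m) \<simeq> sfield (of_real C) M (leg M (int l))"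
    "snd (e l m) \<simeq> sfield d M (leg M (int l))"
    using e_sfield[of l m] l m unfolding M_def by auto
  have adm: "admissible g M (leg M i)" if "even (i - int l)" for i
    using g that by (intro leg_admissible) auto
  define T where "T = smult ((real M * \<kappa>)\<^sup>2 / 4) (lift M (\<lambda>k. -1 + (ev (int l) - 12) / ev k) (int l)
      (\<lambda>k. lift M (\<lambda>i. 1 + (ev k - 12) / ev i) k (leg M)))
     - smult ((real M * \<kappa>)\<^sup>2 / 2) (lift M (\<lambda>k. 1) (int l) (\<lambda>k. lift M (\<lambda>i. -1 + (ev k - 12) / ev i) k (leg M)))"
  have l3: "int l \<ge> 3"
    using l by simp
  let ?a = "sfield (of_real C) M (leg M (int l))" and ?b = "sfield d M (leg M (int l))" and ?U = "sfield 1 0 f"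
  have R: "eq_C (cR g (e 3 0) (e l m) (e 3 0)) (sfield (of_real C) M T, sfield d M T)"
    unfolding T_def by (rule cR_zonal[OF f l3 adm u v])
  have ev: "eq_C (e l m) (?a, ?b)" and eu: "eq_C (e 3 0) (?U, (\<lambda>p. 0))"
    using u v by (simp_all add: eq_C_def)
  note herms = eq_C_herm[OF R ev] eq_C_herm[OF eu eu] eq_C_herm[OF ev ev] eq_C_herm[OF eu ev]
  show ?thesis
  proof (cases "M = 0")
    \<comment> \<open>Numerator and \<open>curv_formula\<close> both carry the factor M^2, so the
      quotient is settled without computing its denominator.\<close>
    case True
    then have "T = 0"
      by (simp add: T_def)
    then have "herm (cR g (e 3 0) (e l m) (e 3 0)) (e l m) = 0"
      unfolding herms by (simp add: herm_def sfield_zero_eq ip_zero_left complex_eq_iff)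
    then show ?thesis
      using True M(3) by (simp add: sec_curv_def curv_formula_def)
  next
    case False
    let ?K = "curv_formula l m"
    \<comment> \<open>c and d' are independent because the Hermitian product also pairs real with
      imaginary parts; all four pairings scale by the same K.\<close>
    have T: "ip (sfield c M T) (sfield d' M (leg M (int l))) = ?K * ip (sfield c M (leg M (int l))) (sfield d' M (leg M (int l)))" for c d'
      unfolding T_def ip_sfield_diff ip_sfield_smult ip_lift_lift[OF False l3]
        curvature_coefficient[OF l k M(2), symmetric]
      by (simp add: algebra_simps)
    have num: "herm (cR g (e 3 0) (e l m) (e 3 0)) (e l m) = of_real (?K * (ip ?a ?a + ip ?b ?b))"
      unfolding herms by (simp add: herm_def T complex_eq_iff ip_commute[of ?b ?a] algebra_simps)
    have uu: "Re (herm (e 3 0) (e 3 0)) = 1"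
      unfolding herms by (simp add: herm_def ip_zonal_self[OF f(2) k] ip_zero_left)
    have vv: "Re (herm (e l m) (e l m)) = ip ?a ?a + ip ?b ?b"
      unfolding herms by (simp add: herm_def)
    have uv: "herm (e 3 0) (e l m) = 0"
      unfolding herms by (simp add: herm_def ip_zonal[OF False] ip_zero_left complex_eq_iff)
    have "ip ?a ?a + ip ?b ?b > 0"
      using ip_leg_pos[OF False M(1) C] ip_self_nonneg[OF sfield_continuous, of d M "leg M (int l)"] by simp
    then show ?thesis
      unfolding sec_curv_def num uu vv uv by (simp del: of_real_add of_real_mult add: of_real_divide[symmetric])
  qed
qed

theorem theorem5:
  fixes l :: nat and m :: int
  assumes "l \<ge> 3" and "- int l \<le> m" and "m \<le> int l" and "(l, m) \<noteq> (3, 0)"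
  shows "sec_curv sdiff_S2 (e 3 0) (e l m) = complex_of_real (curv_formula l m) \<and>
         (odd l \<longrightarrow> sec_curv sdiff_RP2 (e 3 0) (e l m) = complex_of_real (curv_formula l m))"
  using sec_curv_e[OF assms(1-3)] by blast

end
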